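(* Let $d\in\mathbb N^*$, let $(\tilde p,\tilde s)\in[1,+\infty]\times\mathbb R$ and $\tilde\chi\in L^{\tilde p}_{\tilde s}$. Let $\omega$ be a concave modulus of continuity for which there exist $\tilde\imath\in\,]0,1]$ and $c,\bar z>0$ with $c\,z^{\tilde\imath}\le\omega(z)$ for all $z\in[0,\bar z]$. Let $(l,s,\imath)\in\mathbb N\times\mathbb R_+\times[0,\tilde\imath]$, and choose $(p,q,r)\in[1,+\infty]^3$ such that $$\frac1{\tilde p}+\frac1p+\frac1q=1+\frac1r .$$ Then the Yukawa bilinear map defines a continuous bilinear map $$\mathcal B_{\tilde\chi}:L^p_{l+s-\tilde s+\tilde\imath}(\mathcal C^0_b)\times W^{l,q}_{s,\imath}(\mathcal C^\omega_b)\longrightarrow W^{l,r}_{s,\imath}(\mathcal C^\omega_b).$$ More precisely, one has the estimate $$\|\mathcal B_{\tilde\chi}[w,\mathsf w]\|_{W^{l,r}_{s,\imath}(\mathcal C^\omega_b)}\lesssim \|\tilde\chi\|_{L^{\tilde p}_{\tilde s}}\,\|w\|_{L^p_{l+s-\tilde s+\tilde\imath}(L^\infty)}\,\|\mathsf w\|_{W^{l,q}_{s,\imath}(\mathcal C^\omega_b)} .$$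
   Context: $\langle k\rangle:=(1+|k|^2)^{1/2}$. For a Banach space $B$, $\|f\|_{L^p_s(B)}:=\|\langle k\rangle^sf(k)\|_{L^p(\mathbb R^d;B)}$; $L^p_s:=L^p_s(\mathbb C)$. $\mathcal C^0_b$ denotes the bounded continuous functions of $\eta\in\mathbb R^d$ with the sup norm; $L^\infty$ inside $L^p_s(L^\infty)$ refers to the variable $\eta$. The symbol $\lesssim$ means inequality up to a multiplicative constant not depending on $\tilde\chi$, $w$, $\mathsf w$. A concave modulus of continuity is a concave increasing function $\omega:\mathbb R_+\to\mathbb R_+$ vanishing at $0$ and continuous at $0$. For a function $f$ of $\eta$, $|f|_\omega:=\sup_{\eta_1\ne\eta_2}\frac{|f(\eta_1)-f(\eta_2)|}{\omega(|\eta_1-\eta_2|)}$; $\mathcal C^\omega_b$ is the space of bounded continuous $f$ with $\|f\|_{L^\infty}+|f|_\omega<\infty$. For functions $w(k,\eta)$ on $\mathbb R^d\times\mathbb R^d$: $$\|w\|_{L^p_{s,\imath}(\mathcal C^\omega_b)}:=\bigl\|k\mapsto\langle k\rangle^{s+\imath}\|w(k,\cdot)\|_{L^\infty_\eta}+\langle k\rangle^s|w(k,\cdot)|_\omega\bigr\|_{L^p_k},\qquad \|w\|_{W^{l,p}_{s,\imath}(\mathcal C^\omega_b)}:=\sum_{|\alpha|\le l}\bigl\|\langle k\rangle^{l-|\alpha|}\partial^\alpha_\eta w\bigr\|_{L^p_{s,\imath}(\mathcal C^\omega_b)} .$$ Yukawa bilinear map: with $\mathcal I w(k,\eta):=\frac12[w(k,\eta)+\overline{w}(-k,-\eta)]$,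 $$\mathcal B_{\tilde\chi}[w_1,w_2](k,\eta):=\frac{2}{(2\pi)^d}\int_{\mathbb R^d}\sin(\tilde k\cdot\eta/2)\,\tilde\chi(\tilde k)\,\mathcal I w_1(\tilde k,0)\,\mathcal I w_2(k-\tilde k,\eta)\,d\tilde k .$$
   Formalization: The formal theorem adds the condition 1/p̃ + 1/p ≤ 1 (equivalently r ≥ q); without it the product χ̃·w need not be locally integrable, the integral defining the Yukawa map can diverge, and the claim fails. *)

theory Defs
  imports "HOL-Analysis.Analysis" "HOL-Probability.Essential_Supremum"
begin

section \<open>Weighted Lebesgue norms\<close>

definition japanese :: "'a::real_normed_vector \<Rightarrow> real" where
  "japanese k = sqrt (1 + (norm k)\<^sup>2)"

text \<open>Only used with a positive exponent.\<close>

definition ennreal_powr :: "ennreal \<Rightarrow> real \<Rightarrow> ennreal" where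
  "ennreal_powr x a = (if x = top then top else ennreal (enn2real x powr a))"

definition Lp_norm :: "ennreal \<Rightarrow> ('a::euclidean_space \<Rightarrow> ennreal) \<Rightarrow> ennreal" where
  "Lp_norm p f =
     (if p = top then esssup lebesgue f
      else ennreal_powr (\<integral>\<^sup>+k. ennreal_powr (f k) (enn2real p) \<partial>lebesgue) (1 / enn2real p))"

text \<open>The norm of \<open>L\<^sup>p\<^sub>s(B)\<close>, where \<open>N\<close> is the norm of \<open>B\<close> with values in \<open>[0, \<infinity>]\<close>.\<close>

definition Lps_norm ::
  "('b \<Rightarrow> ennreal) \<Rightarrow> ennreal \<Rightarrow> real \<Rightarrow> ('a::euclidean_space \<Rightarrow> 'b) \<Rightarrow> ennreal" where
  "Lps_norm N p s f = Lp_norm p (\<lambda>k. ennreal (japanese k powr s) * N (f k))"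

definition scalar_norm :: "complex \<Rightarrow> ennreal" where
  "scalar_norm z = ennreal (norm z)"

text \<open>Only applied to continuous functions, for which it is the norm of \<open>L\<^sup>\<infinity>\<close>.\<close>

definition sup_norm :: "('a \<Rightarrow> complex) \<Rightarrow> ennreal" where
  "sup_norm f = (SUP \<eta>. ennreal (norm (f \<eta>)))"

definition Lps :: "ennreal \<Rightarrow> real \<Rightarrow> ('a::euclidean_space \<Rightarrow> complex) set" where
  "Lps p s = {f \<in> borel_measurable lebesgue. Lps_norm scalar_norm p s f < top}"

text \<open>Elements of function-valued Lebesgue spaces are functions of \<open>(k, \<eta>)\<close>, in curried form
  \<open>w k \<eta>\<close>, that represent their class modulo equality for almost every \<open>k\<close>. Measurability in \<open>k\<close>
  is required at every fixed \<open>\<eta>\<close>; by continuity in \<open>\<eta>\<close> this amounts to joint measurability.\<close>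

definition Lps_Cb :: "ennreal \<Rightarrow> real \<Rightarrow> ((real^'d) \<Rightarrow> (real^'d) \<Rightarrow> complex) set" where
  "Lps_Cb p s = {w. (\<forall>\<eta>. (\<lambda>k. w k \<eta>) \<in> borel_measurable lebesgue) \<and>
                    (AE k in lebesgue. w k \<in> bcontfun) \<and>
                    Lps_norm sup_norm p s w < top}"

section \<open>Moduli of continuity\<close>

definition concave_modulus :: "(real \<Rightarrow> real) \<Rightarrow> bool" where
  "concave_modulus \<omega> \<longleftrightarrow>
     (\<forall>z\<ge>0. 0 \<le> \<omega> z) \<and> concave_on {0..} \<omega> \<and> mono_on {0..} \<omega> \<and>
     \<omega> 0 = 0 \<and> continuous (at 0 within {0..}) \<omega>"

definition modulus_seminorm ::
  "(real \<Rightarrow> real) \<Rightarrow> ('a::metric_space \<Rightarrow> complex) \<Rightarrow> ennreal" where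
  "modulus_seminorm \<omega> f =
     (SUP (\<eta>\<^sub>1, \<eta>\<^sub>2) \<in> {(\<eta>\<^sub>1, \<eta>\<^sub>2). \<eta>\<^sub>1 \<noteq> \<eta>\<^sub>2}.
        ennreal (norm (f \<eta>\<^sub>1 - f \<eta>\<^sub>2)) / ennreal (\<omega> (dist \<eta>\<^sub>1 \<eta>\<^sub>2)))"

definition Cb_modulus :: "(real \<Rightarrow> real) \<Rightarrow> ('a::metric_space \<Rightarrow> complex) set" where
  "Cb_modulus \<omega> = {f \<in> bcontfun. sup_norm f + modulus_seminorm \<omega> f < top}"

section \<open>Partial derivatives\<close>

definition partial_diff :: "'d \<Rightarrow> (real^'d \<Rightarrow> complex) \<Rightarrow> real^'d \<Rightarrow> complex" where
  "partial_diff i f \<eta> = vector_derivative (\<lambda>t. f (\<eta> + t *\<^sub>R axis i 1)) (at 0)"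

primrec C_n :: "nat \<Rightarrow> (real^'d \<Rightarrow> complex) \<Rightarrow> bool" where
  "C_n 0 f \<longleftrightarrow> continuous_on UNIV f"
| "C_n (Suc n) f \<longleftrightarrow> continuous_on UNIV f \<and>
     (\<forall>i. (\<forall>\<eta>. (\<lambda>t. f (\<eta> + t *\<^sub>R axis i 1)) differentiable (at 0)) \<and> C_n n (partial_diff i f))"

text \<open>A multi-index is a function \<open>\<alpha> :: 'd \<Rightarrow> nat\<close>. The partial derivatives are applied in an
  arbitrary order in which the direction \<open>i\<close> occurs \<open>\<alpha> i\<close> times. The order is irrelevant
  on functions of class \<open>C\<^sup>n\<close> with \<open>n \<ge> |\<alpha>|\<close>, the only ones to which this is applied.\<close>

definition multi_diff :: "('d::finite \<Rightarrow> nat) \<Rightarrow> (real^'d \<Rightarrow> complex) \<Rightarrow> real^'d \<Rightarrow> complex" where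
  "multi_diff \<alpha> f = foldr partial_diff (SOME xs. \<forall>i. count_list xs i = \<alpha> i) f"

lemma ex_directions: "\<exists>xs. \<forall>i. count_list xs i = (\<alpha> i :: nat)" for \<alpha> :: "'d::finite \<Rightarrow> nat"
proof -
  obtain xs where xs: "mset xs = Abs_multiset \<alpha>"
    using ex_mset by blast
  have "count_list xs i = \<alpha> i" for i
    using xs by (simp add: Abs_multiset_inverse flip: count_mset)
  then show ?thesis by blast
qed

abbreviation multi_order :: "('d::finite \<Rightarrow> nat) \<Rightarrow> nat" where
  "multi_order \<alpha> \<equiv> \<Sum>i\<in>UNIV. \<alpha> i"

lemma finite_multi_order_le: "finite {\<alpha> :: 'd::finite \<Rightarrow> nat. multi_order \<alpha> \<le> l}"
proof (rule finite_subset)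
  show "{\<alpha> :: 'd \<Rightarrow> nat. multi_order \<alpha> \<le> l} \<subseteq> UNIV \<rightarrow>\<^sub>E {..l}"
  proof
    fix \<alpha> :: "'d \<Rightarrow> nat"
    assume "\<alpha> \<in> {\<alpha>. multi_order \<alpha> \<le> l}"
    moreover have "\<alpha> i \<le> multi_order \<alpha>" for i
      by (rule member_le_sum) simp_all
    ultimately have "\<alpha> i \<le> l" for i
      using order_trans by blast
    then show "\<alpha> \<in> UNIV \<rightarrow>\<^sub>E {..l}"
      by (simp add: PiE_iff)
  qed
  show "finite (UNIV \<rightarrow>\<^sub>E {..l} :: ('d \<Rightarrow> nat) set)"
    by (rule finite_PiE) simp_all
qed

section \<open>The spaces \<open>W\<close>\<close>

definition Lps_modulus_norm ::
  "(real \<Rightarrow> real) \<Rightarrow> ennreal \<Rightarrow> real \<Rightarrow> real \<Rightarrow> ((real^'d) \<Rightarrow> (real^'d) \<Rightarrow> complex) \<Rightarrow> ennreal" where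
  "Lps_modulus_norm \<omega> p s \<iota> w =
     Lp_norm p (\<lambda>k. ennreal (japanese k powr (s + \<iota>)) * sup_norm (w k) +
                    ennreal (japanese k powr s) * modulus_seminorm \<omega> (w k))"

definition W_norm ::
  "(real \<Rightarrow> real) \<Rightarrow> nat \<Rightarrow> ennreal \<Rightarrow> real \<Rightarrow> real \<Rightarrow> ((real^'d) \<Rightarrow> (real^'d) \<Rightarrow> complex) \<Rightarrow> ennreal"
  where
  "W_norm \<omega> l p s \<iota> w =
     (\<Sum>\<alpha> | multi_order \<alpha> \<le> l.
        Lps_modulus_norm \<omega> p s \<iota> (\<lambda>k \<eta>. japanese k ^ (l - multi_order \<alpha>) *\<^sub>R multi_diff \<alpha> (w k) \<eta>))"

text \<open>Continuous distributional derivatives are classical ones, so that the \<open>\<eta>\<close>-derivatives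
  can be taken in the classical sense for almost every \<open>k\<close>.\<close>

definition W ::
  "(real \<Rightarrow> real) \<Rightarrow> nat \<Rightarrow> ennreal \<Rightarrow> real \<Rightarrow> real \<Rightarrow> ((real^'d) \<Rightarrow> (real^'d) \<Rightarrow> complex) set" where
  "W \<omega> l p s \<iota> =
     {w. (\<forall>\<eta>. (\<lambda>k. w k \<eta>) \<in> borel_measurable lebesgue) \<and>
         (AE k in lebesgue. C_n l (w k) \<and>
            (\<forall>\<alpha>. multi_order \<alpha> \<le> l \<longrightarrow> multi_diff \<alpha> (w k) \<in> Cb_modulus \<omega>)) \<and>
         W_norm \<omega> l p s \<iota> w < top}"

section \<open>The Yukawa bilinear map\<close>

text \<open>Because of the complex conjugation, the symmetrisation, and hence the Yukawa map in each
  argument, is linear over the reals only.\<close>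

definition sym_part ::
  "((real^'d) \<Rightarrow> (real^'d) \<Rightarrow> complex) \<Rightarrow> (real^'d) \<Rightarrow> (real^'d) \<Rightarrow> complex" where
  "sym_part w k \<eta> = (w k \<eta> + cnj (w (- k) (- \<eta>))) / 2"

definition yukawa_integrand ::
  "(real^'d \<Rightarrow> complex) \<Rightarrow> ((real^'d) \<Rightarrow> (real^'d) \<Rightarrow> complex) \<Rightarrow> ((real^'d) \<Rightarrow> (real^'d) \<Rightarrow> complex) \<Rightarrow>
     (real^'d) \<Rightarrow> (real^'d) \<Rightarrow> (real^'d) \<Rightarrow> complex" where
  "yukawa_integrand chi w\<^sub>1 w\<^sub>2 k \<eta> k' =
     complex_of_real (sin (k' \<bullet> \<eta> / 2)) * chi k' * sym_part w\<^sub>1 k' 0 * sym_part w\<^sub>2 (k - k') \<eta>"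

definition yukawa ::
  "(real^'d \<Rightarrow> complex) \<Rightarrow> ((real^'d) \<Rightarrow> (real^'d) \<Rightarrow> complex) \<Rightarrow> ((real^'d) \<Rightarrow> (real^'d) \<Rightarrow> complex) \<Rightarrow>
     (real^'d) \<Rightarrow> (real^'d) \<Rightarrow> complex" where
  "yukawa chi w\<^sub>1 w\<^sub>2 k \<eta> =
     complex_of_real (2 / (2 * pi) ^ CARD('d)) * (LINT k'|lebesgue. yukawa_integrand chi w\<^sub>1 w\<^sub>2 k \<eta> k')"

end

theory Submission
  imports Defs
begin

text \<open>For fixed \<open>k\<close>, the function \<open>B(k, \<cdot>)\<close>, where \<open>B\<close> is the value of the Yukawa map at \<open>(w, v)\<close>, is an integral over \<open>k'\<close> of functions of
\<open>\<eta>\<close>, each of which is the product of the amplitude \<open>chi(k') Iw(k', 0)\<close>, of the plane wave \<open>sin(k' \<bullet> \<eta> / 2)\<close>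
and of \<open>Iv(k - k', \<eta>)\<close>, where \<open>I\<close> denotes the symmetric part. Write \<open>\<langle>k\<rangle>\<close> for the weight.

The estimate is pointwise in \<open>k\<close> and \<open>k'\<close> at first. Each derivative in \<open>\<eta>\<close> that falls on the wave costs a factor
\<open>\<langle>k'\<rangle>\<close>. Measuring the oscillation of the wave by \<open>\<omega>\<close> costs \<open>\<langle>k'\<rangle>\<^bsup>\<iota>'\<^esup>\<close>: a bounded Lipschitz function is Hoelder
continuous of exponent \<open>\<iota>'\<close>, and \<open>\<omega>\<close> dominates \<open>z\<^bsup>\<iota>'\<^esup>\<close> near 0 and stays away from 0 elsewhere. Finally, the weight
in \<open>k\<close> is split by \<open>\<langle>k\<rangle> \<le> 2 \<langle>k'\<rangle> \<langle>k - k'\<rangle>\<close>. In every term of the Leibniz rule the total power of \<open>\<langle>k'\<rangle>\<close> is at most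
\<open>l + s + \<iota>'\<close>, which is the sum of the weights \<open>s'\<close> of \<open>chi\<close> and \<open>l + s - s' + \<iota>'\<close> of \<open>w\<close>; the power of \<open>\<langle>k - k'\<rangle>\<close> is at
most the one with which the norm of \<open>v\<close> measures the derivatives that fall on \<open>Iv\<close>. This is
\<open>controlled_wave_mult\<close>.

Consequently the integrand of the norm of \<open>B\<close> is bounded by a convolution \<open>(h * g)(k)\<close>, where \<open>h\<close> is the weighted
amplitude and \<open>g\<close> the symmetrized integrand of the norm of \<open>v\<close>. The Hoelder inequality puts \<open>h\<close> into \<open>L\<^sup>a\<close> with
\<open>1/a = 1/p' + 1/p\<close>, and the Young inequality puts \<open>h * g\<close> into \<open>L\<^sup>r\<close> because \<open>1/a + 1/q = 1 + 1/r\<close>. Both are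
proved with infinite exponents included, as \<open>majorized_mult\<close> and \<open>majorized_convolution\<close>, by expressing
membership in \<open>L\<^sup>p\<close> as domination by the power \<open>1/p\<close> of an integrable function.

The convolution is finite for almost every \<open>k\<close>. At such \<open>k\<close> the same bound dominates all
derivatives up to order \<open>l\<close>, so that they can be taken under the integral (\<open>C_n_integral\<close>,
\<open>controlled_integral\<close>); this gives the regularity of \<open>B\<close>, and with the convergence of the integrals also
the bilinearity. As the norm in \<open>L\<^sup>\<infinity>\<close> of a function that is not measurable is infinite, measurability in \<open>k\<close> of the
suprema over \<open>\<eta>\<close> is established as well, by continuity in \<open>\<eta>\<close>.\<close>

section \<open>Powers and the inequality of the means\<close>

text \<open>The exponents that occur stem from reciprocals \<open>1 / p\<close>, and \<open>p = \<infinity>\<close> corresponds to the exponent 0.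
Then the power has to be 1 even at the base 0, where \<open>powr\<close> is 0.\<close>

definition rpow :: "real \<Rightarrow> real \<Rightarrow> real" where
  "rpow a t = (if t = 0 then 1 else a powr t)"

lemma rpow_nonneg [simp]: "0 \<le> rpow a t"
  by (simp add: rpow_def)

lemma rpow_mono: "0 \<le> a \<Longrightarrow> a \<le> b \<Longrightarrow> 0 \<le> t \<Longrightarrow> rpow a t \<le> rpow b t"
  by (simp add: rpow_def powr_mono2)

lemma rpow_rpow: "0 \<le> a \<Longrightarrow> rpow (rpow a x) y = rpow a (x * y)"
  by (simp add: rpow_def powr_powr)

lemma rpow_mult: "0 \<le> a \<Longrightarrow> 0 \<le> b \<Longrightarrow> rpow (a * b) t = rpow a t * rpow b t"
  by (simp add: rpow_def powr_mult)

lemma rpow_add: "0 \<le> x \<Longrightarrow> 0 \<le> y \<Longrightarrow> rpow a (x + y) = rpow a x * rpow a y"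
  by (auto simp add: rpow_def powr_add)

lemma rpow_divide: "0 \<le> a \<Longrightarrow> 0 < b \<Longrightarrow> rpow (a / b) t = rpow a t / rpow b t"
  by (simp add: rpow_def powr_divide)

lemma measurable_rpow [measurable (raw)]:
  assumes [measurable]: "f \<in> borel_measurable M"
  shows "(\<lambda>x. rpow (f x) t) \<in> borel_measurable M"
  unfolding rpow_def by measurable

lemma rpow_AM_GM2:
  assumes "0 \<le> a" "0 \<le> b" "0 \<le> x" "0 \<le> y" "x + y = 1"
  shows "rpow a x * rpow b y \<le> x * a + y * b"
proof (cases "x = 0 \<or> y = 0")
  case True
  then show ?thesis using assms by (auto simp: rpow_def)
next
  case False
  then show ?thesis
    using Youngs_inequality_0[of x y a b] assms by (cases "a = 0 \<or> b = 0") (auto simp: rpow_def)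
qed

text \<open>For \<open>z < 1\<close>, the first two factors form, by the inequality for two numbers with the weights \<open>x / (x + y)\<close>
and \<open>y / (x + y)\<close>, at most the power \<open>x + y\<close> of a weighted mean, which is then paired with \<open>c\<close>.\<close>

lemma rpow_AM_GM3:
  assumes "0 \<le> a" "0 \<le> b" "0 \<le> c" "0 \<le> x" "0 \<le> y" "0 \<le> z" "x + y + z = 1"
  shows "rpow a x * rpow b y * rpow c z \<le> x * a + y * b + z * c"
proof (cases "z = 1")
  case True
  then have "x = 0" "y = 0" using assms by auto
  then show ?thesis using True assms by (simp add: rpow_def)
next
  case False
  define u where "u = x + y"
  have u: "0 < u" "z = 1 - u" using False assms by (auto simp: u_def)
  have "x / u + y / u = 1" using u by (simp add: u_def flip: add_divide_distrib)
  then have "rpow a (x / u) * rpow b (y / u) \<le> x / u * a + y / u * b"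
    using assms u by (intro rpow_AM_GM2) auto
  then have "rpow (rpow a (x / u) * rpow b (y / u)) u \<le> rpow (x / u * a + y / u * b) u"
    using u by (intro rpow_mono) auto
  moreover have "rpow (rpow a (x / u) * rpow b (y / u)) u = rpow a x * rpow b y"
    using u assms by (simp add: rpow_mult rpow_rpow)
  ultimately have "rpow a x * rpow b y * rpow c z \<le> rpow (x / u * a + y / u * b) u * rpow c z"
    by (intro mult_right_mono) auto
  also have "\<dots> \<le> u * (x / u * a + y / u * b) + z * c"
    using assms u by (intro rpow_AM_GM2) auto
  also have "\<dots> = x * a + y * b + z * c" using u by (simp add: field_simps)
  finally show ?thesis .
qed

section \<open>Membership in a Lebesgue space by means of a majorant\<close>

text \<open>The unit ball of nonnegative \<open>L\<^sup>1\<close> functions. A measurable nonnegative function has norm at most \<open>N\<close> in \<open>L\<^sup>p\<close> exactly when it is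
almost everywhere at most \<open>N * F\<^bsup>1/p\<^esup>\<close> for some \<open>F\<close> in this ball. In this form the case \<open>p = \<infinity>\<close> is the
exponent 0, and the Hoelder and Young inequalities reduce to the inequality of the means applied
pointwise to the majorants. The majorants are Borel functions with finite values,
whatever the function they dominate.\<close>

definition subunit :: "('a::euclidean_space \<Rightarrow> real) \<Rightarrow> bool" where
  "subunit F \<longleftrightarrow> F \<in> borel_measurable borel \<and> (\<forall>k. 0 \<le> F k) \<and> (\<integral>\<^sup>+k. ennreal (F k) \<partial>lborel) \<le> 1"

definition majorized :: "real \<Rightarrow> real \<Rightarrow> ('a::euclidean_space \<Rightarrow> ennreal) \<Rightarrow> bool" where
  "majorized \<theta> N f \<longleftrightarrow> 0 \<le> N \<and>
     (\<exists>F. subunit F \<and> (AE k in lebesgue. f k \<le> ennreal (N * rpow (F k) \<theta>)))"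

definition recip :: "ennreal \<Rightarrow> real" where
  "recip p = enn2real (1 / p)"

lemma recip_top [simp]: "recip top = 0"
  by (simp add: recip_def)

lemma recip_finite: "1 \<le> p \<Longrightarrow> p \<noteq> top \<Longrightarrow> recip p = 1 / enn2real p \<and> 1 \<le> enn2real p"
  apply (cases p)
   apply (auto simp: recip_def)
   apply (subst ennreal_1[symmetric], subst divide_ennreal)
     apply (auto simp flip: ennreal_1)
  done

lemma recip_bounds: "1 \<le> p \<Longrightarrow> 0 \<le> recip p \<and> recip p \<le> 1"
  using recip_finite[of p] by (cases "p = top") (simp_all add: divide_le_eq_1)

lemma ennreal_recip: "1 \<le> p \<Longrightarrow> ennreal (recip p) = 1 / p"
  unfolding recip_def by (intro ennreal_enn2real) (auto simp: ennreal_divide_eq_top_iff less_top[symmetric])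

lemma AE_lebesgue_iff_lborel: "(AE k in lebesgue. P k) \<longleftrightarrow> (AE k in lborel. P k)"
  by (rule AE_completion_iff)

lemma subunit_zero: "subunit (\<lambda>_. 0)"
  by (simp add: subunit_def)

lemma ennreal_Borel_version:
  assumes "f \<in> borel_measurable lebesgue"
  obtains g :: "'a::euclidean_space \<Rightarrow> ennreal" where "g \<in> borel_measurable borel" "AE k in lebesgue. f k = g k"
  using completion_ex_borel_measurable[OF assms] by (auto simp: AE_completion_iff)

text \<open>For finite \<open>p\<close> and a positive norm \<open>n\<close>, the majorant is \<open>(f / n)\<^sup>p\<close>; if the norm is 0, or if \<open>p = \<infinity>\<close>, the zero
function will do.\<close>

lemma majorized_of_Lp_norm:
  fixes f :: "'a::euclidean_space \<Rightarrow> ennreal"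
  assumes "f \<in> borel_measurable lebesgue" "1 \<le> p" "Lp_norm p f < top"
  shows "majorized (recip p) (enn2real (Lp_norm p f)) f"
proof (cases "p = top")
  case True
  have "AE k in lebesgue. f k \<le> ennreal (enn2real (Lp_norm p f) * rpow 0 0)"
    using esssup_AE[where M=lebesgue and f = f] assms(3) True
    by (simp add: rpow_def Lp_norm_def)
  then show ?thesis using True subunit_zero by (auto simp: majorized_def)
next
  case False
  define P where "P = enn2real p"
  have P: "1 \<le> P" "recip p = 1 / P" using recip_finite[OF assms(2) False] by (auto simp: P_def)
  obtain g where g [measurable]: "g \<in> borel_measurable borel" and fg: "AE k in lebesgue. f k = g k"
    using ennreal_Borel_version[OF assms(1)] by blast
  have [measurable]: "(\<lambda>k. ennreal_powr (g k) P) \<in> borel_measurable borel"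
    unfolding ennreal_powr_def by measurable
  define I where "I = (\<integral>\<^sup>+k. ennreal_powr (f k) P \<partial>lebesgue)"
  have N: "Lp_norm p f = ennreal_powr I (1 / P)" using False by (simp add: Lp_norm_def I_def P_def)
  have Ifin: "I < top" using assms(3) unfolding N by (auto simp: ennreal_powr_def split: if_splits simp: less_top)
  have Ig: "I = (\<integral>\<^sup>+k. ennreal_powr (g k) P \<partial>lborel)"
    unfolding I_def using fg by (subst nn_integral_completion[symmetric]) (intro nn_integral_cong_AE, auto)
  have fin: "AE k in lborel. ennreal_powr (g k) P \<noteq> top"
    using nn_integral_PInf_AE[of "\<lambda>k. ennreal_powr (g k) P" lborel] Ifin unfolding Ig by simp
  have gfin: "AE k in lborel. g k = ennreal (enn2real (g k))"
    using fin by eventually_elim (auto simp: ennreal_powr_def less_top split: if_splits)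
  define n where "n = enn2real (Lp_norm p f)"
  have n: "n = enn2real I powr (1 / P)" using Ifin by (auto simp: n_def N ennreal_powr_def)
  have nP: "n powr P = enn2real I" using P by (simp add: n powr_powr)
  show ?thesis
  proof (cases "enn2real I = 0")
    case True
    then have "I = 0" using Ifin by (auto simp: enn2real_eq_0_iff)
    then have "AE k in lborel. ennreal_powr (g k) P = 0"
      unfolding Ig by (subst (asm) nn_integral_0_iff_AE) auto
    then have "AE k in lborel. g k = 0"
      using gfin by eventually_elim (auto simp: ennreal_powr_def enn2real_eq_0_iff split: if_splits)
    then have "AE k in lebesgue. f k \<le> ennreal (n * rpow 0 (recip p))"
      using fg unfolding AE_lebesgue_iff_lborel by eventually_elim simp
    then show ?thesis using subunit_zero unfolding majorized_def n_def by auto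
  next
    case False
    then have I0: "0 < enn2real I" by (simp add: order_less_le)
    then have n0: "0 < n" by (simp add: n)
    define F where "F k = enn2real (g k) powr P / enn2real I" for k
    have "(\<integral>\<^sup>+k. ennreal (F k) \<partial>lborel) = (\<integral>\<^sup>+k. ennreal_powr (g k) P / I \<partial>lborel)"
    proof (intro nn_integral_cong_AE, use fin in eventually_elim)
      case (elim k)
      then have "ennreal_powr (g k) P = ennreal (enn2real (g k) powr P)"
        by (auto simp: ennreal_powr_def split: if_splits)
      moreover have "I = ennreal (enn2real I)" using Ifin by simp
      ultimately show "ennreal (F k) = ennreal_powr (g k) P / I"
        unfolding F_def using I0 by (metis divide_ennreal powr_ge_zero)
    qed
    also have "\<dots> = I / I" by (simp add: nn_integral_divide Ig)
    also have "\<dots> = 1" using I0 Ifin by (intro ennreal_divide_self) (auto simp: less_top)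
    finally have "(\<integral>\<^sup>+k. ennreal (F k) \<partial>lborel) = 1" .
    moreover have "F \<in> borel_measurable borel" unfolding F_def by measurable
    ultimately have "subunit F" by (auto simp: subunit_def F_def)
    moreover have "AE k in lebesgue. f k \<le> ennreal (n * rpow (F k) (recip p))"
      using fg gfin unfolding AE_lebesgue_iff_lborel
    proof eventually_elim
      case (elim k)
      have "rpow (F k) (1 / P) = enn2real (g k) / n"
        using P I0 by (simp add: F_def rpow_def powr_divide powr_powr n)
      then show ?case using elim n0 P by simp
    qed
    ultimately show ?thesis unfolding majorized_def n_def by auto
  qed
qed

lemma Lp_norm_le_of_majorized:
  fixes f :: "'a::euclidean_space \<Rightarrow> ennreal"
  assumes f: "f \<in> borel_measurable lebesgue" and p: "1 \<le> p" and m: "majorized (recip p) N f"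
  shows "Lp_norm p f \<le> ennreal N"
proof -
  obtain F where F: "subunit F" and N: "0 \<le> N" and le: "AE k in lebesgue. f k \<le> ennreal (N * rpow (F k) (recip p))"
    using m by (auto simp: majorized_def)
  have [measurable]: "F \<in> borel_measurable borel" and F0: "\<And>k. 0 \<le> F k" using F by (auto simp: subunit_def)
  show ?thesis
  proof (cases "p = top")
    case True
    then show ?thesis using le f by (auto simp: Lp_norm_def rpow_def intro: esssup_I)
  next
    case False
    define P where "P = enn2real p"
    have P: "1 \<le> P" "recip p = 1 / P" using recip_finite[OF p False] by (auto simp: P_def)
    have "(\<integral>\<^sup>+k. ennreal_powr (f k) P \<partial>lebesgue) \<le> (\<integral>\<^sup>+k. ennreal (N powr P) * ennreal (F k) \<partial>lebesgue)"
    proof (intro nn_integral_mono_AE, use le in eventually_elim)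
      case (elim k)
      then have ft: "f k \<noteq> top" "enn2real (f k) \<le> N * rpow (F k) (recip p)"
        using N by (auto simp: top_unique intro: enn2real_leI)
      have "enn2real (f k) powr P \<le> (N * rpow (F k) (recip p)) powr P"
        using ft P by (intro powr_mono2) auto
      also have "\<dots> = N powr P * F k"
        using N P F0[of k] by (auto simp: rpow_def powr_mult powr_powr)
      finally show ?case using ft F0 by (simp add: ennreal_powr_def ennreal_mult[symmetric])
    qed
    also have "\<dots> = ennreal (N powr P) * (\<integral>\<^sup>+k. ennreal (F k) \<partial>lborel)"
      by (simp add: nn_integral_completion nn_integral_cmult)
    also have "\<dots> \<le> ennreal (N powr P) * 1"
      using F by (intro mult_left_mono) (auto simp: subunit_def)
    finally have *: "(\<integral>\<^sup>+k. ennreal_powr (f k) P \<partial>lebesgue) \<le> ennreal (N powr P)" by simp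
    then have t: "(\<integral>\<^sup>+k. ennreal_powr (f k) P \<partial>lebesgue) \<noteq> top" by (auto simp: top_unique)
    have "enn2real (\<integral>\<^sup>+k. ennreal_powr (f k) P \<partial>lebesgue) powr (1 / P) \<le> (N powr P) powr (1/P)"
      using * P by (intro powr_mono2) (auto intro: enn2real_leI)
    also have "\<dots> = N" using N P by (simp add: powr_powr)
    finally show ?thesis using False t N by (simp add: Lp_norm_def P_def[symmetric] ennreal_powr_def)
  qed
qed

lemma majorized_mono_AE:
  "majorized \<theta> N g \<Longrightarrow> AE k in lebesgue. f k \<le> g k \<Longrightarrow> majorized \<theta> N f"
  unfolding majorized_def by (fastforce elim: AE_mp)

lemma majorized_finite: "majorized \<theta> N f \<Longrightarrow> AE k in lebesgue. f k < top"
  unfolding majorized_def by (auto elim!: eventually_mono intro: le_less_trans)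

lemma majorized_cmult:
  "majorized \<theta> N f \<Longrightarrow> 0 \<le> c \<Longrightarrow> majorized \<theta> (c * N) (\<lambda>k. ennreal c * f k)"
  unfolding majorized_def
proof (clarsimp, intro exI conjI)
  fix F assume "AE k in lebesgue. f k \<le> ennreal (N * rpow (F k) \<theta>)" "0 \<le> c" "0 \<le> N"
  then show "AE k in lebesgue. ennreal c * f k \<le> ennreal (c * N * rpow (F k) \<theta>)"
    by (auto elim!: eventually_mono simp: ennreal_mult mult.assoc intro: mult_left_mono)
qed

text \<open>The triangle inequality, up to a constant: each majorant is at most the cardinality of \<open>I\<close> times the average of all of them, and the power \<open>\<theta> \<le> 1\<close> of the cardinality is at
most the cardinality.\<close>

lemma majorized_sum:
  assumes I: "finite I" "I \<noteq> {}" and m: "\<And>i. i \<in> I \<Longrightarrow> majorized \<theta> (N i) (f i)" and \<theta>: "0 \<le> \<theta>" "\<theta> \<le> 1"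
  shows "majorized \<theta> (real (card I) * (\<Sum>i\<in>I. N i)) (\<lambda>k. \<Sum>i\<in>I. f i k)"
proof -
  have "\<exists>F. \<forall>i\<in>I. 0 \<le> N i \<and> subunit (F i) \<and> (AE k in lebesgue. f i k \<le> ennreal (N i * rpow (F i k) \<theta>))"
    using m unfolding majorized_def by metis
  then obtain F where F: "\<And>i. i \<in> I \<Longrightarrow> subunit (F i)" and N: "\<And>i. i \<in> I \<Longrightarrow> 0 \<le> N i"
    and le: "\<And>i. i \<in> I \<Longrightarrow> AE k in lebesgue. f i k \<le> ennreal (N i * rpow (F i k) \<theta>)" by blast
  define c where "c = real (card I)"
  have c: "1 \<le> c" using I by (simp add: c_def Suc_le_eq card_gt_0_iff)
  define G where "G k = (\<Sum>i\<in>I. F i k) / c" for k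
  have F0: "0 \<le> F i k" if "i \<in> I" for i k using F[OF that] by (simp add: subunit_def)
  have Fm [measurable]: "F i \<in> borel_measurable borel" if "i \<in> I" for i using F[OF that] by (simp add: subunit_def)
  have "(\<integral>\<^sup>+k. ennreal (G k) \<partial>lborel) = (\<integral>\<^sup>+k. (\<Sum>i\<in>I. ennreal (F i k)) / ennreal c \<partial>lborel)"
    using F0 c by (intro nn_integral_cong) (auto simp: G_def divide_ennreal sum_nonneg)
  also have "\<dots> = (\<Sum>i\<in>I. (\<integral>\<^sup>+k. ennreal (F i k) \<partial>lborel)) / ennreal c"
    by (simp add: nn_integral_divide nn_integral_sum)
  also have "\<dots> \<le> (\<Sum>i\<in>I. 1) / ennreal c"
    using F by (intro divide_right_mono_ennreal sum_mono) (auto simp: subunit_def)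
  also have "\<dots> = 1" using c by (simp add: c_def ennreal_of_nat_eq_real_of_nat ennreal_divide_self)
  finally have "(\<integral>\<^sup>+k. ennreal (G k) \<partial>lborel) \<le> 1" .
  moreover have "G \<in> borel_measurable borel" unfolding G_def by measurable
  moreover have G0: "0 \<le> G k" for k
    unfolding G_def using F0 c by (intro divide_nonneg_nonneg sum_nonneg) auto
  ultimately have "subunit G" by (auto simp: subunit_def)
  moreover have "AE k in lebesgue. (\<Sum>i\<in>I. f i k) \<le> ennreal (c * (\<Sum>i\<in>I. N i) * rpow (G k) \<theta>)"
  proof -
    have "AE k in lebesgue. \<forall>i\<in>I. f i k \<le> ennreal (N i * rpow (F i k) \<theta>)"
      using le I by (intro AE_finite_allI) auto
    then show ?thesis
    proof eventually_elim
      case (elim k)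
      have "rpow (F i k) \<theta> \<le> c * rpow (G k) \<theta>" if i: "i \<in> I" for i
      proof -
        have "rpow (F i k) \<theta> \<le> rpow (c * G k) \<theta>"
          using i c I F0 \<theta> by (intro rpow_mono) (auto simp: G_def intro!: member_le_sum)
        also have "\<dots> = rpow c \<theta> * rpow (G k) \<theta>"
          using c G0 by (intro rpow_mult) auto
        also have "\<dots> \<le> c * rpow (G k) \<theta>"
          using c \<theta> powr_mono[of \<theta> 1 c] by (intro mult_right_mono) (auto simp: rpow_def)
        finally show ?thesis .
      qed
      then have "(\<Sum>i\<in>I. N i * rpow (F i k) \<theta>) \<le> (\<Sum>i\<in>I. N i * (c * rpow (G k) \<theta>))"
        using N by (intro sum_mono mult_left_mono) auto
      also have "\<dots> = c * (\<Sum>i\<in>I. N i) * rpow (G k) \<theta>"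
        by (simp add: sum_distrib_left sum_distrib_right mult_ac)
      finally have "ennreal (\<Sum>i\<in>I. N i * rpow (F i k) \<theta>) \<le> ennreal (c * (\<Sum>i\<in>I. N i) * rpow (G k) \<theta>)"
        by (rule ennreal_leI)
      moreover have "(\<Sum>i\<in>I. f i k) \<le> (\<Sum>i\<in>I. ennreal (N i * rpow (F i k) \<theta>))"
        using elim by (intro sum_mono) auto
      moreover have "\<dots> = ennreal (\<Sum>i\<in>I. N i * rpow (F i k) \<theta>)"
        using N by (intro sum_ennreal) auto
      ultimately show ?case by simp
    qed
  qed
  moreover have "0 \<le> c * (\<Sum>i\<in>I. N i)" using c N by (auto intro!: mult_nonneg_nonneg sum_nonneg)
  ultimately show ?thesis by (auto simp: majorized_def c_def)
qed

text \<open>This is the Hoelder inequality: \<open>F\<^sup>x G\<^sup>y\<close> is at most the power \<open>x + y\<close> of the mean of \<open>F\<close> and \<open>G\<close> with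
weights proportional to \<open>x\<close> and \<open>y\<close>, and such a mean again has integral at most 1.\<close>

lemma majorized_mult:
  assumes f: "majorized x N f" and g: "majorized y M g" and xy: "0 \<le> x" "0 \<le> y" "x + y \<le> 1"
  shows "majorized (x + y) (N * M) (\<lambda>k. f k * g k)"
proof -
  obtain F G where F: "subunit F" "0 \<le> N" and fF: "AE k in lebesgue. f k \<le> ennreal (N * rpow (F k) x)"
    and G: "subunit G" "0 \<le> M" and gG: "AE k in lebesgue. g k \<le> ennreal (M * rpow (G k) y)"
    using f g by (auto simp: majorized_def)
  have F': "0 \<le> F k" "0 \<le> G k" for k using F G by (auto simp: subunit_def)
  have [measurable]: "F \<in> borel_measurable borel" "G \<in> borel_measurable borel" using F G by (auto simp: subunit_def)
  define H where "H k = (x * F k + y * G k) / (x + y)" for k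
  have H0: "0 \<le> H k" for k using F'[of k] xy by (auto simp: H_def)
  have "(\<integral>\<^sup>+k. ennreal (H k) \<partial>lborel) \<le> 1"
  proof (cases "x + y = 0")
    case False
    have "(\<integral>\<^sup>+k. ennreal (H k) \<partial>lborel) = (\<integral>\<^sup>+k. ennreal (x / (x + y)) * ennreal (F k) + ennreal (y / (x + y)) * ennreal (G k) \<partial>lborel)"
      using F' xy False
      by (intro nn_integral_cong) (auto simp: H_def ennreal_mult[symmetric] ennreal_plus[symmetric] add_divide_distrib simp del: ennreal_plus)
    also have "\<dots> = ennreal (x / (x + y)) * (\<integral>\<^sup>+k. ennreal (F k) \<partial>lborel) + ennreal (y / (x + y)) * (\<integral>\<^sup>+k. ennreal (G k) \<partial>lborel)"
      by (simp add: nn_integral_add nn_integral_cmult)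
    also have "\<dots> \<le> ennreal (x / (x + y)) * 1 + ennreal (y / (x + y)) * 1"
      using F G by (intro add_mono mult_left_mono) (auto simp: subunit_def)
    also have "\<dots> = 1" using xy False by (simp add: ennreal_plus[symmetric] add_divide_distrib[symmetric] del: ennreal_plus)
    finally show ?thesis .
  qed (simp add: H_def)
  moreover have "H \<in> borel_measurable borel" unfolding H_def by measurable
  ultimately have "subunit H" using H0 by (simp add: subunit_def)
  moreover have "AE k in lebesgue. f k * g k \<le> ennreal (N * M * rpow (H k) (x + y))"
    using fF gG
  proof eventually_elim
    case (elim k)
    have "rpow (F k) x * rpow (G k) y \<le> rpow (H k) (x + y)"
    proof (cases "x + y = 0")
      case True
      then have "x = 0" "y = 0" using xy by auto
      then show ?thesis by (simp add: rpow_def)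
    next
      case False
      define u where "u = x + y"
      have u: "0 < u" using False xy by (simp add: u_def)
      have "rpow (F k) (x / u) * rpow (G k) (y / u) \<le> x / u * F k + y / u * G k"
        using u xy F' by (intro rpow_AM_GM2) (auto simp: u_def simp flip: add_divide_distrib)
      then have "rpow (rpow (F k) (x / u) * rpow (G k) (y / u)) u \<le> rpow (H k) u"
        using u by (intro rpow_mono) (auto simp: H_def u_def add_divide_distrib)
      then show ?thesis using u F' by (simp add: rpow_mult rpow_rpow u_def[symmetric])
    qed
    then have "N * M * (rpow (F k) x * rpow (G k) y) \<le> N * M * rpow (H k) (x + y)"
      using F G by (intro mult_left_mono) auto
    moreover have "f k * g k \<le> ennreal (N * rpow (F k) x) * ennreal (M * rpow (G k) y)"
      using elim by (intro mult_mono) auto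
    ultimately show ?case using F G
      by (simp add: ennreal_mult[symmetric] mult_ac) (meson ennreal_leI order_trans)
  qed
  ultimately show ?thesis using F G by (auto simp: majorized_def)
qed

lemma lborel_distr_diff: "distr lborel borel (\<lambda>x. t - x) = (lborel :: 'a::euclidean_space measure)"
proof -
  have "lborel = density (distr lborel borel (\<lambda>x::'a. t + (-1) *\<^sub>R x)) (\<lambda>_. 1)"
    using lborel_affine[of "-1" t] by simp
  then show ?thesis by (simp add: density_1)
qed

lemma nn_integral_lborel_diff:
  "f \<in> borel_measurable borel \<Longrightarrow> (\<integral>\<^sup>+x. f (t - x) \<partial>lborel) = (\<integral>\<^sup>+x. f (x::'a::euclidean_space) \<partial>lborel)"
  by (subst (2) lborel_distr_diff[of t, symmetric]) (simp add: nn_integral_distr)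

text \<open>Almost every \<open>k\<close> may be replaced by \<open>t - k\<close> with \<open>t\<close> arbitrary, not just almost every \<open>t\<close>; for
\<open>t = 0\<close> this is the reflection that occurs in the symmetric part.\<close>

lemma AE_lebesgue_diff:
  assumes "AE k in lebesgue. P (k::'a::euclidean_space)"
  shows "AE k in lebesgue. P (t - k)"
proof -
  have "AE k in distr lborel borel (\<lambda>x. t - x). P k"
    using assms unfolding lborel_distr_diff by (simp add: AE_lebesgue_iff_lborel)
  then obtain N where N: "{k. \<not> P k} \<subseteq> N" "N \<in> null_sets (distr lborel borel (\<lambda>x. t - x))"
    by (auto simp: eventually_ae_filter)
  then have "N \<in> sets borel" by (auto simp: null_sets_def)
  then have "AE k in lborel. t - k \<notin> N"
    using AE_not_in[OF N(2)]
    by (subst (asm) AE_distr_iff) (auto simp: Compl_eq[symmetric] Collect_neg_eq)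
  then show ?thesis using N(1) unfolding AE_lebesgue_iff_lborel by (auto elim!: eventually_mono)
qed

lemma AE_lebesgue_uminus:
  "AE k in lebesgue. P k \<Longrightarrow> AE k in lebesgue. P (- k::'a::euclidean_space)"
  using AE_lebesgue_diff[of P 0] by simp

lemma majorized_reflect:
  assumes "majorized \<theta> N f" shows "majorized \<theta> N (\<lambda>k. f (- k))"
proof -
  obtain F where F: "subunit F" "0 \<le> N" and fF: "AE k in lebesgue. f k \<le> ennreal (N * rpow (F k) \<theta>)"
    using assms by (auto simp: majorized_def)
  have [measurable]: "F \<in> borel_measurable borel" using F by (simp add: subunit_def)
  have "(\<integral>\<^sup>+k. ennreal (F (- k)) \<partial>lborel) = (\<integral>\<^sup>+k. ennreal (F k) \<partial>lborel)"
    using nn_integral_lborel_diff[of "\<lambda>k. ennreal (F k)" 0] by simp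
  then have "subunit (\<lambda>k. F (- k))" using F by (simp add: subunit_def)
  moreover have "AE k in lebesgue. f (- k) \<le> ennreal (N * rpow (F (- k)) \<theta>)"
    by (rule AE_lebesgue_uminus[OF fF])
  ultimately show ?thesis using F(2) unfolding majorized_def by blast
qed

text \<open>This is the Young inequality for convolutions. Since \<open>x = \<rho> + (1 - y)\<close> and \<open>y = \<rho> + (1 - x)\<close>, the integrand
is \<open>(F G)\<^bsup>\<rho>\<^esup> F\<^bsup>1-y\<^esup> G\<^bsup>1-x\<^esup>\<close> with \<open>F\<close> taken at \<open>k'\<close> and \<open>G\<close> at \<open>k - k'\<close>, and the three exponents add up to 1. So
the integral is at most \<open>R\<^bsup>\<rho>\<^esup>\<close>, where \<open>R\<close> is the convolution of \<open>F\<close> and \<open>G\<close>, whose integral is at most 1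
by Tonelli's theorem.\<close>

lemma majorized_convolution:
  fixes F G :: "'a::euclidean_space \<Rightarrow> real"
  assumes F: "subunit F" and G: "subunit G" and xy: "x \<le> 1" "y \<le> 1" "x + y = 1 + \<rho>" "0 \<le> \<rho>"
  shows "majorized \<rho> 1 (\<lambda>k. \<integral>\<^sup>+k'. ennreal (rpow (F k') x * rpow (G (k - k')) y) \<partial>lborel)"
proof -
  have [measurable]: "F \<in> borel_measurable borel" "G \<in> borel_measurable borel"
    and F0: "\<And>k. 0 \<le> F k" "\<And>k. 0 \<le> G k"
    and F1: "(\<integral>\<^sup>+k. ennreal (F k) \<partial>lborel) \<le> 1" and G1: "(\<integral>\<^sup>+k. ennreal (G k) \<partial>lborel) \<le> 1"
    using F G by (auto simp: subunit_def)
  have G1': "(\<integral>\<^sup>+k'. ennreal (G (k - k')) \<partial>lborel) \<le> 1" for k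
    using G1 nn_integral_lborel_diff[of "\<lambda>k. ennreal (G k)" k] by simp
  define R where "R k = (\<integral>\<^sup>+k'. ennreal (F k' * G (k - k')) \<partial>lborel)" for k
  have [measurable]: "R \<in> borel_measurable borel"
    unfolding R_def by measurable
  have "(\<integral>\<^sup>+k. R k \<partial>lborel) = (\<integral>\<^sup>+k'. \<integral>\<^sup>+k. ennreal (F k' * G (k - k')) \<partial>lborel \<partial>lborel)"
    unfolding R_def by (rule lborel_pair.Fubini') measurable
  also have "\<dots> = (\<integral>\<^sup>+k'. ennreal (F k') * (\<integral>\<^sup>+k. ennreal (G (k - k')) \<partial>lborel) \<partial>lborel)"
    using F0 by (intro nn_integral_cong) (simp add: ennreal_mult nn_integral_cmult)
  also have "\<dots> \<le> (\<integral>\<^sup>+k'. ennreal (F k') * 1 \<partial>lborel)"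
  proof (intro nn_integral_mono mult_left_mono)
    fix k'
    have "(\<integral>\<^sup>+k. ennreal (G (k - k')) \<partial>lborel) = (\<integral>\<^sup>+k. ennreal (G k) \<partial>distr lborel borel ((+) (- k')))"
      by (subst nn_integral_distr) (auto simp: algebra_simps)
    then show "(\<integral>\<^sup>+k. ennreal (G (k - k')) \<partial>lborel) \<le> 1"
      using G1 by (simp add: lborel_distr_plus)
  qed auto
  also have "\<dots> \<le> 1" using F1 by simp
  finally have R1: "(\<integral>\<^sup>+k. R k \<partial>lborel) \<le> 1" .
  then have "(\<integral>\<^sup>+k. R k \<partial>lborel) \<noteq> \<infinity>" by (auto simp: top_unique)
  then have "AE k in lborel. R k \<noteq> top"
    using nn_integral_PInf_AE[of R lborel] by simp
  then have Rfin: "AE k in lborel. R k = ennreal (enn2real (R k))"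
    by eventually_elim (simp add: less_top)
  then have "(\<integral>\<^sup>+k. ennreal (enn2real (R k)) \<partial>lborel) = (\<integral>\<^sup>+k. R k \<partial>lborel)"
    by (intro nn_integral_cong_AE) auto
  then have "subunit (\<lambda>k. enn2real (R k))" using R1 by (simp add: subunit_def)
  moreover have "AE k in lebesgue. (\<integral>\<^sup>+k'. ennreal (rpow (F k') x * rpow (G (k - k')) y) \<partial>lborel)
      \<le> ennreal (1 * rpow (enn2real (R k)) \<rho>)"
    using Rfin unfolding AE_lebesgue_iff_lborel
  proof eventually_elim
    case (elim k)
    define t where "t = enn2real (R k)"
    have t0: "0 \<le> t" by (simp add: t_def)
    have split: "rpow (F k') x * rpow (G (k - k')) y =
        rpow (F k' * G (k - k')) \<rho> * rpow (F k') (1 - y) * rpow (G (k - k')) (1 - x)" for k'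
    proof -
      have "x = \<rho> + (1 - y)" "y = \<rho> + (1 - x)" using xy by auto
      then have "rpow (F k') x = rpow (F k') \<rho> * rpow (F k') (1 - y)"
        "rpow (G (k - k')) y = rpow (G (k - k')) \<rho> * rpow (G (k - k')) (1 - x)"
        using xy by (metis rpow_add diff_ge_0_iff_ge)+
      then show ?thesis using F0 by (simp add: rpow_mult)
    qed
    show ?case
    proof (cases "t = 0 \<and> \<rho> > 0")
      case True
      then have "R k = 0" using elim by (simp add: t_def)
      then have "AE k' in lborel. ennreal (F k' * G (k - k')) = 0"
        unfolding R_def by (subst (asm) nn_integral_0_iff_AE) auto
      then have "AE k' in lborel. ennreal (rpow (F k') x * rpow (G (k - k')) y) = 0"
      proof eventually_elim
        case (elim k')
        then have "F k' * G (k - k') \<le> 0" by (simp add: ennreal_eq_0_iff)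
          moreover have "0 \<le> F k' * G (k - k')" using F0 by simp
          ultimately have "F k' * G (k - k') = 0" by linarith
        then show ?case unfolding split using True by (simp add: rpow_def)
      qed
      then have "(\<integral>\<^sup>+k'. ennreal (rpow (F k') x * rpow (G (k - k')) y) \<partial>lborel) = 0"
        by (subst nn_integral_0_iff_AE) auto
      then show ?thesis by simp
    next
      case False
      \<comment> \<open>The factor \<open>a\<close> gives the product, as a function of \<open>k'\<close>, mass at most 1, like the other two
        factors; for \<open>\<rho> = 0\<close> the product does not enter, and any value of \<open>a\<close> will do.\<close>
      define a where "a = (if \<rho> = 0 then 0 else 1 / t)"
      have a0: "0 \<le> a" using t0 by (simp add: a_def)
      have at: "rpow (F k' * G (k - k')) \<rho> = rpow t \<rho> * rpow (a * (F k' * G (k - k'))) \<rho>" for k'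
        using False F0 t0 xy by (auto simp: a_def rpow_mult rpow_divide) (auto simp: rpow_def)
      have "(\<integral>\<^sup>+k'. ennreal (rpow (F k') x * rpow (G (k - k')) y) \<partial>lborel)
         \<le> (\<integral>\<^sup>+k'. ennreal (rpow t \<rho>) * (ennreal (\<rho> * a) * ennreal (F k' * G (k - k')) +
               ennreal (1 - y) * ennreal (F k') + ennreal (1 - x) * ennreal (G (k - k'))) \<partial>lborel)"
      proof (intro nn_integral_mono)
        fix k'
        have "rpow (a * (F k' * G (k - k'))) \<rho> * rpow (F k') (1 - y) * rpow (G (k - k')) (1 - x)
           \<le> \<rho> * (a * (F k' * G (k - k'))) + (1 - y) * F k' + (1 - x) * G (k - k')"
          using F0 a0 xy by (intro rpow_AM_GM3) auto
        then have "rpow t \<rho> * (rpow (a * (F k' * G (k - k'))) \<rho> * rpow (F k') (1 - y) * rpow (G (k - k')) (1 - x))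
           \<le> rpow t \<rho> * (\<rho> * (a * (F k' * G (k - k'))) + (1 - y) * F k' + (1 - x) * G (k - k'))"
          by (intro mult_left_mono) auto
        then have "rpow (F k') x * rpow (G (k - k')) y \<le> rpow t \<rho> * (\<rho> * (a * (F k' * G (k - k'))) + (1 - y) * F k' + (1 - x) * G (k - k'))"
          unfolding split at by (simp only: mult.assoc)
        then show "ennreal (rpow (F k') x * rpow (G (k - k')) y) \<le> ennreal (rpow t \<rho>) * (ennreal (\<rho> * a) * ennreal (F k' * G (k - k')) +
               ennreal (1 - y) * ennreal (F k') + ennreal (1 - x) * ennreal (G (k - k')))"
          using F0 a0 xy
          by (simp add: ennreal_mult[symmetric] ennreal_plus[symmetric] mult.assoc ennreal_leI del: ennreal_plus)
      qed
      also have "\<dots> = ennreal (rpow t \<rho>) * (ennreal (\<rho> * a) * R k +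
               ennreal (1 - y) * (\<integral>\<^sup>+k'. ennreal (F k') \<partial>lborel) + ennreal (1 - x) * (\<integral>\<^sup>+k'. ennreal (G (k - k')) \<partial>lborel))"
        unfolding R_def by (simp add: nn_integral_cmult nn_integral_add)
      also have "\<dots> \<le> ennreal (rpow t \<rho>) * (ennreal \<rho> + ennreal (1 - y) * 1 + ennreal (1 - x) * 1)"
      proof (intro mult_left_mono add_mono)
        show "ennreal (\<rho> * a) * R k \<le> ennreal \<rho>"
          using elim False t0 xy by (subst elim) (auto simp: a_def t_def[symmetric] ennreal_mult[symmetric])
      qed (use F1 G1' in auto)
      also have "\<dots> = ennreal (rpow t \<rho> * 1)"
        using xy by (simp add: ennreal_mult[symmetric] ennreal_plus[symmetric] del: ennreal_plus)
      finally show ?thesis by (simp add: t_def)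
    qed
  qed
  ultimately show ?thesis
    unfolding majorized_def by (intro conjI exI[of _ "\<lambda>k. enn2real (R k)"]) auto
qed

section \<open>Calculus of iterated partial derivatives\<close>

text \<open>Iterated derivatives are indexed by the list of their directions, because lists lend
themselves to induction; the return to multi-indices is made at the end of this section.\<close>

definition has_partial :: "(real^'d \<Rightarrow> complex) \<Rightarrow> 'd \<Rightarrow> (real^'d \<Rightarrow> complex) \<Rightarrow> bool" where
  "has_partial f i f' \<longleftrightarrow>
     (\<forall>\<eta>. ((\<lambda>t. f (\<eta> + t *\<^sub>R axis i 1)) has_vector_derivative f' \<eta>) (at 0))"

abbreviation iter_diff :: "'d list \<Rightarrow> (real^'d \<Rightarrow> complex) \<Rightarrow> real^'d \<Rightarrow> complex" where
  "iter_diff xs f \<equiv> foldr partial_diff xs f"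

lemma has_partial_imp_eq: "has_partial f i f' \<Longrightarrow> partial_diff i f = f'"
  by (auto simp: has_partial_def partial_diff_def fun_eq_iff intro: vector_derivative_at)

lemma has_partial_line:
  assumes "has_partial f i f'"
  shows "((\<lambda>t. f (\<eta> + t *\<^sub>R axis i 1)) has_vector_derivative f' (\<eta> + t *\<^sub>R axis i 1)) (at t)"
proof -
  have "((\<lambda>u. f ((\<eta> + t *\<^sub>R axis i 1) + u *\<^sub>R axis i 1)) has_vector_derivative f' (\<eta> + t *\<^sub>R axis i 1)) (at (t - t))"
    using assms by (simp add: has_partial_def)
  moreover have "((\<lambda>u. u - t) has_vector_derivative 1) (at t)"
    by (auto intro!: derivative_eq_intros)
  ultimately have "((\<lambda>u. f ((\<eta> + t *\<^sub>R axis i 1) + u *\<^sub>R axis i 1)) \<circ> (\<lambda>u. u - t)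
      has_vector_derivative 1 *\<^sub>R f' (\<eta> + t *\<^sub>R axis i 1)) (at t)"
    by (rule vector_diff_chain_at[rotated])
  then show ?thesis by (simp add: o_def algebra_simps)
qed

lemma has_partial_diffI:
  "(\<forall>\<eta>. (\<lambda>t. f (\<eta> + t *\<^sub>R axis i 1)) differentiable (at 0)) \<Longrightarrow> has_partial f i (partial_diff i f)"
  by (simp add: has_partial_def partial_diff_def vector_derivative_works)

lemma has_partialD: "has_partial f i f' \<Longrightarrow> (\<lambda>t. f (\<eta> + t *\<^sub>R axis i 1)) differentiable (at 0)"
  unfolding has_partial_def by (blast intro: differentiableI_vector)

lemma C_n_SucI:
  assumes "continuous_on UNIV f" "\<And>i. \<exists>f'. has_partial f i f' \<and> C_n n f'"
  shows "C_n (Suc n) f"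
proof -
  have "(\<forall>\<eta>. (\<lambda>t. f (\<eta> + t *\<^sub>R axis i 1)) differentiable (at 0)) \<and> C_n n (partial_diff i f)" for i
  proof -
    obtain f' where f': "has_partial f i f'" "C_n n f'" using assms(2) by blast
    then show ?thesis using has_partialD[OF f'(1)] has_partial_imp_eq[OF f'(1)] by simp
  qed
  then show ?thesis using assms(1) by simp
qed

lemma C_n_SucD: "C_n (Suc n) f \<Longrightarrow> has_partial f i (partial_diff i f) \<and> C_n n (partial_diff i f)"
  by (simp add: has_partial_diffI)

lemma C_n_continuous: "C_n n f \<Longrightarrow> continuous_on UNIV f"
  by (cases n) auto

lemma C_n_antimono: "C_n n f \<Longrightarrow> m \<le> n \<Longrightarrow> C_n m f"
proof (induction n arbitrary: m f)
  case (Suc n)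
  show ?case
  proof (cases m)
    case 0
    then show ?thesis using C_n_continuous[OF Suc.prems(1)] by simp
  next
    case (Suc m')
    have "has_partial f i (partial_diff i f) \<and> C_n m' (partial_diff i f)" for i
      using C_n_SucD[OF Suc.prems(1), of i] Suc.IH[of "partial_diff i f" m'] Suc.prems(2) Suc by auto
    then show ?thesis unfolding Suc using C_n_continuous[OF Suc.prems(1)] by (intro C_n_SucI) auto
  qed
qed simp

lemma C_n_iter_diff: "C_n n f \<Longrightarrow> length xs \<le> n \<Longrightarrow> C_n (n - length xs) (iter_diff xs f)"
proof (induction xs)
  case (Cons x xs)
  then have "C_n (n - length xs) (iter_diff xs f)" by simp
  moreover have "n - length xs = Suc (n - length (x # xs))" using Cons.prems by simp
  ultimately show ?case using C_n_SucD by fastforce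
qed simp

lemma has_partial_iter_diff:
  assumes "C_n n f" "length xs < n"
  shows "has_partial (iter_diff xs f) i (iter_diff (i # xs) f)"
proof -
  have "C_n (n - length xs) (iter_diff xs f)" using assms by (intro C_n_iter_diff) auto
  moreover have "n - length xs = Suc (n - length xs - 1)" using assms by simp
  ultimately show ?thesis using C_n_SucD by (metis foldr.simps(2) comp_apply)
qed

lemma continuous_iter_diff: "C_n n f \<Longrightarrow> length xs \<le> n \<Longrightarrow> continuous_on UNIV (iter_diff xs f)"
  using C_n_iter_diff C_n_continuous by blast

lemma has_partial_add:
  "has_partial f i f' \<Longrightarrow> has_partial g i g' \<Longrightarrow> has_partial (\<lambda>\<eta>. f \<eta> + g \<eta>) i (\<lambda>\<eta>. f' \<eta> + g' \<eta>)"
  by (simp add: has_partial_def has_vector_derivative_add)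

lemma has_partial_mult:
  "has_partial f i f' \<Longrightarrow> has_partial g i g' \<Longrightarrow>
   has_partial (\<lambda>\<eta>. f \<eta> * g \<eta>) i (\<lambda>\<eta>. f' \<eta> * g \<eta> + f \<eta> * g' \<eta>)"
  unfolding has_partial_def
proof
  fix \<eta>
  assume "\<forall>\<eta>. ((\<lambda>t. f (\<eta> + t *\<^sub>R axis i 1)) has_vector_derivative f' \<eta>) (at 0)"
    and "\<forall>\<eta>. ((\<lambda>t. g (\<eta> + t *\<^sub>R axis i 1)) has_vector_derivative g' \<eta>) (at 0)"
  from has_vector_derivative_mult[OF this(1)[rule_format, of \<eta>] this(2)[rule_format, of \<eta>]]
  show "((\<lambda>t. f (\<eta> + t *\<^sub>R axis i 1) * g (\<eta> + t *\<^sub>R axis i 1)) has_vector_derivative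
        f' \<eta> * g \<eta> + f \<eta> * g' \<eta>) (at 0)"
    by (simp add: add.commute)
qed

lemma has_partial_const: "has_partial (\<lambda>\<eta>. c) i (\<lambda>\<eta>. 0)"
  by (simp add: has_partial_def)

lemma has_partial_cmult: "has_partial f i f' \<Longrightarrow> has_partial (\<lambda>\<eta>. c * f \<eta>) i (\<lambda>\<eta>. c * f' \<eta>)"
  using has_partial_mult[OF has_partial_const[of c i], of f f'] by simp

lemma has_partial_reflect:
  assumes "has_partial f i f'"
  shows "has_partial (\<lambda>\<eta>. cnj (f (- \<eta>))) i (\<lambda>\<eta>. - cnj (f' (- \<eta>)))"
  unfolding has_partial_def
proof
  fix \<eta>
  have "((\<lambda>t. f (- \<eta> + t *\<^sub>R axis i 1)) has_vector_derivative f' (- \<eta>)) (at (- 0))"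
    using assms[unfolded has_partial_def, rule_format, of "- \<eta>"] by (simp only: minus_zero)
  moreover have "((\<lambda>t::real. - t) has_vector_derivative - 1) (at 0)"
    by (auto intro!: derivative_eq_intros)
  ultimately have "((\<lambda>t. f (- \<eta> + t *\<^sub>R axis i 1)) \<circ> uminus has_vector_derivative - 1 *\<^sub>R f' (- \<eta>)) (at 0)"
    by (rule vector_diff_chain_at[rotated])
  moreover have "- \<eta> + - t *\<^sub>R axis i 1 = - (\<eta> + t *\<^sub>R axis i 1)" for t by simp
  ultimately have "((\<lambda>t. f (- (\<eta> + t *\<^sub>R axis i 1))) has_vector_derivative - 1 *\<^sub>R f' (- \<eta>)) (at 0)"
    by (simp only: o_def)
  then have "((\<lambda>t. cnj (f (- (\<eta> + t *\<^sub>R axis i 1)))) has_vector_derivative cnj (- 1 *\<^sub>R f' (- \<eta>))) (at 0)"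
    by (rule has_vector_derivative_cnj)
  then show "((\<lambda>t. cnj (f (- (\<eta> + t *\<^sub>R axis i 1)))) has_vector_derivative - cnj (f' (- \<eta>))) (at 0)"
    by simp
qed

lemma C_n_const: "C_n n (\<lambda>\<eta>. c)"
proof (induction n arbitrary: c)
  case (Suc n)
  show ?case using has_partial_const Suc[of 0] by (intro C_n_SucI) auto
qed simp

lemma C_n_add: "C_n n f \<Longrightarrow> C_n n g \<Longrightarrow> C_n n (\<lambda>\<eta>. f \<eta> + g \<eta>)"
proof (induction n arbitrary: f g)
  case (Suc n)
  show ?case
  proof (intro C_n_SucI continuous_intros C_n_continuous[OF Suc.prems(1)] C_n_continuous[OF Suc.prems(2)] exI conjI)
    fix i
    show "has_partial (\<lambda>\<eta>. f \<eta> + g \<eta>) i (\<lambda>\<eta>. partial_diff i f \<eta> + partial_diff i g \<eta>)"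
      using C_n_SucD[OF Suc.prems(1)] C_n_SucD[OF Suc.prems(2)] by (intro has_partial_add) auto
    show "C_n n (\<lambda>\<eta>. partial_diff i f \<eta> + partial_diff i g \<eta>)"
      using C_n_SucD[OF Suc.prems(1)] C_n_SucD[OF Suc.prems(2)] by (intro Suc.IH) auto
  qed
qed (auto intro: continuous_intros)

lemma C_n_mult: "C_n n f \<Longrightarrow> C_n n g \<Longrightarrow> C_n n (\<lambda>\<eta>. f \<eta> * g \<eta>)"
proof (induction n arbitrary: f g)
  case (Suc n)
  show ?case
  proof (intro C_n_SucI continuous_intros C_n_continuous[OF Suc.prems(1)] C_n_continuous[OF Suc.prems(2)] exI conjI)
    fix i
    show "has_partial (\<lambda>\<eta>. f \<eta> * g \<eta>) i (\<lambda>\<eta>. partial_diff i f \<eta> * g \<eta> + f \<eta> * partial_diff i g \<eta>)"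
      using C_n_SucD[OF Suc.prems(1)] C_n_SucD[OF Suc.prems(2)] by (intro has_partial_mult) auto
    show "C_n n (\<lambda>\<eta>. partial_diff i f \<eta> * g \<eta> + f \<eta> * partial_diff i g \<eta>)"
      using C_n_SucD[OF Suc.prems(1), of i] C_n_SucD[OF Suc.prems(2), of i]
        C_n_antimono[OF Suc.prems(1), of n] C_n_antimono[OF Suc.prems(2), of n]
      by (intro C_n_add Suc.IH) (simp_all del: C_n.simps)
  qed
qed (auto intro: continuous_intros)

lemma C_n_reflect: "C_n n f \<Longrightarrow> C_n n (\<lambda>\<eta>. cnj (f (- \<eta>)))"
proof (induction n arbitrary: f)
  case 0
  then show ?case by (auto intro!: continuous_intros continuous_on_compose2[of UNIV f])
next
  case (Suc n)
  have c: "continuous_on UNIV (\<lambda>\<eta>. cnj (f (- \<eta>)))"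
    using C_n_continuous[OF Suc.prems] by (auto intro!: continuous_intros continuous_on_compose2[of UNIV f])
  have "has_partial (\<lambda>\<eta>. cnj (f (- \<eta>))) i (\<lambda>\<eta>. - 1 * cnj (partial_diff i f (- \<eta>)))
      \<and> C_n n (\<lambda>\<eta>. - 1 * cnj (partial_diff i f (- \<eta>)))" for i
    using has_partial_reflect[of f i "partial_diff i f"] C_n_SucD[OF Suc.prems, of i]
      C_n_mult[OF C_n_const[of n "-1"] Suc.IH[of "partial_diff i f"]] by simp
  then show ?case using c by (intro C_n_SucI) blast+
qed

text \<open>All ways of distributing the entries of a list over two lists: the terms of the Leibniz rule, with
their multiplicities.\<close>

primrec splits :: "'a list \<Rightarrow> ('a list \<times> 'a list) list" where
  "splits [] = [([], [])]"
| "splits (x # xs) = map (\<lambda>(a, b). (x # a, b)) (splits xs) @ map (\<lambda>(a, b). (a, x # b)) (splits xs)"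

lemma length_splits_elem: "(a, b) \<in> set (splits xs) \<Longrightarrow> length a + length b = length xs"
  by (induction xs arbitrary: a b) auto

lemma length_splits: "length (splits xs) = 2 ^ length xs"
  by (induction xs) auto

lemma has_partial_sum_list:
  "(\<And>x. x \<in> set xs \<Longrightarrow> has_partial (f x) i (f' x)) \<Longrightarrow>
   has_partial (\<lambda>\<eta>. \<Sum>x\<leftarrow>xs. f x \<eta>) i (\<lambda>\<eta>. \<Sum>x\<leftarrow>xs. f' x \<eta>)"
  by (induction xs) (auto intro: has_partial_const has_partial_add)

lemma sum_list_map_add: "(\<Sum>x\<leftarrow>xs. f x + g x) = (\<Sum>x\<leftarrow>xs. f x) + (\<Sum>x\<leftarrow>xs. (g x :: complex))"
  by (induction xs) auto

lemma iter_diff_mult: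
  assumes "C_n n f" "C_n n g" "length xs \<le> n"
  shows "iter_diff xs (\<lambda>\<eta>. f \<eta> * g \<eta>) = (\<lambda>\<eta>. \<Sum>(a, b)\<leftarrow>splits xs. iter_diff a f \<eta> * iter_diff b g \<eta>)"
  using assms(3)
proof (induction xs)
  case (Cons x xs)
  have "has_partial (\<lambda>\<eta>. \<Sum>p\<leftarrow>splits xs. iter_diff (fst p) f \<eta> * iter_diff (snd p) g \<eta>) x
     (\<lambda>\<eta>. \<Sum>p\<leftarrow>splits xs. iter_diff (x # fst p) f \<eta> * iter_diff (snd p) g \<eta> + iter_diff (fst p) f \<eta> * iter_diff (x # snd p) g \<eta>)"
  proof (intro has_partial_sum_list has_partial_mult has_partial_iter_diff)
    fix p assume "p \<in> set (splits xs)"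
    then have "length (fst p) + length (snd p) = length xs" using length_splits_elem[of "fst p" "snd p" xs] by simp
    then show "length (fst p) < n" "length (snd p) < n" using Cons.prems by auto
  qed (use assms in auto)
  from has_partial_imp_eq[OF this]
  have "partial_diff x (\<lambda>\<eta>. \<Sum>p\<leftarrow>splits xs. iter_diff (fst p) f \<eta> * iter_diff (snd p) g \<eta>) =
     (\<lambda>\<eta>. \<Sum>p\<leftarrow>splits xs. iter_diff (x # fst p) f \<eta> * iter_diff (snd p) g \<eta> + iter_diff (fst p) f \<eta> * iter_diff (x # snd p) g \<eta>)" .
  then show ?case
    using Cons by (simp add: sum_list_map_add case_prod_unfold o_def)
qed simp

lemma iter_diff_add:
  assumes "C_n n f" "C_n n g" "length xs \<le> n"
  shows "iter_diff xs (\<lambda>\<eta>. f \<eta> + g \<eta>) = (\<lambda>\<eta>. iter_diff xs f \<eta> + iter_diff xs g \<eta>)"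
  using assms(3)
proof (induction xs)
  case (Cons x xs)
  have "has_partial (\<lambda>\<eta>. iter_diff xs f \<eta> + iter_diff xs g \<eta>) x (\<lambda>\<eta>. iter_diff (x # xs) f \<eta> + iter_diff (x # xs) g \<eta>)"
    using Cons.prems assms by (intro has_partial_add has_partial_iter_diff) auto
  from has_partial_imp_eq[OF this] show ?case using Cons by simp
qed simp

lemma iter_diff_cmult:
  assumes "C_n n f" "length xs \<le> n"
  shows "iter_diff xs (\<lambda>\<eta>. c * f \<eta>) = (\<lambda>\<eta>. c * iter_diff xs f \<eta>)"
  using assms(2)
proof (induction xs)
  case (Cons x xs)
  have "has_partial (\<lambda>\<eta>. c * iter_diff xs f \<eta>) x (\<lambda>\<eta>. c * iter_diff (x # xs) f \<eta>)"
    using Cons.prems assms by (intro has_partial_cmult has_partial_iter_diff) auto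
  from has_partial_imp_eq[OF this] show ?case using Cons by simp
qed simp

lemma iter_diff_reflect:
  assumes "C_n n f" "length xs \<le> n"
  shows "iter_diff xs (\<lambda>\<eta>. cnj (f (- \<eta>))) = (\<lambda>\<eta>. (- 1) ^ length xs * cnj (iter_diff xs f (- \<eta>)))"
  using assms(2)
proof (induction xs)
  case (Cons x xs)
  have "has_partial (\<lambda>\<eta>. (- 1) ^ length xs * cnj (iter_diff xs f (- \<eta>))) x
      (\<lambda>\<eta>. (- 1) ^ length xs * (- cnj (iter_diff (x # xs) f (- \<eta>))))"
    using Cons.prems assms by (intro has_partial_cmult has_partial_reflect has_partial_iter_diff) auto
  from has_partial_imp_eq[OF this] show ?case using Cons by simp
qed simp

text \<open>The phase makes the family closed under differentiation, up to scalar factors.\<close>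

definition wave :: "real^'d \<Rightarrow> real \<Rightarrow> real^'d \<Rightarrow> complex" where
  "wave \<kappa> \<phi> \<eta> = complex_of_real (sin (\<kappa> \<bullet> \<eta> / 2 + \<phi>))"

lemma has_partial_wave:
  "has_partial (wave \<kappa> \<phi>) i (\<lambda>\<eta>. complex_of_real (\<kappa> $ i / 2) * wave \<kappa> (\<phi> + pi / 2) \<eta>)"
  unfolding has_partial_def
proof
  fix \<eta>
  have "((\<lambda>t. sin (\<kappa> \<bullet> (\<eta> + t *\<^sub>R axis i 1) / 2 + \<phi>)) has_real_derivative
      cos (\<kappa> \<bullet> \<eta> / 2 + \<phi>) * (\<kappa> $ i / 2)) (at 0)"
    by (auto intro!: derivative_eq_intros simp: inner_add_right inner_axis)
  then have "((\<lambda>t. complex_of_real (sin (\<kappa> \<bullet> (\<eta> + t *\<^sub>R axis i 1) / 2 + \<phi>))) has_vector_derivative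
      complex_of_real (cos (\<kappa> \<bullet> \<eta> / 2 + \<phi>) * (\<kappa> $ i / 2))) (at 0)"
    by (intro has_vector_derivative_of_real) (simp add: has_real_derivative_iff_has_vector_derivative)
  moreover have "cos (\<kappa> \<bullet> \<eta> / 2 + \<phi>) = sin (\<kappa> \<bullet> \<eta> / 2 + (\<phi> + pi / 2))"
    by (simp add: sin_add flip: add.assoc)
  ultimately show "((\<lambda>t. wave \<kappa> \<phi> (\<eta> + t *\<^sub>R axis i 1)) has_vector_derivative
      complex_of_real (\<kappa> $ i / 2) * wave \<kappa> (\<phi> + pi / 2) \<eta>) (at 0)"
    by (simp add: wave_def mult.commute)
qed

lemma C_n_wave: "C_n n (wave \<kappa> \<phi>)"
proof (induction n arbitrary: \<phi>)
  case 0
  show ?case by (auto simp: wave_def[abs_def] intro!: continuous_intros)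
next
  case (Suc n)
  have "C_n n (\<lambda>\<eta>. complex_of_real (\<kappa> $ i / 2) * wave \<kappa> (\<phi> + pi / 2) \<eta>)" for i
    by (intro C_n_mult C_n_const Suc)
  moreover have "continuous_on UNIV (wave \<kappa> \<phi>)"
    by (auto simp: wave_def[abs_def] intro!: continuous_intros)
  ultimately show ?case using has_partial_wave by (intro C_n_SucI) blast+
qed

lemma iter_diff_wave:
  "iter_diff xs (wave \<kappa> \<phi>) =
     (\<lambda>\<eta>. complex_of_real (\<Prod>i\<leftarrow>xs. \<kappa> $ i / 2) * wave \<kappa> (\<phi> + real (length xs) * (pi / 2)) \<eta>)"
proof (induction xs)
  case (Cons x xs)
  have "has_partial (\<lambda>\<eta>. complex_of_real (\<Prod>i\<leftarrow>xs. \<kappa> $ i / 2) * wave \<kappa> (\<phi> + real (length xs) * (pi / 2)) \<eta>) x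
    (\<lambda>\<eta>. complex_of_real (\<Prod>i\<leftarrow>xs. \<kappa> $ i / 2) * (complex_of_real (\<kappa> $ x / 2) * wave \<kappa> (\<phi> + real (length xs) * (pi / 2) + pi / 2) \<eta>))"
    by (intro has_partial_cmult has_partial_wave)
  moreover have "\<phi> + real (length xs) * (pi / 2) + pi / 2 = \<phi> + real (length (x # xs)) * (pi / 2)"
    by (simp add: algebra_simps)
  ultimately have "partial_diff x (iter_diff xs (wave \<kappa> \<phi>)) =
    (\<lambda>\<eta>. complex_of_real (\<Prod>i\<leftarrow>xs. \<kappa> $ i / 2) * (complex_of_real (\<kappa> $ x / 2) * wave \<kappa> (\<phi> + real (length (x # xs)) * (pi / 2)) \<eta>))"
    unfolding Cons.IH by (simp only: has_partial_imp_eq)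
  then show ?case by (simp add: mult_ac)
qed simp

lemma linearization_bound:
  fixes f :: "real \<Rightarrow> complex"
  assumes "0 \<le> h" "\<And>t. t \<in> {0..h} \<Longrightarrow> (f has_vector_derivative f' t) (at t)" "\<And>t. t \<in> {0..h} \<Longrightarrow> norm (f' t - c) \<le> B"
  shows "norm (f h - f 0 - h *\<^sub>R c) \<le> B * h"
proof -
  have "norm ((f h - h *\<^sub>R c) - (f 0 - 0 *\<^sub>R c)) \<le> B * norm (h - 0)"
  proof (rule differentiable_bound[where S = "{0..h}" and f' = "\<lambda>t x. x *\<^sub>R (f' t - c)"])
    fix t assume t: "t \<in> {0..h}"
    have "((\<lambda>t. f t - t *\<^sub>R c) has_vector_derivative f' t - c) (at t)"
      using assms(2)[OF t] by (auto intro!: derivative_eq_intros)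
    then show "((\<lambda>t. f t - t *\<^sub>R c) has_derivative (\<lambda>x. x *\<^sub>R (f' t - c))) (at t within {0..h})"
      unfolding has_vector_derivative_def by (rule has_derivative_at_withinI)
    show "onorm (\<lambda>x. x *\<^sub>R (f' t - c)) \<le> B"
      using assms(3)[OF t] onorm_scaleR_left[OF bounded_linear_ident, of "f' t - c"] by (simp add: onorm_id)
  qed (use assms in auto)
  then show ?thesis using assms by (simp add: algebra_simps)
qed

text \<open>The quotient of the second difference by \<open>h\<^sup>2\<close> tends to the mixed derivative, because of two
applications of the mean value inequality: one to \<open>f1\<close> in the direction \<open>j\<close>, one to the difference of \<open>f\<close>
along two parallel lines in the direction \<open>i\<close>. As the second difference is symmetric in \<open>i\<close> and \<open>j\<close>, this
yields the equality of mixed derivatives.\<close>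

lemma second_difference_bound:
  assumes fi: "has_partial f i f1" and fj: "has_partial f1 j f2" and c: "continuous_on UNIV f2" and e: "0 < e"
  shows "\<exists>d>0. \<forall>h. 0 < h \<and> h < d \<longrightarrow>
     norm (f (\<eta> + h *\<^sub>R axis i 1 + h *\<^sub>R axis j 1) - f (\<eta> + h *\<^sub>R axis i 1) - f (\<eta> + h *\<^sub>R axis j 1) + f \<eta> - h\<^sup>2 *\<^sub>R f2 \<eta>) \<le> e * h\<^sup>2"
proof -
  have "continuous (at \<eta>) f2" using c by (simp add: continuous_on_eq_continuous_at)
  then obtain d where d: "0 < d" "\<And>\<xi>. dist \<xi> \<eta> < d \<Longrightarrow> dist (f2 \<xi>) (f2 \<eta>) < e"
    unfolding continuous_at using e by (metis continuous_at_eps_delta continuous_at)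
  have "norm (f (\<eta> + h *\<^sub>R axis i 1 + h *\<^sub>R axis j 1) - f (\<eta> + h *\<^sub>R axis i 1) - f (\<eta> + h *\<^sub>R axis j 1) + f \<eta> - h\<^sup>2 *\<^sub>R f2 \<eta>) \<le> e * h\<^sup>2"
    if h: "0 < h" "h < d / 2" for h
  proof -
    let ?g = "\<lambda>s. f ((\<eta> + h *\<^sub>R axis j 1) + s *\<^sub>R axis i 1) - f (\<eta> + s *\<^sub>R axis i 1)"
    have inner: "norm (f1 ((\<eta> + s *\<^sub>R axis i 1) + h *\<^sub>R axis j 1) - f1 ((\<eta> + s *\<^sub>R axis i 1) + 0 *\<^sub>R axis j 1) - h *\<^sub>R f2 \<eta>) \<le> e * h"
      if s: "s \<in> {0..h}" for s
    proof (rule linearization_bound[where f = "\<lambda>u. f1 ((\<eta> + s *\<^sub>R axis i 1) + u *\<^sub>R axis j 1)"])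
      fix u assume u: "u \<in> {0..h}"
      show "((\<lambda>u. f1 ((\<eta> + s *\<^sub>R axis i 1) + u *\<^sub>R axis j 1)) has_vector_derivative
          f2 ((\<eta> + s *\<^sub>R axis i 1) + u *\<^sub>R axis j 1)) (at u)"
        by (rule has_partial_line[OF fj])
      have "dist (\<eta> + s *\<^sub>R axis i 1 + u *\<^sub>R axis j 1) \<eta> \<le> norm (s *\<^sub>R (axis i 1 :: real^'a)) + norm (u *\<^sub>R (axis j 1 :: real^'a))"
        unfolding dist_norm by (rule order_trans[OF _ norm_triangle_ineq]) (simp add: algebra_simps)
      also have "\<dots> < d" using s u h by (simp add: norm_axis_1)
      finally show "norm (f2 ((\<eta> + s *\<^sub>R axis i 1) + u *\<^sub>R axis j 1) - f2 \<eta>) \<le> e"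
        using d(2) by (auto simp: dist_norm intro: less_imp_le)
    qed (use h in auto)
    have "norm (?g h - ?g 0 - h *\<^sub>R (h *\<^sub>R f2 \<eta>)) \<le> (e * h) * h"
    proof (rule linearization_bound)
      fix s assume s: "s \<in> {0..h}"
      show "(?g has_vector_derivative f1 ((\<eta> + h *\<^sub>R axis j 1) + s *\<^sub>R axis i 1) - f1 (\<eta> + s *\<^sub>R axis i 1)) (at s)"
        by (intro has_vector_derivative_diff has_partial_line[OF fi])
      show "norm (f1 ((\<eta> + h *\<^sub>R axis j 1) + s *\<^sub>R axis i 1) - f1 (\<eta> + s *\<^sub>R axis i 1) - h *\<^sub>R f2 \<eta>) \<le> e * h"
        using inner[OF s] by (simp add: algebra_simps)
    qed (use h in auto)
    then show ?thesis by (simp add: power2_eq_square algebra_simps)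
  qed
  then show ?thesis using d(1) by (intro exI[of _ "d / 2"]) auto
qed

lemma partial_diff_commute:
  assumes "C_n (Suc (Suc n)) f"
  shows "partial_diff j (partial_diff i f) = partial_diff i (partial_diff j f)"
proof
  fix \<eta>
  have i: "has_partial f i (partial_diff i f)" "has_partial (partial_diff i f) j (partial_diff j (partial_diff i f))"
    "continuous_on UNIV (partial_diff j (partial_diff i f))"
   and j: "has_partial f j (partial_diff j f)" "has_partial (partial_diff j f) i (partial_diff i (partial_diff j f))"
    "continuous_on UNIV (partial_diff i (partial_diff j f))"
    using assms C_n_SucD C_n_continuous by blast+
  define a b where "a = partial_diff j (partial_diff i f) \<eta>" and "b = partial_diff i (partial_diff j f) \<eta>"
  have "norm (a - b) \<le> e" if e: "0 < e" for e
  proof -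
    have e2: "0 < e / 2" using e by simp
    obtain d where d: "0 < d" "\<And>h. 0 < h \<Longrightarrow> h < d \<Longrightarrow> norm (f (\<eta> + h *\<^sub>R axis i 1 + h *\<^sub>R axis j 1) - f (\<eta> + h *\<^sub>R axis i 1) - f (\<eta> + h *\<^sub>R axis j 1) + f \<eta> - h\<^sup>2 *\<^sub>R a) \<le> e / 2 * h\<^sup>2"
      using second_difference_bound[OF i e2, of \<eta>] unfolding a_def by blast
    obtain d' where d': "0 < d'" "\<And>h. 0 < h \<Longrightarrow> h < d' \<Longrightarrow> norm (f (\<eta> + h *\<^sub>R axis j 1 + h *\<^sub>R axis i 1) - f (\<eta> + h *\<^sub>R axis j 1) - f (\<eta> + h *\<^sub>R axis i 1) + f \<eta> - h\<^sup>2 *\<^sub>R b) \<le> e / 2 * h\<^sup>2"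
      using second_difference_bound[OF j e2, of \<eta>] unfolding b_def by blast
    \<comment> \<open>Both mixed derivatives approximate the same second difference at this step size.\<close>
    define h where "h = min d d' / 2"
    have h: "0 < h" "h < d" "h < d'" using d(1) d'(1) by (auto simp: h_def min_def)
    define \<Delta> where "\<Delta> = f (\<eta> + h *\<^sub>R axis i 1 + h *\<^sub>R axis j 1) - f (\<eta> + h *\<^sub>R axis i 1) - f (\<eta> + h *\<^sub>R axis j 1) + f \<eta>"
    have "norm (\<Delta> - h\<^sup>2 *\<^sub>R a) \<le> e / 2 * h\<^sup>2" "norm (\<Delta> - h\<^sup>2 *\<^sub>R b) \<le> e / 2 * h\<^sup>2"
      using d(2)[of h] d'(2)[of h] h by (auto simp: \<Delta>_def algebra_simps)
    then have "norm ((\<Delta> - h\<^sup>2 *\<^sub>R b) - (\<Delta> - h\<^sup>2 *\<^sub>R a)) \<le> e * h\<^sup>2"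
      using norm_triangle_ineq4[of "\<Delta> - h\<^sup>2 *\<^sub>R b" "\<Delta> - h\<^sup>2 *\<^sub>R a"] by simp
    moreover have "(\<Delta> - h\<^sup>2 *\<^sub>R b) - (\<Delta> - h\<^sup>2 *\<^sub>R a) = h\<^sup>2 *\<^sub>R (a - b)" by (simp add: algebra_simps)
    ultimately have "h\<^sup>2 * norm (a - b) \<le> h\<^sup>2 * e" by (simp add: mult.commute)
    then show ?thesis using h by simp
  qed
  then have "norm (a - b) \<le> 0" by (rule field_le_epsilon) simp
  then show "partial_diff j (partial_diff i f) \<eta> = partial_diff i (partial_diff j f) \<eta>" by (simp add: a_def b_def)
qed

lemma iter_diff_move_front:
  assumes "C_n n f" "length (ys @ x # zs) \<le> n"
  shows "iter_diff (ys @ x # zs) f = iter_diff (x # ys @ zs) f"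
  using assms(2)
proof (induction ys)
  case (Cons y ys)
  have "C_n (n - length (ys @ zs)) (iter_diff (ys @ zs) f)"
    using assms(1) Cons.prems by (intro C_n_iter_diff) auto
  moreover have "n - length (ys @ zs) = Suc (Suc (n - length (ys @ zs) - 2))" using Cons.prems by simp
  ultimately have "partial_diff y (partial_diff x (iter_diff (ys @ zs) f)) = partial_diff x (partial_diff y (iter_diff (ys @ zs) f))"
    using partial_diff_commute by metis
  then show ?case using Cons by simp
qed simp

lemma iter_diff_perm:
  assumes "C_n n f" "length xs \<le> n" "\<forall>i. count_list xs i = count_list ys i"
  shows "iter_diff xs f = iter_diff ys f"
  using assms(2,3)
proof (induction xs arbitrary: ys)
  case Nil
  then have "ys = []" by (metis count_list_0_iff count_list.simps(1) last_in_set)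
  then show ?case by simp
next
  case (Cons x xs)
  have "mset (x # xs) = mset ys" using Cons.prems(2) by (intro multiset_eqI) (simp only: count_mset)
  then have len: "length (x # xs) = length ys" by (rule mset_eq_length)
  have "x \<in> set ys" using Cons.prems(2)[rule_format, of x] by (metis count_list.simps(2) count_list_0_iff Suc_eq_plus1 nat.simps(3))
  then obtain ys1 ys2 where ys: "ys = ys1 @ x # ys2" by (meson split_list)
  have "\<forall>i. count_list xs i = count_list (ys1 @ ys2) i"
    using Cons.prems(2) unfolding ys by (auto split: if_splits)
  then have "iter_diff xs f = iter_diff (ys1 @ ys2) f" using Cons.prems(1) by (intro Cons.IH) auto
  moreover have "iter_diff ys f = iter_diff (x # ys1 @ ys2) f"
    unfolding ys using assms(1) Cons.prems(1) len ys by (intro iter_diff_move_front) auto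
  ultimately show ?case by simp
qed

text \<open>The order of differentiation that is chosen for a multi-index can be replaced by any other one. The
Leibniz rule needs this, since it produces the factors in the orders inherited from a given list.\<close>

lemma multi_diff_count:
  assumes "C_n n f" "length xs \<le> n"
  shows "multi_diff (count_list xs) f = iter_diff xs f"
proof -
  have "\<exists>ys. \<forall>i. count_list ys i = count_list xs i" by blast
  then have "\<forall>i. count_list (SOME ys. \<forall>i. count_list ys i = count_list xs i) i = count_list xs i"
    by (rule someI_ex)
  then show ?thesis unfolding multi_diff_def using iter_diff_perm[OF assms] by (metis (no_types, lifting))
qed

lemma multi_order_count: "multi_order (count_list xs) = length (xs :: 'd::finite list)"
  by (rule sum_count_set) auto

lemma ex_list_multi_index:
  obtains xs :: "'d::finite list" where "\<alpha> = count_list xs" "multi_diff \<alpha> = iter_diff xs" "length xs = multi_order \<alpha>"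
proof -
  define xs where "xs = (SOME xs. \<forall>i. count_list xs i = \<alpha> i)"
  have "\<forall>i. count_list xs i = \<alpha> i" unfolding xs_def using ex_directions[of \<alpha>] by (rule someI_ex)
  then have "\<alpha> = count_list xs" by auto
  moreover have "multi_diff \<alpha> = iter_diff xs" by (simp add: fun_eq_iff multi_diff_def xs_def)
  ultimately show ?thesis using that multi_order_count by metis
qed

section \<open>Measurability in the parameter and differentiation under the integral\<close>

text \<open>Lebesgue measurability, unlike Borel measurability, is insensitive to null sets. This is what allows
regularity in \<open>\<eta>\<close> for almost every \<open>k\<close> only.\<close>

lemma lebesgue_measurable_cong_AE:
  fixes f g :: "'a::euclidean_space \<Rightarrow> 'b::topological_space"
  assumes f: "f \<in> borel_measurable lebesgue" and eq: "AE x in lebesgue. f x = g x"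
  shows "g \<in> borel_measurable lebesgue"
proof (rule borel_measurableI)
  fix S :: "'b set" assume S: "open S"
  obtain N where N: "{x. f x \<noteq> g x} \<subseteq> N" "N \<in> null_sets lebesgue"
    using eq by (auto simp: eventually_ae_filter)
  have "f -` S \<in> sets lebesgue" using measurable_sets[OF f, of S] S by simp
  moreover have "N \<in> sets lebesgue" using N(2) by auto
  moreover have "g -` S \<inter> N \<in> null_sets lebesgue"
    by (rule completion.complete2[OF _ N(2)]) auto
  then have "g -` S \<inter> N \<in> sets lebesgue" by auto
  ultimately have "(f -` S - N) \<union> (g -` S \<inter> N) \<in> sets lebesgue" by blast
  moreover have "f x = g x" if "x \<notin> N" for x using N(1) that by auto
  then have "g -` S = (f -` S - N) \<union> (g -` S \<inter> N)" by auto
  ultimately show "g -` S \<inter> space lebesgue \<in> sets lebesgue" by simp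
qed

lemma complex_Borel_version:
  fixes f :: "'a::euclidean_space \<Rightarrow> complex"
  assumes "f \<in> borel_measurable lebesgue"
  obtains g where "g \<in> borel_measurable borel" "AE x in lebesgue. f x = g x"
proof -
  have m: "(\<lambda>x. Re (f x)) \<in> borel_measurable lebesgue" "(\<lambda>x. Im (f x)) \<in> borel_measurable lebesgue"
    using assms by (simp_all add: borel_measurable_complex_iff)
  obtain a where [measurable]: "a \<in> borel_measurable borel" and a: "AE x in lebesgue. Re (f x) = a x"
    using completion_ex_borel_measurable_real[OF m(1)] by (auto simp: AE_completion_iff)
  obtain b where [measurable]: "b \<in> borel_measurable borel" and b: "AE x in lebesgue. Im (f x) = b x"
    using completion_ex_borel_measurable_real[OF m(2)] by (auto simp: AE_completion_iff)
  have "AE x in lebesgue. f x = Complex (a x) (b x)"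
    using a b by eventually_elim (simp add: complex_eq_iff)
  moreover have "(\<lambda>x. Complex (a x) (b x)) \<in> borel_measurable borel"
    by (simp add: borel_measurable_complex_iff)
  ultimately show ?thesis using that by blast
qed

lemma lebesgue_measurable_diff:
  fixes f :: "'a::euclidean_space \<Rightarrow> complex"
  assumes "f \<in> borel_measurable lebesgue"
  shows "(\<lambda>x. f (t - x)) \<in> borel_measurable lebesgue"
proof -
  obtain g where g [measurable]: "g \<in> borel_measurable borel" and eq: "AE x in lebesgue. f x = g x"
    using complex_Borel_version[OF assms] by blast
  have "(\<lambda>x. g (t - x)) \<in> borel_measurable borel" by measurable
  then have "(\<lambda>x. g (t - x)) \<in> borel_measurable lebesgue" by (simp add: measurable_completion)
  moreover have "AE x in lebesgue. g (t - x) = f (t - x)"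
    using AE_lebesgue_diff[OF eq, of t] by eventually_elim simp
  ultimately show ?thesis by (rule lebesgue_measurable_cong_AE)
qed

lemma has_vector_derivative_LIMSEQ:
  fixes f :: "real \<Rightarrow> 'b::real_normed_vector"
  shows "(f has_vector_derivative D) (at 0) \<longleftrightarrow>
    (\<forall>t. (\<forall>n. t n \<noteq> 0) \<longrightarrow> t \<longlonglongrightarrow> 0 \<longrightarrow> (\<lambda>n. (f (t n) - f 0) /\<^sub>R t n) \<longlonglongrightarrow> D)"
proof -
  have "(f has_vector_derivative D) (at 0) \<longleftrightarrow> ((\<lambda>t. norm (f t - f 0 - t *\<^sub>R D) / norm t) \<longlongrightarrow> 0) (at 0)"
    by (simp add: has_vector_derivative_def has_derivative_iff_norm bounded_linear_scaleR_left)
  also have "\<dots> \<longleftrightarrow> ((\<lambda>t. (f t - f 0) /\<^sub>R t - D) \<longlongrightarrow> 0) (at 0)"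
    unfolding tendsto_norm_zero_iff[symmetric, of "\<lambda>t. (f t - f 0) /\<^sub>R t - D"]
  proof (rule filterlim_cong[OF refl refl], simp add: eventually_at_filter, intro always_eventually allI impI)
    fix t :: real assume "t \<noteq> 0"
    then have "(f t - f 0) /\<^sub>R t - D = (f t - f 0 - t *\<^sub>R D) /\<^sub>R t" by (simp add: algebra_simps)
    then show "norm (f t - f 0 - t *\<^sub>R D) / \<bar>t\<bar> = norm ((f t - f 0) /\<^sub>R t - D)"
      by (simp add: divide_inverse mult.commute)
  qed
  also have "\<dots> \<longleftrightarrow> ((\<lambda>t. (f t - f 0) /\<^sub>R t) \<longlongrightarrow> D) (at 0)"
    by (rule LIM_zero_iff)
  finally show ?thesis by (simp add: tendsto_at_iff_sequentially o_def)
qed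

lemma has_partial_LIMSEQ:
  "has_partial f i f' \<Longrightarrow> (\<forall>n. t n \<noteq> 0) \<Longrightarrow> t \<longlonglongrightarrow> 0 \<Longrightarrow>
    (\<lambda>n. (f (\<eta> + t n *\<^sub>R axis i 1) - f \<eta>) /\<^sub>R t n) \<longlonglongrightarrow> f' \<eta>"
  unfolding has_partial_def has_vector_derivative_LIMSEQ by simp

text \<open>The derivative is almost everywhere a limit of difference quotients along a fixed sequence.\<close>

lemma measurable_has_partial:
  fixes F :: "'a::euclidean_space \<Rightarrow> real^'d \<Rightarrow> complex"
  assumes meas: "\<And>\<eta>. (\<lambda>x. F x \<eta>) \<in> borel_measurable lebesgue"
    and der: "AE x in lebesgue. has_partial (F x) i (F' x)"
  shows "(\<lambda>x. F' x \<eta>) \<in> borel_measurable lebesgue"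
proof -
  define t where "t n = inverse (real (Suc n))" for n
  have t: "\<forall>n. t n \<noteq> 0" "t \<longlonglongrightarrow> 0" using LIMSEQ_inverse_real_of_nat by (auto simp: t_def[abs_def])
  have m: "(\<lambda>x. lim (\<lambda>n. (F x (\<eta> + t n *\<^sub>R axis i 1) - F x \<eta>) /\<^sub>R t n)) \<in> borel_measurable lebesgue"
    using meas by (intro borel_measurable_lim_metric) simp
  show ?thesis
  proof (rule lebesgue_measurable_cong_AE[OF m], use der in eventually_elim)
    case (elim x)
    show ?case by (rule limI[OF has_partial_LIMSEQ[OF elim t]])
  qed
qed

lemma has_partial_Lipschitz:
  assumes "has_partial f i f'" "\<And>\<eta>. norm (f' \<eta>) \<le> B"
  shows "norm (f (\<eta> + t *\<^sub>R axis i 1) - f \<eta>) \<le> B * \<bar>t\<bar>"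
proof -
  have "norm (f (\<eta> + t *\<^sub>R axis i 1) - f (\<eta> + 0 *\<^sub>R axis i 1)) \<le> B * norm (t - 0)"
  proof (rule differentiable_bound[where S = UNIV and f' = "\<lambda>t x. x *\<^sub>R f' (\<eta> + t *\<^sub>R axis i 1)" and f = "\<lambda>t. f (\<eta> + t *\<^sub>R axis i 1)"])
    fix u :: real
    show "((\<lambda>t. f (\<eta> + t *\<^sub>R axis i 1)) has_derivative (\<lambda>x. x *\<^sub>R f' (\<eta> + u *\<^sub>R axis i 1))) (at u)"
      using has_partial_line[OF assms(1)] unfolding has_vector_derivative_def .
    show "onorm (\<lambda>x. x *\<^sub>R f' (\<eta> + u *\<^sub>R axis i 1)) \<le> B"
      using assms(2) onorm_scaleR_left[OF bounded_linear_ident, of "f' (\<eta> + u *\<^sub>R axis i 1)"] by (simp add: onorm_id)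
  qed auto
  then show ?thesis by simp
qed

lemma has_partial_integral:
  fixes F :: "'a::euclidean_space \<Rightarrow> real^'d \<Rightarrow> complex"
  assumes meas: "\<And>\<eta>. (\<lambda>x. F x \<eta>) \<in> borel_measurable lebesgue"
    and der: "AE x in lebesgue. has_partial (F x) i (F' x)"
    and H: "integrable lebesgue H"
    and F: "AE x in lebesgue. \<forall>\<eta>. norm (F x \<eta>) \<le> H x"
    and F': "AE x in lebesgue. \<forall>\<eta>. norm (F' x \<eta>) \<le> H x"
  shows "has_partial (\<lambda>\<eta>. LINT x|lebesgue. F x \<eta>) i (\<lambda>\<eta>. LINT x|lebesgue. F' x \<eta>)"
  unfolding has_partial_def has_vector_derivative_LIMSEQ
proof (intro allI impI)
  fix \<eta> :: "real^'d" and t :: "nat \<Rightarrow> real" assume t: "\<forall>n. t n \<noteq> 0" "t \<longlonglongrightarrow> 0"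
  have int: "integrable lebesgue (\<lambda>x. F x \<xi>)" for \<xi>
    using F by (intro Bochner_Integration.integrable_bound[OF H meas]) (auto elim!: eventually_mono intro: order_trans)
  have "(\<lambda>n. LINT x|lebesgue. (F x (\<eta> + t n *\<^sub>R axis i 1) - F x \<eta>) /\<^sub>R t n) \<longlonglongrightarrow> (LINT x|lebesgue. F' x \<eta>)"
  proof (rule integral_dominated_convergence[where w = H])
    show "(\<lambda>x. F' x \<eta>) \<in> borel_measurable lebesgue" by (rule measurable_has_partial[OF meas der])
    show "(\<lambda>x. (F x (\<eta> + t n *\<^sub>R axis i 1) - F x \<eta>) /\<^sub>R t n) \<in> borel_measurable lebesgue" for n
      using meas by simp
    show "AE x in lebesgue. (\<lambda>n. (F x (\<eta> + t n *\<^sub>R axis i 1) - F x \<eta>) /\<^sub>R t n) \<longlonglongrightarrow> F' x \<eta>"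
      using der by eventually_elim (rule has_partial_LIMSEQ[OF _ t])
    show "AE x in lebesgue. norm ((F x (\<eta> + t n *\<^sub>R axis i 1) - F x \<eta>) /\<^sub>R t n) \<le> H x" for n
      using der F'
    proof eventually_elim
      case (elim x)
      then have "norm (F x (\<eta> + t n *\<^sub>R axis i 1) - F x \<eta>) \<le> H x * \<bar>t n\<bar>"
        by (intro has_partial_Lipschitz) auto
      moreover have "norm ((F x (\<eta> + t n *\<^sub>R axis i 1) - F x \<eta>) /\<^sub>R t n) =
          norm (F x (\<eta> + t n *\<^sub>R axis i 1) - F x \<eta>) / \<bar>t n\<bar>"
        by (simp only: norm_scaleR abs_inverse divide_inverse mult.commute)
      ultimately show ?case using t(1) by (simp add: pos_divide_le_eq)
    qed
  qed (rule H)
  moreover have "(LINT x|lebesgue. (F x (\<eta> + t n *\<^sub>R axis i 1) - F x \<eta>) /\<^sub>R t n) =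
      ((LINT x|lebesgue. F x (\<eta> + t n *\<^sub>R axis i 1)) - (LINT x|lebesgue. F x \<eta>)) /\<^sub>R t n" for n
    using int by simp
  ultimately show "(\<lambda>n. ((LINT x|lebesgue. F x (\<eta> + t n *\<^sub>R axis i 1)) - (LINT x|lebesgue. F x (\<eta> + 0 *\<^sub>R axis i 1))) /\<^sub>R t n)
      \<longlonglongrightarrow> (LINT x|lebesgue. F' x \<eta>)"
    by (simp only: scaleR_zero_left add_0_right)
qed

lemma continuous_integral:
  fixes F :: "'a::euclidean_space \<Rightarrow> 'b::metric_space \<Rightarrow> complex"
  assumes meas: "\<And>\<eta>. (\<lambda>x. F x \<eta>) \<in> borel_measurable lebesgue"
    and cont: "AE x in lebesgue. continuous_on UNIV (F x)"
    and H: "integrable lebesgue H"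
    and F: "AE x in lebesgue. \<forall>\<eta>. norm (F x \<eta>) \<le> H x"
  shows "continuous_on UNIV (\<lambda>\<eta>. LINT x|lebesgue. F x \<eta>)"
  unfolding continuous_on_sequentially o_def
proof (intro allI ballI impI, elim conjE)
  fix \<eta> and t :: "nat \<Rightarrow> 'b" assume t: "t \<longlonglongrightarrow> \<eta>"
  show "(\<lambda>n. LINT x|lebesgue. F x (t n)) \<longlonglongrightarrow> (LINT x|lebesgue. F x \<eta>)"
  proof (rule integral_dominated_convergence[where w = H])
    show "AE x in lebesgue. (\<lambda>n. F x (t n)) \<longlonglongrightarrow> F x \<eta>"
      using cont by eventually_elim (auto intro: continuous_on_tendsto_compose[OF _ t])
    show "AE x in lebesgue. norm (F x (t n)) \<le> H x" for n using F by eventually_elim auto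
  qed (use meas H in auto)
qed

text \<open>By induction on \<open>n\<close>. The derivative that acts first is moved under the integral, and the induction
hypothesis is applied to the differentiated integrand.\<close>

lemma C_n_integral:
  fixes F :: "'a::euclidean_space \<Rightarrow> real^'d \<Rightarrow> complex"
  assumes "\<And>\<eta>. (\<lambda>x. F x \<eta>) \<in> borel_measurable lebesgue"
    and "AE x in lebesgue. C_n n (F x)"
    and "integrable lebesgue H"
    and "AE x in lebesgue. \<forall>xs. length xs \<le> n \<longrightarrow> (\<forall>\<eta>. norm (iter_diff xs (F x) \<eta>) \<le> H x)"
  shows "C_n n (\<lambda>\<eta>. LINT x|lebesgue. F x \<eta>) \<and>
    (\<forall>xs. length xs \<le> n \<longrightarrow>
       iter_diff xs (\<lambda>\<eta>. LINT x|lebesgue. F x \<eta>) = (\<lambda>\<eta>. LINT x|lebesgue. iter_diff xs (F x) \<eta>))"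
  using assms
proof (induction n arbitrary: F)
  case 0
  have "continuous_on UNIV (\<lambda>\<eta>. LINT x|lebesgue. F x \<eta>)"
    using 0 by (intro continuous_integral[where H = H]) auto
  then show ?case by simp
next
  case (Suc n)
  have bd: "AE x in lebesgue. \<forall>\<eta>. norm (iter_diff xs (F x) \<eta>) \<le> H x" if "length xs \<le> Suc n" for xs
    using Suc.prems(4) that by (auto elim!: eventually_mono)
  have der: "AE x in lebesgue. has_partial (F x) i (partial_diff i (F x)) \<and> C_n n (partial_diff i (F x))" for i
    using Suc.prems(2) by (auto elim!: eventually_mono dest: C_n_SucD simp del: C_n.simps)
  have hp: "has_partial (\<lambda>\<eta>. LINT x|lebesgue. F x \<eta>) i (\<lambda>\<eta>. LINT x|lebesgue. partial_diff i (F x) \<eta>)" for i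
    using bd[of "[]"] bd[of "[i]"] der[of i]
    by (intro has_partial_integral[OF Suc.prems(1) _ Suc.prems(3)]) auto
  have IH: "C_n n (\<lambda>\<eta>. LINT x|lebesgue. partial_diff i (F x) \<eta>) \<and>
    (\<forall>xs. length xs \<le> n \<longrightarrow>
       iter_diff xs (\<lambda>\<eta>. LINT x|lebesgue. partial_diff i (F x) \<eta>) = (\<lambda>\<eta>. LINT x|lebesgue. iter_diff xs (partial_diff i (F x)) \<eta>))" for i
  proof (rule Suc.IH[OF _ _ Suc.prems(3)])
    show "(\<lambda>x. partial_diff i (F x) \<eta>) \<in> borel_measurable lebesgue" for \<eta>
      using der[of i] by (intro measurable_has_partial[OF Suc.prems(1)]) auto
    show "AE x in lebesgue. C_n n (partial_diff i (F x))" using der[of i] by auto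
    show "AE x in lebesgue. \<forall>xs. length xs \<le> n \<longrightarrow> (\<forall>\<eta>. norm (iter_diff xs (partial_diff i (F x)) \<eta>) \<le> H x)"
      using Suc.prems(4)
    proof eventually_elim
      case (elim x)
      have "norm (iter_diff xs (partial_diff i (F x)) \<eta>) \<le> H x" if "length xs \<le> n" for xs \<eta>
        using elim[rule_format, of "xs @ [i]" \<eta>] that by simp
      then show ?case by blast
    qed
  qed
  have c: "continuous_on UNIV (\<lambda>\<eta>. LINT x|lebesgue. F x \<eta>)"
    using bd[of "[]"] Suc.prems(2)
    by (intro continuous_integral[OF Suc.prems(1) _ Suc.prems(3)]) (auto elim!: eventually_mono)
  have "C_n (Suc n) (\<lambda>\<eta>. LINT x|lebesgue. F x \<eta>)"
    using c hp IH by (intro C_n_SucI) blast+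
  moreover have "iter_diff xs (\<lambda>\<eta>. LINT x|lebesgue. F x \<eta>) = (\<lambda>\<eta>. LINT x|lebesgue. iter_diff xs (F x) \<eta>)"
    if "length xs \<le> Suc n" for xs
  proof (cases xs rule: rev_cases)
    case (snoc ys i)
    then show ?thesis using that IH[of i] has_partial_imp_eq[OF hp[of i]] by simp
  qed simp
  ultimately show ?case by blast
qed

lemma measurable_iter_diff:
  fixes F :: "'a::euclidean_space \<Rightarrow> real^'d \<Rightarrow> complex"
  assumes "\<And>\<eta>. (\<lambda>x. F x \<eta>) \<in> borel_measurable lebesgue" "AE x in lebesgue. C_n n (F x)" "length xs \<le> n"
  shows "(\<lambda>x. iter_diff xs (F x) \<eta>) \<in> borel_measurable lebesgue"
  using assms(3)
proof (induction xs arbitrary: \<eta>)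
  case Nil
  then show ?case using assms(1) by simp
next
  case (Cons i xs)
  have "AE x in lebesgue. has_partial (iter_diff xs (F x)) i (iter_diff (i # xs) (F x))"
    using assms(2)
  proof eventually_elim
    case (elim x)
    show ?case by (rule has_partial_iter_diff[OF elim]) (use Cons.prems in simp)
  qed
  then show ?case using Cons.prems by (intro measurable_has_partial[OF Cons.IH]) auto
qed

text \<open>Suprema over all \<open>\<eta>\<close>, or over all pairs of distinct points, are not countable suprema; one countable
set that serves all continuous functions makes such suprema measurable in a parameter.\<close>

lemma SUP_countable_dense:
  fixes S :: "'b::euclidean_space set"
  assumes "open S"
  obtains D where "countable D" "D \<subseteq> S"
    "\<And>g :: 'b \<Rightarrow> ennreal. continuous_on S g \<Longrightarrow> (SUP x\<in>S. g x) = (SUP x\<in>D. g x)"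
proof -
  obtain D0 :: "'b set" where D0: "countable D0" "\<And>X. open X \<Longrightarrow> X \<noteq> {} \<Longrightarrow> \<exists>d\<in>D0. d \<in> X"
    using countable_dense_exists by blast
  show thesis
  proof (rule that[of "D0 \<inter> S"])
    fix g :: "'b \<Rightarrow> ennreal" assume g: "continuous_on S g"
    show "(SUP x\<in>S. g x) = (SUP x\<in>D0 \<inter> S. g x)"
    proof (rule antisym)
      show "(SUP x\<in>S. g x) \<le> (SUP x\<in>D0 \<inter> S. g x)"
      proof (rule SUP_least, rule dense_le)
        fix x y assume x: "x \<in> S" and y: "y < g x"
        have "open (g -` {y<..} \<inter> S)"
          using g assms by (auto simp: continuous_on_open_vimage)
        moreover have "x \<in> g -` {y<..} \<inter> S" using x y by auto
        ultimately obtain d where "d \<in> D0" "d \<in> g -` {y<..} \<inter> S" using D0(2) by blast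
        then show "y \<le> (SUP x\<in>D0 \<inter> S. g x)" by (intro SUP_upper2[of d]) auto
      qed
    qed (auto intro: SUP_subset_mono)
  qed (use D0 in auto)
qed

lemma measurable_sup_norm:
  fixes u :: "'a::euclidean_space \<Rightarrow> 'b::euclidean_space \<Rightarrow> complex"
  assumes meas: "\<And>\<eta>. (\<lambda>k. u k \<eta>) \<in> borel_measurable lebesgue"
    and cont: "AE k in lebesgue. continuous_on UNIV (u k)"
  shows "(\<lambda>k. sup_norm (u k)) \<in> borel_measurable lebesgue"
proof -
  obtain D :: "'b set" where D: "countable D" "D \<subseteq> UNIV"
    "\<And>g :: 'b \<Rightarrow> ennreal. continuous_on UNIV g \<Longrightarrow> (SUP x\<in>UNIV. g x) = (SUP x\<in>D. g x)"
    using SUP_countable_dense[OF open_UNIV] by blast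
  have "(\<lambda>k. SUP \<eta>\<in>D. ennreal (norm (u k \<eta>))) \<in> borel_measurable lebesgue"
    using D(1) meas by (intro borel_measurable_SUP) auto
  then show ?thesis
  proof (rule lebesgue_measurable_cong_AE, use cont in eventually_elim)
    case (elim k)
    have "continuous_on UNIV (\<lambda>\<eta>. ennreal (norm (u k \<eta>)))"
      by (intro continuous_on_ennreal continuous_intros elim)
    from D(3)[OF this] show ?case by (simp add: sup_norm_def)
  qed
qed

lemma concave_modulus_pos:
  assumes \<omega>: "concave_modulus \<omega>" and c: "0 < c" "0 < z\<^sub>0" "\<forall>z\<in>{0..z\<^sub>0}. c * z powr \<iota>' \<le> \<omega> z" and z: "0 < z"
  shows "0 < \<omega> z"
proof -
  define y where "y = min z z\<^sub>0"
  have y: "0 < y" "y \<le> z\<^sub>0" "y \<le> z" using z c by (auto simp: y_def)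
  have "0 < c * y powr \<iota>'" using y c by simp
  also have "\<dots> \<le> \<omega> y" using c(3) y by auto
  also have "\<dots> \<le> \<omega> z" using \<omega> y unfolding concave_modulus_def mono_on_def by auto
  finally show ?thesis .
qed

text \<open>Continuity at positive arguments is automatic for a concave function.\<close>

lemma concave_modulus_continuous:
  assumes "concave_modulus \<omega>" shows "continuous_on {0<..} \<omega>"
proof -
  have "convex_on {0<..} (\<lambda>x. - \<omega> x)"
    using assms unfolding concave_modulus_def concave_on_def
    by (auto intro: convex_on_subset)
  then have "continuous_on {0<..} (\<lambda>x. - \<omega> x)" by (intro convex_on_continuous) auto
  from continuous_on_minus[OF this] show ?thesis by simp
qed

lemma measurable_modulus_seminorm:
  fixes u :: "'a::euclidean_space \<Rightarrow> 'b::euclidean_space \<Rightarrow> complex"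
  assumes meas: "\<And>\<eta>. (\<lambda>k. u k \<eta>) \<in> borel_measurable lebesgue"
    and cont: "AE k in lebesgue. continuous_on UNIV (u k)"
    and \<omega>: "concave_modulus \<omega>" and pos: "\<And>z. 0 < z \<Longrightarrow> 0 < \<omega> z"
  shows "(\<lambda>k. modulus_seminorm \<omega> (u k)) \<in> borel_measurable lebesgue"
proof -
  let ?S = "{(a, b). a \<noteq> b} :: ('b \<times> 'b) set"
  have "?S = {x. fst x \<noteq> snd x}" by auto
  then have "open ?S" by (auto intro!: open_Collect_neq continuous_intros)
  then obtain D :: "('b \<times> 'b) set" where D: "countable D" "D \<subseteq> ?S"
    "\<And>g :: 'b \<times> 'b \<Rightarrow> ennreal. continuous_on ?S g \<Longrightarrow> (SUP x\<in>?S. g x) = (SUP x\<in>D. g x)"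
    using SUP_countable_dense by blast
  have "(\<lambda>k. SUP (a, b)\<in>D. ennreal (norm (u k a - u k b)) / ennreal (\<omega> (dist a b))) \<in> borel_measurable lebesgue"
    unfolding case_prod_beta using D(1) meas by (intro borel_measurable_SUP) auto
  then show ?thesis
  proof (rule lebesgue_measurable_cong_AE, use cont in eventually_elim)
    case (elim k)
    have c1: "continuous_on ?S (\<lambda>x. \<omega> (dist (fst x) (snd x)))"
      by (rule continuous_on_compose2[OF concave_modulus_continuous[OF \<omega>]]) (auto intro!: continuous_intros)
    have c2: "continuous_on ?S (\<lambda>x. u k (fst x))" "continuous_on ?S (\<lambda>x. u k (snd x))"
      by (auto intro!: continuous_on_compose2[OF elim] continuous_intros)
    have p: "0 < \<omega> (dist (fst x) (snd x))" if "x \<in> ?S" for x using that pos by auto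
    have "continuous_on ?S (\<lambda>x. ennreal (norm (u k (fst x) - u k (snd x)) / \<omega> (dist (fst x) (snd x))))"
      using c1 c2 p by (intro continuous_on_ennreal continuous_intros) fastforce+
    moreover have "ennreal (norm (u k (fst x) - u k (snd x)) / \<omega> (dist (fst x) (snd x))) =
       (case x of (a, b) \<Rightarrow> ennreal (norm (u k a - u k b)) / ennreal (\<omega> (dist a b)))" if "x \<in> ?S" for x
      using p[OF that] by (auto simp: case_prod_beta divide_ennreal)
    ultimately have "continuous_on ?S (\<lambda>x. case x of (a, b) \<Rightarrow> ennreal (norm (u k a - u k b)) / ennreal (\<omega> (dist a b)))"
      by (rule continuous_on_eq)
    from D(3)[OF this] show ?case by (simp add: modulus_seminorm_def)
  qed
qed

section \<open>Weighted pointwise bounds\<close>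

lemma japanese_ge_1: "1 \<le> japanese k"
  by (simp add: japanese_def)

lemma japanese_pos: "0 < japanese k"
  using japanese_ge_1[of k] by linarith

lemma japanese_nonneg [simp]: "0 \<le> japanese k"
  using japanese_pos[of k] by linarith

lemma japanese_minus [simp]: "japanese (- k) = japanese k"
  by (simp add: japanese_def)

lemma norm_le_japanese: "norm k \<le> japanese k"
  unfolding japanese_def by (rule real_le_rsqrt) simp

lemma measurable_japanese [measurable]: "(japanese :: 'a::real_normed_vector \<Rightarrow> real) \<in> borel_measurable borel"
  unfolding japanese_def[abs_def] by measurable

text \<open>This distributes the weight in \<open>k\<close> over the two factors of the convolution.\<close>

lemma japanese_submult: "japanese k \<le> 2 * japanese k' * japanese (k - k')"
proof -
  define p q where "p = norm k'" and "q = norm (k - k')"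
  have "norm k \<le> p + q" using norm_triangle_ineq[of k' "k - k'"] by (simp add: p_def q_def)
  then have "(norm k)\<^sup>2 \<le> (p + q)\<^sup>2" by (intro power_mono) auto
  also have "\<dots> \<le> 2 * p\<^sup>2 + 2 * q\<^sup>2"
    using zero_le_power2[of "p - q"] by (simp add: power2_eq_square algebra_simps)
  finally have "(norm k)\<^sup>2 \<le> 2 * p\<^sup>2 + 2 * q\<^sup>2" .
  moreover have "(1 + p\<^sup>2) * (1 + q\<^sup>2) = 1 + p\<^sup>2 + q\<^sup>2 + p\<^sup>2 * q\<^sup>2" by (simp add: algebra_simps)
  moreover have "0 \<le> p\<^sup>2" "0 \<le> q\<^sup>2" "0 \<le> p\<^sup>2 * q\<^sup>2" by simp_all
  ultimately have "1 + (norm k)\<^sup>2 \<le> 4 * ((1 + p\<^sup>2) * (1 + q\<^sup>2))" by linarith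
  then have "japanese k \<le> sqrt (4 * ((1 + p\<^sup>2) * (1 + q\<^sup>2)))"
    unfolding japanese_def by (rule real_sqrt_le_mono)
  also have "\<dots> = 2 * japanese k' * japanese (k - k')"
    by (simp add: real_sqrt_mult japanese_def p_def q_def)
  finally show ?thesis .
qed

text \<open>The pointwise content of the norm of \<open>W\<close> at a frequency with weight \<open>b\<close>: up to a
constant, the least admissible \<open>G\<close> is the largest of the integrands that make up that norm. Stating it with a number \<open>G\<close> and without suprema
avoids extended reals and makes it stable under the operations that the Yukawa map is composed of.\<close>

definition controlled ::
  "(real \<Rightarrow> real) \<Rightarrow> nat \<Rightarrow> real \<Rightarrow> real \<Rightarrow> real \<Rightarrow> (real^'d \<Rightarrow> complex) \<Rightarrow> real \<Rightarrow> bool" where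
  "controlled \<omega> l s \<iota> b f G \<longleftrightarrow> C_n l f \<and>
     (\<forall>xs. length xs \<le> l \<longrightarrow> (\<forall>\<eta> \<eta>'.
        b powr (real (l - length xs) + s + \<iota>) * norm (iter_diff xs f \<eta>) \<le> G \<and>
        b powr (real (l - length xs) + s) * norm (iter_diff xs f \<eta> - iter_diff xs f \<eta>') \<le> G * \<omega> (dist \<eta> \<eta>')))"

lemma controlledD:
  assumes "controlled \<omega> l s \<iota> b f G"
  shows "C_n l f"
    and "length xs \<le> l \<Longrightarrow> b powr (real (l - length xs) + s + \<iota>) * norm (iter_diff xs f \<eta>) \<le> G"
    and "length xs \<le> l \<Longrightarrow> b powr (real (l - length xs) + s) * norm (iter_diff xs f \<eta> - iter_diff xs f \<eta>') \<le> G * \<omega> (dist \<eta> \<eta>')"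
  using assms unfolding controlled_def by blast+

lemma controlled_nonneg:
  assumes "controlled \<omega> l s \<iota> b f G" shows "0 \<le> G"
proof -
  have "0 \<le> b powr (real l + s + \<iota>) * norm (f 0)" by simp
  also have "\<dots> \<le> G" using controlledD(2)[OF assms, of "[]" 0] by simp
  finally show ?thesis .
qed

lemma controlled_mono:
  assumes "controlled \<omega> l s \<iota> b f G" "G \<le> G'" "\<And>z. 0 \<le> z \<Longrightarrow> 0 \<le> \<omega> z"
  shows "controlled \<omega> l s \<iota> b f G'"
proof -
  have "G * \<omega> (dist \<eta> \<eta>') \<le> G' * \<omega> (dist \<eta> \<eta>')" for \<eta> \<eta>' :: "real^'a"
    using assms by (intro mult_right_mono) auto
  then show ?thesis
    unfolding controlled_def
    by (intro conjI allI impI controlledD(1)[OF assms(1)] order_trans[OF controlledD(2)[OF assms(1)] assms(2)]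
        order_trans[OF controlledD(3)[OF assms(1)]])
qed

lemma controlled_cmult:
  assumes "controlled \<omega> l s \<iota> b f G"
  shows "controlled \<omega> l s \<iota> b (\<lambda>\<eta>. c * f \<eta>) (norm c * G)"
proof -
  note C = controlledD(1)[OF assms]
  have "b powr (real (l - length xs) + s + \<iota>) * norm (iter_diff xs (\<lambda>\<eta>. c * f \<eta>) \<eta>) \<le> norm c * G \<and>
    b powr (real (l - length xs) + s) * norm (iter_diff xs (\<lambda>\<eta>. c * f \<eta>) \<eta> - iter_diff xs (\<lambda>\<eta>. c * f \<eta>) \<eta>') \<le> norm c * G * \<omega> (dist \<eta> \<eta>')"
    if l: "length xs \<le> l" for xs \<eta> \<eta>'
  proof -
    have "norm c * (b powr (real (l - length xs) + s + \<iota>) * norm (iter_diff xs f \<eta>)) \<le> norm c * G"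
      by (intro mult_left_mono controlledD(2)[OF assms l]) auto
    moreover have "norm c * (b powr (real (l - length xs) + s) * norm (iter_diff xs f \<eta> - iter_diff xs f \<eta>')) \<le> norm c * (G * \<omega> (dist \<eta> \<eta>'))"
      by (intro mult_left_mono controlledD(3)[OF assms l]) auto
    ultimately show ?thesis
      unfolding iter_diff_cmult[OF C l] right_diff_distrib[symmetric] norm_mult
      by (simp add: mult_ac)
  qed
  then show ?thesis using C_n_mult[OF C_n_const C] unfolding controlled_def by blast
qed

lemma controlled_symmetrize:
  assumes f: "controlled \<omega> l s \<iota> b f G" and g: "controlled \<omega> l s \<iota> b g G"
  shows "controlled \<omega> l s \<iota> b (\<lambda>\<eta>. (f \<eta> + cnj (g (- \<eta>))) / 2) G"
proof -
  note Cf = controlledD(1)[OF f] and Cg = controlledD(1)[OF g]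
  have D: "iter_diff xs (\<lambda>\<eta>. (f \<eta> + cnj (g (- \<eta>))) / 2) =
     (\<lambda>\<eta>. (iter_diff xs f \<eta> + (- 1) ^ length xs * cnj (iter_diff xs g (- \<eta>))) / 2)" if l: "length xs \<le> l" for xs
  proof -
    have "iter_diff xs (\<lambda>\<eta>. (1 / 2) * (f \<eta> + cnj (g (- \<eta>)))) =
       (\<lambda>\<eta>. (1 / 2) * (iter_diff xs f \<eta> + (- 1) ^ length xs * cnj (iter_diff xs g (- \<eta>))))"
      using l Cf Cg
      by (simp only: iter_diff_cmult[OF C_n_add[OF Cf C_n_reflect[OF Cg]]] iter_diff_add[OF Cf C_n_reflect[OF Cg]] iter_diff_reflect[OF Cg])
    then show ?thesis by simp
  qed
  have half: "p * norm ((x + (- 1) ^ n * cnj y) / 2) \<le> B"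
    if "p * norm x \<le> B" "p * norm y \<le> B" "0 \<le> p" for p B n and x y :: complex
  proof -
    have "norm ((x + (- 1) ^ n * cnj y) / 2) \<le> (norm x + norm y) / 2"
      using norm_triangle_ineq[of x "(- 1) ^ n * cnj y"] by (simp add: norm_mult norm_power)
    then have "p * norm ((x + (- 1) ^ n * cnj y) / 2) \<le> p * ((norm x + norm y) / 2)"
      using that by (intro mult_left_mono) auto
    also have "\<dots> = (p * norm x + p * norm y) / 2" by (simp add: algebra_simps)
    also have "\<dots> \<le> B" using that by simp
    finally show ?thesis .
  qed
  have "b powr (real (l - length xs) + s + \<iota>) * norm (iter_diff xs (\<lambda>\<eta>. (f \<eta> + cnj (g (- \<eta>))) / 2) \<eta>) \<le> G \<and>
    b powr (real (l - length xs) + s) * norm (iter_diff xs (\<lambda>\<eta>. (f \<eta> + cnj (g (- \<eta>))) / 2) \<eta> - iter_diff xs (\<lambda>\<eta>. (f \<eta> + cnj (g (- \<eta>))) / 2) \<eta>') \<le> G * \<omega> (dist \<eta> \<eta>')"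
    if l: "length xs \<le> l" for xs \<eta> \<eta>'
  proof
    show "b powr (real (l - length xs) + s + \<iota>) * norm (iter_diff xs (\<lambda>\<eta>. (f \<eta> + cnj (g (- \<eta>))) / 2) \<eta>) \<le> G"
      unfolding D[OF l] by (intro half controlledD(2)[OF f l] controlledD(2)[OF g l]) auto
    have "dist (- \<eta>) (- \<eta>') = dist \<eta> \<eta>'" by (simp add: dist_minus)
    then have g': "b powr (real (l - length xs) + s) * norm (iter_diff xs g (- \<eta>) - iter_diff xs g (- \<eta>')) \<le> G * \<omega> (dist \<eta> \<eta>')"
      using controlledD(3)[OF g l, of "- \<eta>" "- \<eta>'"] by simp
    have "iter_diff xs (\<lambda>\<eta>. (f \<eta> + cnj (g (- \<eta>))) / 2) \<eta> - iter_diff xs (\<lambda>\<eta>. (f \<eta> + cnj (g (- \<eta>))) / 2) \<eta>' =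
      ((iter_diff xs f \<eta> - iter_diff xs f \<eta>') + (- 1) ^ length xs * cnj (iter_diff xs g (- \<eta>) - iter_diff xs g (- \<eta>'))) / 2"
      unfolding D[OF l] by (simp add: algebra_simps diff_divide_distrib add_divide_distrib)
    then show "b powr (real (l - length xs) + s) * norm (iter_diff xs (\<lambda>\<eta>. (f \<eta> + cnj (g (- \<eta>))) / 2) \<eta> - iter_diff xs (\<lambda>\<eta>. (f \<eta> + cnj (g (- \<eta>))) / 2) \<eta>') \<le> G * \<omega> (dist \<eta> \<eta>')"
      by (simp only:) (intro half controlledD(3)[OF f l] g', auto)
  qed
  moreover have "C_n l (\<lambda>\<eta>. (f \<eta> + cnj (g (- \<eta>))) / 2)"
    using C_n_mult[OF C_n_const[of l "1/2"] C_n_add[OF Cf C_n_reflect[OF Cg]]] by simp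
  ultimately show ?thesis unfolding controlled_def by blast
qed

definition wave_const :: "real \<Rightarrow> real \<Rightarrow> real \<Rightarrow> real" where
  "wave_const c z\<^sub>0 \<iota>' = 2 / c + 2 / (c * z\<^sub>0 powr \<iota>')"

lemma sin_Lipschitz: "\<bar>sin x - sin y\<bar> \<le> \<bar>x - y :: real\<bar>"
proof -
  have "norm (sin x - sin y) \<le> 1 * norm (x - y)"
    by (rule field_differentiable_bound[where S = UNIV and f' = cos]) (auto intro!: derivative_eq_intros)
  then show ?thesis by simp
qed

lemma wave_bound: "norm (wave \<kappa> \<phi> \<eta>) \<le> 1"
  by (simp add: wave_def)

text \<open>With \<open>z\<close> the distance of the two points, the difference is at most \<open>min 2 (J z) \<le> 2 (J z)\<^bsup>\<iota>'\<^esup>\<close> where \<open>J\<close> is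
the weight of \<open>\<kappa>\<close>. For \<open>z \<le> z\<^sub>0\<close> the lower bound on \<open>\<omega>\<close> absorbs \<open>z\<^bsup>\<iota>'\<^esup>\<close>; for larger \<open>z\<close> the trivial bound 2 is
absorbed by \<open>\<omega> z \<ge> \<omega> z\<^sub>0\<close>. The two cases account for the two terms of the constant.\<close>

lemma wave_modulus:
  assumes \<omega>: "concave_modulus \<omega>" and i: "0 < \<iota>'" "\<iota>' \<le> 1"
    and c: "0 < c" "0 < z\<^sub>0" "\<forall>z\<in>{0..z\<^sub>0}. c * z powr \<iota>' \<le> \<omega> z"
  shows "norm (wave \<kappa> \<phi> \<eta> - wave \<kappa> \<phi> \<eta>') \<le> wave_const c z\<^sub>0 \<iota>' * japanese \<kappa> powr \<iota>' * \<omega> (dist \<eta> \<eta>')"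
proof -
  define z J where "z = dist \<eta> \<eta>'" and "J = japanese \<kappa>"
  have z0: "0 \<le> z" and J: "1 \<le> J" by (simp_all add: z_def J_def japanese_ge_1)
  have Jp: "1 \<le> J powr \<iota>'" using J i by (intro ge_one_powr_ge_zero) auto
  have \<omega>0: "0 \<le> \<omega> z" using \<omega> z0 by (auto simp: concave_modulus_def)
  let ?D = "norm (wave \<kappa> \<phi> \<eta> - wave \<kappa> \<phi> \<eta>')"
  have D: "?D = \<bar>sin (\<kappa> \<bullet> \<eta> / 2 + \<phi>) - sin (\<kappa> \<bullet> \<eta>' / 2 + \<phi>)\<bar>"
    by (simp add: wave_def flip: of_real_diff)
  have D2: "?D \<le> 2"
    using norm_triangle_ineq4[of "wave \<kappa> \<phi> \<eta>" "wave \<kappa> \<phi> \<eta>'"] wave_bound[of \<kappa> \<phi> \<eta>] wave_bound[of \<kappa> \<phi> \<eta>'] by linarith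
  have wc: "0 \<le> 2 / c" "0 \<le> 2 / (c * z\<^sub>0 powr \<iota>')" using c by auto
  have "?D \<le> (2 / c + 2 / (c * z\<^sub>0 powr \<iota>')) * J powr \<iota>' * \<omega> z"
  proof (cases "z \<le> z\<^sub>0")
    case True
    have "?D \<le> \<bar>(\<kappa> \<bullet> \<eta> / 2 + \<phi>) - (\<kappa> \<bullet> \<eta>' / 2 + \<phi>)\<bar>"
      unfolding D by (rule sin_Lipschitz)
    also have "\<dots> = \<bar>\<kappa> \<bullet> (\<eta> - \<eta>')\<bar> / 2" by (simp add: inner_diff_right flip: diff_divide_distrib)
    also have "\<dots> \<le> norm \<kappa> * norm (\<eta> - \<eta>')"
      using Cauchy_Schwarz_ineq2[of \<kappa> "\<eta> - \<eta>'"] abs_ge_zero[of "\<kappa> \<bullet> (\<eta> - \<eta>')"] by linarith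
    also have "\<dots> \<le> J * z"
      unfolding z_def dist_norm J_def by (intro mult_right_mono norm_le_japanese) auto
    finally have D1: "?D \<le> J * z" .
    have "?D \<le> 2 * (J * z) powr \<iota>'"
    proof (cases "J * z \<le> 1")
      case True
      then have "(J * z) powr 1 \<le> (J * z) powr \<iota>'"
        using i J z0 by (intro powr_mono') auto
      then have "J * z \<le> (J * z) powr \<iota>'" using J z0 by simp
      then show ?thesis using D1 powr_ge_zero[of "J * z" \<iota>'] by linarith
    next
      case False
      then have "1 \<le> (J * z) powr \<iota>'" using i by (intro ge_one_powr_ge_zero) auto
      then show ?thesis using D2 by linarith
    qed
    also have "\<dots> = (2 / c) * J powr \<iota>' * (c * z powr \<iota>')" using c J z0 by (simp add: powr_mult)
    also have "\<dots> \<le> (2 / c) * J powr \<iota>' * \<omega> z"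
      using c True z0 by (intro mult_left_mono) auto
    also have "\<dots> \<le> (2 / c + 2 / (c * z\<^sub>0 powr \<iota>')) * J powr \<iota>' * \<omega> z"
      using wc \<omega>0 by (intro mult_right_mono) auto
    finally show ?thesis .
  next
    case False
    have "c * z\<^sub>0 powr \<iota>' \<le> \<omega> z\<^sub>0" using c by auto
    also have "\<dots> \<le> \<omega> z" using \<omega> False c unfolding concave_modulus_def mono_on_def by auto
    finally have 1: "1 \<le> \<omega> z / (c * z\<^sub>0 powr \<iota>')" using c by simp
    have "?D \<le> 2 * (1 * 1)" using D2 by simp
    also have "\<dots> \<le> 2 * (\<omega> z / (c * z\<^sub>0 powr \<iota>') * J powr \<iota>')"
      using 1 Jp by (intro mult_left_mono mult_mono) auto
    also have "\<dots> = 2 / (c * z\<^sub>0 powr \<iota>') * J powr \<iota>' * \<omega> z" by simp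
    also have "\<dots> \<le> (2 / c + 2 / (c * z\<^sub>0 powr \<iota>')) * J powr \<iota>' * \<omega> z"
      using wc \<omega>0 by (intro mult_right_mono) auto
    finally show ?thesis .
  qed
  then show ?thesis by (simp add: wave_const_def z_def J_def)
qed

lemma abs_prod_list_wave: "\<bar>\<Prod>i\<leftarrow>xs. \<kappa> $ i / 2\<bar> \<le> japanese \<kappa> ^ length xs"
proof (induction xs)
  case (Cons x xs)
  have "\<bar>\<kappa> $ x / 2\<bar> \<le> japanese \<kappa>"
    using component_le_norm_cart[of \<kappa> x] norm_le_japanese[of \<kappa>] by simp
  then have "\<bar>\<kappa> $ x / 2\<bar> * \<bar>\<Prod>i\<leftarrow>xs. \<kappa> $ i / 2\<bar> \<le> japanese \<kappa> * japanese \<kappa> ^ length xs"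
    using Cons japanese_pos[of \<kappa>] by (intro mult_mono) auto
  then show ?case by (simp add: abs_mult)
qed simp

lemma norm_sum_list_le:
  "(\<And>x. x \<in> set xs \<Longrightarrow> norm (f x :: complex) \<le> B) \<Longrightarrow> norm (\<Sum>x\<leftarrow>xs. f x) \<le> real (length xs) * B"
proof (induction xs)
  case (Cons x xs)
  have "norm (f x + (\<Sum>x\<leftarrow>xs. f x)) \<le> B + real (length xs) * B"
    using Cons by (intro norm_triangle_le add_mono) auto
  then show ?case by (simp add: algebra_simps)
qed simp

lemma sum_list_map_diff: "(\<Sum>x\<leftarrow>xs. f x) - (\<Sum>x\<leftarrow>xs. g x) = (\<Sum>x\<leftarrow>xs. f x - (g x :: complex))"
  by (induction xs) auto

text \<open>The bookkeeping of exponents for one term of the Leibniz rule: \<open>x\<close> is the wave factor, which grows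
like a power of \<open>a\<close>, and \<open>y\<close> is the factor measured with a power of \<open>b\<close>. The weight \<open>t\<^sup>e\<close> is spread over \<open>a\<close>
and \<open>b\<close>.\<close>

lemma weight_transfer:
  fixes a b t x y e e' u E P G :: real
  assumes ab: "1 \<le> a" "1 \<le> b" "1 \<le> t" "t \<le> 2 * a * b" and e: "0 \<le> e" "e \<le> E"
    and x: "0 \<le> x" "x \<le> a powr u" "e + u \<le> P" and y: "0 \<le> y" "b powr e' * y \<le> G" "e \<le> e'"
  shows "t powr e * (x * y) \<le> 2 powr E * a powr P * G"
proof -
  have "t powr e \<le> (2 * a * b) powr e" using ab e by (intro powr_mono2) auto
  also have "\<dots> = 2 powr e * a powr e * b powr e" using ab by (simp add: powr_mult)
  finally have "t powr e * (x * y) \<le> (2 powr e * a powr e * b powr e) * (a powr u * y)"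
    using x y by (intro mult_mono) auto
  also have "\<dots> = 2 powr e * a powr (e + u) * (b powr e * y)" using ab by (simp add: powr_add)
  also have "\<dots> \<le> 2 powr E * a powr P * G"
  proof (intro mult_mono)
    show "2 powr e \<le> 2 powr E" using e by (intro powr_mono) auto
    show "a powr (e + u) \<le> a powr P" using ab x by (intro powr_mono) auto
    have "b powr e * y \<le> b powr e' * y" using ab y by (intro mult_right_mono powr_mono) auto
    then show "b powr e * y \<le> G" using y by linarith
  qed (use y in auto)
  finally show ?thesis .
qed

text \<open>This is the heart of the estimate. In a term of the Leibniz rule for \<open>n\<close> derivatives, of which \<open>m\<close> fall on
the wave, the weight in \<open>\<kappa>\<close> is raised to the power \<open>l - n + s + \<iota> + m\<close> in the bound of the supremum, and to
\<open>l - n + s + m\<close> or, if the oscillation of the wave is measured, \<open>l - n + s + m + \<iota>'\<close> in the bound of the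
modulus of continuity. All of these are at most \<open>l + s + \<iota>'\<close>, as \<open>m \<le> n\<close> and \<open>\<iota> \<le> \<iota>'\<close>. The weight in \<open>b\<close> never
exceeds the one under which the remaining \<open>n - m\<close> derivatives of \<open>g\<close> are controlled.\<close>

lemma controlled_wave_mult:
  fixes \<kappa> :: "real^'d"
  assumes \<omega>: "concave_modulus \<omega>" and i: "0 < \<iota>'" "\<iota>' \<le> 1"
    and c: "0 < c" "0 < z\<^sub>0" "\<forall>z\<in>{0..z\<^sub>0}. c * z powr \<iota>' \<le> \<omega> z"
    and s: "0 \<le> s" "0 \<le> \<iota>" "\<iota> \<le> \<iota>'"
    and g: "controlled \<omega> l s \<iota> b g G" and b: "1 \<le> b" "1 \<le> t" "t \<le> 2 * japanese \<kappa> * b"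
  shows "controlled \<omega> l s \<iota> t (\<lambda>\<eta>. wave \<kappa> 0 \<eta> * g \<eta>)
    (2 ^ l * ((1 + wave_const c z\<^sub>0 \<iota>') * 2 powr (real l + s + \<iota>)) * (japanese \<kappa> powr (real l + s + \<iota>') * G))"
proof -
  note Cg = controlledD(1)[OF g] and G0 = controlled_nonneg[OF g]
  define a where "a = japanese \<kappa>"
  define Cw where "Cw = wave_const c z\<^sub>0 \<iota>'"
  define Q where "Q = 2 powr (real l + s + \<iota>) * a powr (real l + s + \<iota>') * G"
  have a: "1 \<le> a" by (simp add: a_def japanese_ge_1)
  have Cw: "0 \<le> Cw" using c by (simp add: Cw_def wave_const_def)
  have Q0: "0 \<le> Q" using G0 by (simp add: Q_def)
  have \<omega>0: "0 \<le> \<omega> (dist \<eta> \<eta>')" for \<eta> \<eta>' :: "real^'d" using \<omega> by (auto simp: concave_modulus_def)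
  have W: "norm (iter_diff ys (wave \<kappa> 0) \<eta>) \<le> a powr real (length ys)" for ys \<eta>
  proof -
    have "norm (iter_diff ys (wave \<kappa> 0) \<eta>) \<le> a ^ length ys * 1"
      unfolding iter_diff_wave norm_mult norm_of_real a_def
      by (intro mult_mono abs_prod_list_wave wave_bound) auto
    then show ?thesis using a by (simp add: powr_realpow)
  qed
  have W': "norm (iter_diff ys (wave \<kappa> 0) \<eta> - iter_diff ys (wave \<kappa> 0) \<eta>') \<le>
      (Cw * \<omega> (dist \<eta> \<eta>')) * a powr (real (length ys) + \<iota>')" for ys \<eta> \<eta>'
  proof -
    have "norm (iter_diff ys (wave \<kappa> 0) \<eta> - iter_diff ys (wave \<kappa> 0) \<eta>') \<le> a ^ length ys * (Cw * a powr \<iota>' * \<omega> (dist \<eta> \<eta>'))"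
      unfolding iter_diff_wave right_diff_distrib[symmetric] norm_mult norm_of_real a_def Cw_def
      by (intro mult_mono abs_prod_list_wave wave_modulus \<omega> i c) auto
    then show ?thesis using a by (simp add: powr_realpow powr_add mult_ac)
  qed
  have main: "t powr (real (l - length xs) + s + \<iota>) * norm (iter_diff xs (\<lambda>\<eta>. wave \<kappa> 0 \<eta> * g \<eta>) \<eta>) \<le> 2 ^ l * ((1 + Cw) * Q) \<and>
    t powr (real (l - length xs) + s) * norm (iter_diff xs (\<lambda>\<eta>. wave \<kappa> 0 \<eta> * g \<eta>) \<eta> - iter_diff xs (\<lambda>\<eta>. wave \<kappa> 0 \<eta> * g \<eta>) \<eta>')
      \<le> 2 ^ l * ((1 + Cw) * Q) * \<omega> (dist \<eta> \<eta>')"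
    if l: "length xs \<le> l" for xs \<eta> \<eta>'
  proof
    define e where "e = real (l - length xs) + s"
    define w where "w = \<omega> (dist \<eta> \<eta>')"
    have w0: "0 \<le> w" by (simp add: w_def \<omega>0)
    have e: "0 \<le> e" "e \<le> real l + s" using s l by (auto simp: e_def)
    let ?W = "\<lambda>p. iter_diff (fst p) (wave \<kappa> 0)" and ?g = "\<lambda>p. iter_diff (snd p) g"
    have len: "length (fst p) + length (snd p) = length xs" if "p \<in> set (splits xs)" for p
      using length_splits_elem[of "fst p" "snd p" xs] that by simp
    have pw: "(2::real) ^ length xs \<le> 2 ^ l" using l by simp
    have *: "iter_diff xs (\<lambda>\<eta>. wave \<kappa> 0 \<eta> * g \<eta>) = (\<lambda>\<eta>. \<Sum>p\<leftarrow>splits xs. ?W p \<eta> * ?g p \<eta>)"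
      by (simp add: iter_diff_mult[OF C_n_wave Cg l] case_prod_unfold)
    have t: "t powr e > 0" "t powr (e + \<iota>) > 0" using b by auto
    have "norm (iter_diff xs (\<lambda>\<eta>. wave \<kappa> 0 \<eta> * g \<eta>) \<eta>) \<le> real (length (splits xs)) * (Q / t powr (e + \<iota>))"
      unfolding *
    proof (rule norm_sum_list_le)
      fix p assume p: "p \<in> set (splits xs)"
      have lp: "length (snd p) \<le> l" using len[OF p] l by simp
      have "t powr (e + \<iota>) * (norm (?W p \<eta>) * norm (?g p \<eta>)) \<le> Q"
        unfolding Q_def
        by (rule weight_transfer[OF a b(1,2) _ _ _ _ W _ _ controlledD(2)[OF g lp]])
          (use b e s len[OF p] l in \<open>auto simp: a_def e_def\<close>)
      then show "norm (?W p \<eta> * ?g p \<eta>) \<le> Q / t powr (e + \<iota>)"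
        using t by (simp add: norm_mult field_simps)
    qed
    also have "\<dots> \<le> 2 ^ l * (((1 + Cw) * Q) / t powr (e + \<iota>))"
      unfolding length_splits of_nat_power of_nat_numeral using pw Q0 Cw
      by (intro mult_mono divide_right_mono) (auto simp: algebra_simps)
    finally show "t powr (real (l - length xs) + s + \<iota>) * norm (iter_diff xs (\<lambda>\<eta>. wave \<kappa> 0 \<eta> * g \<eta>) \<eta>) \<le> 2 ^ l * ((1 + Cw) * Q)"
      using t by (simp add: e_def field_simps)
    have "norm (iter_diff xs (\<lambda>\<eta>. wave \<kappa> 0 \<eta> * g \<eta>) \<eta> - iter_diff xs (\<lambda>\<eta>. wave \<kappa> 0 \<eta> * g \<eta>) \<eta>') \<le> real (length (splits xs)) * ((1 + Cw) * Q * w / t powr e)"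
      unfolding * sum_list_map_diff
    proof (rule norm_sum_list_le)
      fix p assume p: "p \<in> set (splits xs)"
      have lp: "length (snd p) \<le> l" using len[OF p] l by simp
      have 1: "t powr e * (norm (?W p \<eta>) * norm (?g p \<eta> - ?g p \<eta>')) \<le> 2 powr (real l + s + \<iota>) * a powr (real l + s + \<iota>') * (G * w)"
        unfolding w_def
        by (rule weight_transfer[OF a b(1,2) _ _ _ _ W _ _ controlledD(3)[OF g lp]])
          (use b e s i len[OF p] l in \<open>auto simp: a_def e_def\<close>)
      have "t powr e * (a powr (real (length (fst p)) + \<iota>') * norm (?g p \<eta>')) \<le> Q"
        unfolding Q_def
        by (rule weight_transfer[OF a b(1,2) _ _ _ _ order_refl _ _ controlledD(2)[OF g lp]])
          (use b e s i len[OF p] l in \<open>auto simp: a_def e_def\<close>)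
      then have "(Cw * w) * (t powr e * (a powr (real (length (fst p)) + \<iota>') * norm (?g p \<eta>'))) \<le> (Cw * w) * Q"
        using Cw w0 by (intro mult_left_mono) auto
      moreover have "t powr e * (norm (?W p \<eta> - ?W p \<eta>') * norm (?g p \<eta>')) \<le>
         t powr e * (((Cw * w) * a powr (real (length (fst p)) + \<iota>')) * norm (?g p \<eta>'))"
        unfolding w_def by (intro mult_left_mono mult_right_mono W') auto
      ultimately have 2: "t powr e * (norm (?W p \<eta> - ?W p \<eta>') * norm (?g p \<eta>')) \<le> Cw * w * Q"
        by (simp add: mult_ac)
      \<comment> \<open>The oscillation is put on one factor at a time; the bounds 1 and 2 treat the two parts.\<close>
      have "?W p \<eta> * ?g p \<eta> - ?W p \<eta>' * ?g p \<eta>' = ?W p \<eta> * (?g p \<eta> - ?g p \<eta>') + (?W p \<eta> - ?W p \<eta>') * ?g p \<eta>'"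
        by (simp add: algebra_simps)
      then have "norm (?W p \<eta> * ?g p \<eta> - ?W p \<eta>' * ?g p \<eta>') \<le>
        norm (?W p \<eta>) * norm (?g p \<eta> - ?g p \<eta>') + norm (?W p \<eta> - ?W p \<eta>') * norm (?g p \<eta>')"
        by (simp only: norm_mult[symmetric] norm_triangle_ineq)
      then have "t powr e * norm (?W p \<eta> * ?g p \<eta> - ?W p \<eta>' * ?g p \<eta>') \<le>
        t powr e * (norm (?W p \<eta>) * norm (?g p \<eta> - ?g p \<eta>') + norm (?W p \<eta> - ?W p \<eta>') * norm (?g p \<eta>'))"
        using t by (intro mult_left_mono) auto
      also have "\<dots> \<le> Q * w + Cw * w * Q" using 1 2 by (simp add: distrib_left Q_def mult_ac)
      also have "\<dots> = (1 + Cw) * Q * w" by (simp add: algebra_simps)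
      finally show "norm (?W p \<eta> * ?g p \<eta> - ?W p \<eta>' * ?g p \<eta>') \<le> (1 + Cw) * Q * w / t powr e"
        using t by (simp add: field_simps)
    qed
    also have "\<dots> \<le> 2 ^ l * ((1 + Cw) * Q * w / t powr e)"
      unfolding length_splits of_nat_power of_nat_numeral using pw Q0 Cw w0
      by (intro mult_right_mono) auto
    finally show "t powr (real (l - length xs) + s) * norm (iter_diff xs (\<lambda>\<eta>. wave \<kappa> 0 \<eta> * g \<eta>) \<eta> - iter_diff xs (\<lambda>\<eta>. wave \<kappa> 0 \<eta> * g \<eta>) \<eta>')
      \<le> 2 ^ l * ((1 + Cw) * Q) * \<omega> (dist \<eta> \<eta>')"
      using t by (simp add: e_def w_def field_simps)
  qed
  have "controlled \<omega> l s \<iota> t (\<lambda>\<eta>. wave \<kappa> 0 \<eta> * g \<eta>) (2 ^ l * ((1 + Cw) * Q))"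
    unfolding controlled_def using main C_n_mult[OF C_n_wave Cg] by blast
  moreover have "2 ^ l * ((1 + Cw) * Q) = 2 ^ l * ((1 + Cw) * 2 powr (real l + s + \<iota>)) * (a powr (real l + s + \<iota>') * G)"
    by (simp add: Q_def)
  ultimately show ?thesis by (simp only: Cw_def a_def)
qed

text \<open>For \<open>s, \<iota> \<ge> 0\<close> all the weights are at least 1. Hence the bound that estimates the weighted norm also
dominates the integrand when derivatives are taken under the integral.\<close>

lemma controlled_unweighted:
  assumes "controlled \<omega> l s \<iota> b f G" "1 \<le> b" "0 \<le> s" "0 \<le> \<iota>" "length xs \<le> l"
  shows "norm (iter_diff xs f \<eta>) \<le> G"
    and "norm (iter_diff xs f \<eta> - iter_diff xs f \<eta>') \<le> G * \<omega> (dist \<eta> \<eta>')"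
proof -
  have "1 * norm (iter_diff xs f \<eta>) \<le> b powr (real (l - length xs) + s + \<iota>) * norm (iter_diff xs f \<eta>)"
    using assms by (intro mult_right_mono ge_one_powr_ge_zero) auto
  then show "norm (iter_diff xs f \<eta>) \<le> G" using controlledD(2)[OF assms(1,5), of \<eta>] by linarith
  have "1 * norm (iter_diff xs f \<eta> - iter_diff xs f \<eta>') \<le> b powr (real (l - length xs) + s) * norm (iter_diff xs f \<eta> - iter_diff xs f \<eta>')"
    using assms by (intro mult_right_mono ge_one_powr_ge_zero) auto
  then show "norm (iter_diff xs f \<eta> - iter_diff xs f \<eta>') \<le> G * \<omega> (dist \<eta> \<eta>')"
    using controlledD(3)[OF assms(1,5), of \<eta> \<eta>'] by linarith
qed

lemma controlled_integral:
  fixes F :: "'a::euclidean_space \<Rightarrow> real^'d \<Rightarrow> complex"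
  assumes meas: "\<And>\<eta>. (\<lambda>x. F x \<eta>) \<in> borel_measurable lebesgue"
    and F: "AE x in lebesgue. controlled \<omega> l s \<iota> b (F x) (H x)"
    and H: "integrable lebesgue H" and b: "1 \<le> b" "0 \<le> s" "0 \<le> \<iota>"
  shows "\<forall>\<eta>. integrable lebesgue (\<lambda>x. F x \<eta>)"
    and "controlled \<omega> l s \<iota> b (\<lambda>\<eta>. LINT x|lebesgue. F x \<eta>) (LINT x|lebesgue. H x)"
proof -
  have C: "AE x in lebesgue. C_n l (F x)" using F by eventually_elim (rule controlledD)
  have bd: "AE x in lebesgue. \<forall>xs. length xs \<le> l \<longrightarrow> (\<forall>\<eta>. norm (iter_diff xs (F x) \<eta>) \<le> H x)"
    using F by eventually_elim (use controlled_unweighted b in blast)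
  note I = C_n_integral[OF meas C H bd]
  have int: "integrable lebesgue (\<lambda>x. iter_diff xs (F x) \<eta>)" if "length xs \<le> l" for xs \<eta>
  proof (rule Bochner_Integration.integrable_bound[OF H measurable_iter_diff[OF meas C that]])
    show "AE x in lebesgue. norm (iter_diff xs (F x) \<eta>) \<le> norm (H x)"
      using bd
    proof eventually_elim
      case (elim x)
      then have "norm (iter_diff xs (F x) \<eta>) \<le> H x" using that by blast
      then show ?case by simp
    qed
  qed
  show "\<forall>\<eta>. integrable lebesgue (\<lambda>x. F x \<eta>)" using int[of "[]"] by simp
  have le: "p * norm (LINT x|lebesgue. f x) \<le> (LINT x|lebesgue. H x) * B"
    if f: "integrable lebesgue f" and p: "0 \<le> p" and ae: "AE x in lebesgue. p * norm (f x) \<le> H x * B"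
    for p B and f :: "'a \<Rightarrow> complex"
  proof -
    have "p * norm (LINT x|lebesgue. f x) \<le> p * (LINT x|lebesgue. norm (f x))"
      using p by (intro mult_left_mono integral_norm_bound) auto
    also have "\<dots> = (LINT x|lebesgue. p * norm (f x))" by simp
    also have "\<dots> \<le> (LINT x|lebesgue. H x * B)"
      using f H ae by (intro integral_mono_AE) auto
    also have "\<dots> = (LINT x|lebesgue. H x) * B" by simp
    finally show ?thesis .
  qed
  have "b powr (real (l - length xs) + s + \<iota>) * norm (iter_diff xs (\<lambda>\<eta>. LINT x|lebesgue. F x \<eta>) \<eta>) \<le> (LINT x|lebesgue. H x) * 1 \<and>
    b powr (real (l - length xs) + s) * norm (iter_diff xs (\<lambda>\<eta>. LINT x|lebesgue. F x \<eta>) \<eta> - iter_diff xs (\<lambda>\<eta>. LINT x|lebesgue. F x \<eta>) \<eta>') \<le> (LINT x|lebesgue. H x) * \<omega> (dist \<eta> \<eta>')"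
    if l: "length xs \<le> l" for xs \<eta> \<eta>'
  proof
    have D: "iter_diff xs (\<lambda>\<eta>. LINT x|lebesgue. F x \<eta>) = (\<lambda>\<eta>. LINT x|lebesgue. iter_diff xs (F x) \<eta>)" using I l by blast
    show "b powr (real (l - length xs) + s + \<iota>) * norm (iter_diff xs (\<lambda>\<eta>. LINT x|lebesgue. F x \<eta>) \<eta>) \<le> (LINT x|lebesgue. H x) * 1"
      unfolding D
    proof (rule le[OF int[OF l]])
      show "AE x in lebesgue. b powr (real (l - length xs) + s + \<iota>) * norm (iter_diff xs (F x) \<eta>) \<le> H x * 1"
        using F by eventually_elim (simp add: controlledD(2)[OF _ l])
    qed simp
    have "(LINT x|lebesgue. iter_diff xs (F x) \<eta>) - (LINT x|lebesgue. iter_diff xs (F x) \<eta>') =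
       (LINT x|lebesgue. iter_diff xs (F x) \<eta> - iter_diff xs (F x) \<eta>')"
      using int[OF l] by simp
    moreover have "b powr (real (l - length xs) + s) * norm (LINT x|lebesgue. iter_diff xs (F x) \<eta> - iter_diff xs (F x) \<eta>')
       \<le> (LINT x|lebesgue. H x) * \<omega> (dist \<eta> \<eta>')"
    proof (rule le)
      show "AE x in lebesgue. b powr (real (l - length xs) + s) * norm (iter_diff xs (F x) \<eta> - iter_diff xs (F x) \<eta>') \<le> H x * \<omega> (dist \<eta> \<eta>')"
        using F by eventually_elim (simp add: controlledD(3)[OF _ l])
    qed (use int[OF l] in auto)
    ultimately show "b powr (real (l - length xs) + s) * norm (iter_diff xs (\<lambda>\<eta>. LINT x|lebesgue. F x \<eta>) \<eta> - iter_diff xs (\<lambda>\<eta>. LINT x|lebesgue. F x \<eta>) \<eta>') \<le> (LINT x|lebesgue. H x) * \<omega> (dist \<eta> \<eta>')"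
      unfolding D by simp
  qed
  then show "controlled \<omega> l s \<iota> b (\<lambda>\<eta>. LINT x|lebesgue. F x \<eta>) (LINT x|lebesgue. H x)"
    using I unfolding controlled_def by simp
qed

definition W_density ::
  "(real \<Rightarrow> real) \<Rightarrow> nat \<Rightarrow> real \<Rightarrow> real \<Rightarrow> ((real^'d) \<Rightarrow> (real^'d) \<Rightarrow> complex) \<Rightarrow> ('d \<Rightarrow> nat) \<Rightarrow> real^'d \<Rightarrow> ennreal" where
  "W_density \<omega> l s \<iota> w \<alpha> k =
     ennreal (japanese k powr (s + \<iota>)) * sup_norm (\<lambda>\<eta>. japanese k ^ (l - multi_order \<alpha>) *\<^sub>R multi_diff \<alpha> (w k) \<eta>) +
     ennreal (japanese k powr s) * modulus_seminorm \<omega> (\<lambda>\<eta>. japanese k ^ (l - multi_order \<alpha>) *\<^sub>R multi_diff \<alpha> (w k) \<eta>)"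

lemma W_norm_density:
  "W_norm \<omega> l p s \<iota> w = (\<Sum>\<alpha> | multi_order \<alpha> \<le> l. Lp_norm p (W_density \<omega> l s \<iota> w \<alpha>))"
  by (simp add: W_norm_def Lps_modulus_norm_def W_density_def[abs_def])

lemma measurable_W_density:
  fixes w :: "(real^'d) \<Rightarrow> (real^'d) \<Rightarrow> complex"
  assumes meas: "\<And>\<eta>. (\<lambda>k. w k \<eta>) \<in> borel_measurable lebesgue" and C: "AE k in lebesgue. C_n l (w k)"
    and \<omega>: "concave_modulus \<omega>" and pos: "\<And>z. 0 < z \<Longrightarrow> 0 < \<omega> z" and \<alpha>: "multi_order \<alpha> \<le> l"
  shows "W_density \<omega> l s \<iota> w \<alpha> \<in> borel_measurable lebesgue"
proof -
  obtain xs :: "'d list" where xs: "multi_diff \<alpha> = iter_diff xs" "length xs = multi_order \<alpha>" using ex_list_multi_index by metis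
  have [measurable]: "japanese \<in> borel_measurable (lebesgue :: (real^'d) measure)"
    by (rule measurable_completion) measurable
  have m: "(\<lambda>k. japanese k ^ (l - multi_order \<alpha>) *\<^sub>R multi_diff \<alpha> (w k) \<eta>) \<in> borel_measurable lebesgue" for \<eta>
    unfolding xs(1) using measurable_iter_diff[OF meas C, of xs \<eta>] xs(2) \<alpha> by simp
  have c: "AE k in lebesgue. continuous_on UNIV (\<lambda>\<eta>. japanese k ^ (l - multi_order \<alpha>) *\<^sub>R multi_diff \<alpha> (w k) \<eta>)"
    using C
  proof eventually_elim
    case (elim k)
    show ?case unfolding xs(1) using continuous_iter_diff[OF elim, of xs] xs(2) \<alpha> by (intro continuous_intros) auto
  qed
  note [measurable] = measurable_sup_norm[OF m c] measurable_modulus_seminorm[OF m c \<omega> pos]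
  show ?thesis unfolding W_density_def[abs_def] by measurable
qed

lemma controlled_of_W_density:
  fixes w :: "(real^'d) \<Rightarrow> (real^'d) \<Rightarrow> complex"
  assumes C: "C_n l (w k)" and le: "\<And>\<alpha>. multi_order \<alpha> \<le> l \<Longrightarrow> W_density \<omega> l s \<iota> w \<alpha> k \<le> ennreal G"
    and G: "0 \<le> G" and pos: "\<And>z. 0 < z \<Longrightarrow> 0 < \<omega> z" "\<omega> 0 = 0"
  shows "controlled \<omega> l s \<iota> (japanese k) (w k) G"
  unfolding controlled_def
proof (intro conjI allI impI C)
  fix xs :: "'d list" and \<eta> \<eta>' assume l: "length xs \<le> l"
  define J where "J = japanese k"
  have J: "0 < J" by (simp add: J_def japanese_pos)
  let ?u = "\<lambda>\<eta>. J ^ (l - length xs) *\<^sub>R iter_diff xs (w k) \<eta>"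
  have md: "multi_diff (count_list xs) (w k) = iter_diff xs (w k)" by (rule multi_diff_count[OF C l])
  have d: "W_density \<omega> l s \<iota> w (count_list xs) k = ennreal (J powr (s + \<iota>)) * sup_norm ?u + ennreal (J powr s) * modulus_seminorm \<omega> ?u"
    by (simp add: W_density_def md multi_order_count J_def)
  have le': "ennreal (J powr (s + \<iota>)) * sup_norm ?u + ennreal (J powr s) * modulus_seminorm \<omega> ?u \<le> ennreal G"
    using le[of "count_list xs"] l unfolding d multi_order_count by simp
  have "ennreal (J powr (s + \<iota>)) * ennreal (norm (?u \<eta>)) \<le> ennreal (J powr (s + \<iota>)) * sup_norm ?u"
    unfolding sup_norm_def by (intro mult_left_mono SUP_upper) auto
  also have "\<dots> \<le> ennreal G" by (rule order_trans[OF add_increasing2 le']) auto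
  finally have "J powr (s + \<iota>) * norm (?u \<eta>) \<le> G"
    using G by (simp add: ennreal_mult[symmetric])
  moreover have "J powr (s + \<iota>) * norm (?u \<eta>) = J powr (real (l - length xs) + s + \<iota>) * norm (iter_diff xs (w k) \<eta>)"
    using J by (simp add: powr_add powr_realpow)
  ultimately show "japanese k powr (real (l - length xs) + s + \<iota>) * norm (iter_diff xs (w k) \<eta>) \<le> G"
    by (simp only: J_def)
  show "japanese k powr (real (l - length xs) + s) * norm (iter_diff xs (w k) \<eta> - iter_diff xs (w k) \<eta>') \<le> G * \<omega> (dist \<eta> \<eta>')"
  proof (cases "\<eta> = \<eta>'")
    case False
    then have w: "0 < \<omega> (dist \<eta> \<eta>')" using pos by simp
    have "ennreal (norm (?u \<eta> - ?u \<eta>')) / ennreal (\<omega> (dist \<eta> \<eta>')) \<le> modulus_seminorm \<omega> ?u"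
      unfolding modulus_seminorm_def using False by (intro SUP_upper2[of "(\<eta>, \<eta>')"]) auto
    then have "ennreal (J powr s) * (ennreal (norm (?u \<eta> - ?u \<eta>')) / ennreal (\<omega> (dist \<eta> \<eta>'))) \<le> ennreal (J powr s) * modulus_seminorm \<omega> ?u"
      by (intro mult_left_mono) auto
    also have "\<dots> \<le> ennreal G" by (rule order_trans[OF add_increasing le']) auto
    finally have "ennreal (J powr s * (norm (?u \<eta> - ?u \<eta>') / \<omega> (dist \<eta> \<eta>'))) \<le> ennreal G"
      using w by (simp add: divide_ennreal ennreal_mult[symmetric])
    then have "J powr s * norm (?u \<eta> - ?u \<eta>') \<le> G * \<omega> (dist \<eta> \<eta>')"
      using G w by (simp add: field_simps)
    moreover have "?u \<eta> - ?u \<eta>' = J ^ (l - length xs) *\<^sub>R (iter_diff xs (w k) \<eta> - iter_diff xs (w k) \<eta>')"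
      by (simp add: scaleR_diff_right)
    then have "J powr s * norm (?u \<eta> - ?u \<eta>') = J powr (real (l - length xs) + s) * norm (iter_diff xs (w k) \<eta> - iter_diff xs (w k) \<eta>')"
      using J by (simp add: powr_add powr_realpow)
    ultimately show ?thesis by (simp only: J_def)
  qed (simp add: pos)
qed

lemma W_density_le_of_controlled:
  fixes w :: "(real^'d) \<Rightarrow> (real^'d) \<Rightarrow> complex"
  assumes c: "controlled \<omega> l s \<iota> (japanese k) (w k) G" and \<alpha>: "multi_order \<alpha> \<le> l"
    and pos: "\<And>z. 0 < z \<Longrightarrow> 0 < \<omega> z"
  shows "W_density \<omega> l s \<iota> w \<alpha> k \<le> ennreal (2 * G)"
proof -
  obtain xs :: "'d list" where xs: "multi_diff \<alpha> = iter_diff xs" "length xs = multi_order \<alpha>" using ex_list_multi_index by metis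
  have l: "length xs \<le> l" using xs \<alpha> by simp
  define J where "J = japanese k"
  have J: "0 < J" by (simp add: J_def japanese_pos)
  note G = controlled_nonneg[OF c]
  let ?u = "\<lambda>\<eta>. J ^ (l - length xs) *\<^sub>R iter_diff xs (w k) \<eta>"
  have "sup_norm ?u \<le> ennreal (G / J powr (s + \<iota>))"
    unfolding sup_norm_def
  proof (intro SUP_least ennreal_leI)
    fix \<eta>
    have "J powr (s + \<iota>) * norm (?u \<eta>) = J powr (real (l - length xs) + s + \<iota>) * norm (iter_diff xs (w k) \<eta>)"
      using J by (simp add: powr_add powr_realpow)
    also have "\<dots> \<le> G" unfolding J_def by (rule controlledD(2)[OF c l])
    finally show "norm (?u \<eta>) \<le> G / J powr (s + \<iota>)" using J by (simp add: field_simps)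
  qed
  then have "ennreal (J powr (s + \<iota>)) * sup_norm ?u \<le> ennreal (J powr (s + \<iota>)) * ennreal (G / J powr (s + \<iota>))"
    by (intro mult_left_mono) auto
  also have "\<dots> = ennreal G" using J G by (simp add: ennreal_mult[symmetric])
  finally have 1: "ennreal (J powr (s + \<iota>)) * sup_norm ?u \<le> ennreal G" .
  have "modulus_seminorm \<omega> ?u \<le> ennreal (G / J powr s)"
    unfolding modulus_seminorm_def
  proof (intro SUP_least, clarify)
    fix \<eta> \<eta>' :: "real^'d" assume "\<eta> \<noteq> \<eta>'"
    then have w: "0 < \<omega> (dist \<eta> \<eta>')" using pos by simp
    have "?u \<eta> - ?u \<eta>' = J ^ (l - length xs) *\<^sub>R (iter_diff xs (w k) \<eta> - iter_diff xs (w k) \<eta>')"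
      by (simp add: scaleR_diff_right)
    then have "J powr s * norm (?u \<eta> - ?u \<eta>') = J powr (real (l - length xs) + s) * norm (iter_diff xs (w k) \<eta> - iter_diff xs (w k) \<eta>')"
      using J by (simp add: powr_add powr_realpow)
    also have "\<dots> \<le> G * \<omega> (dist \<eta> \<eta>')" unfolding J_def by (rule controlledD(3)[OF c l])
    finally have "norm (?u \<eta> - ?u \<eta>') / \<omega> (dist \<eta> \<eta>') \<le> G / J powr s" using J w by (simp add: field_simps)
    then show "ennreal (norm (?u \<eta> - ?u \<eta>')) / ennreal (\<omega> (dist \<eta> \<eta>')) \<le> ennreal (G / J powr s)"
      using w by (simp add: divide_ennreal ennreal_leI)
  qed
  then have "ennreal (J powr s) * modulus_seminorm \<omega> ?u \<le> ennreal (J powr s) * ennreal (G / J powr s)"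
    by (intro mult_left_mono) auto
  also have "\<dots> = ennreal G" using J G by (simp add: ennreal_mult[symmetric])
  finally have "ennreal (J powr (s + \<iota>)) * sup_norm ?u + ennreal (J powr s) * modulus_seminorm \<omega> ?u \<le> ennreal G + ennreal G"
    using 1 by (intro add_mono) auto
  also have "\<dots> = ennreal (2 * G)" using G by (simp add: ennreal_plus[symmetric] del: ennreal_plus)
  finally show ?thesis by (simp add: W_density_def xs(1) xs(2)[symmetric] J_def)
qed

lemma Cb_modulus_of_controlled:
  fixes f :: "real^'d \<Rightarrow> complex"
  assumes c: "controlled \<omega> l s \<iota> b f G" "1 \<le> b" "0 \<le> s" "0 \<le> \<iota>" and \<alpha>: "multi_order \<alpha> \<le> l"
    and pos: "\<And>z. 0 < z \<Longrightarrow> 0 < \<omega> z"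
  shows "multi_diff \<alpha> f \<in> Cb_modulus \<omega>"
proof -
  obtain xs :: "'d list" where xs: "multi_diff \<alpha> = iter_diff xs" "length xs = multi_order \<alpha>" using ex_list_multi_index by metis
  have l: "length xs \<le> l" using xs \<alpha> by simp
  note bd = controlled_unweighted[OF c l]
  have "iter_diff xs f \<in> bcontfun"
    using continuous_iter_diff[OF controlledD(1)[OF c(1)] l] bd(1) by (auto simp: bcontfun_def bounded_iff)
  moreover have "sup_norm (iter_diff xs f) \<le> ennreal G"
    unfolding sup_norm_def by (intro SUP_least ennreal_leI bd(1))
  moreover have "modulus_seminorm \<omega> (iter_diff xs f) \<le> ennreal G"
    unfolding modulus_seminorm_def
  proof (intro SUP_least, clarify)
    fix \<eta> \<eta>' :: "real^'d" assume "\<eta> \<noteq> \<eta>'"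
    then have w: "0 < \<omega> (dist \<eta> \<eta>')" using pos by simp
    have "norm (iter_diff xs f \<eta> - iter_diff xs f \<eta>') / \<omega> (dist \<eta> \<eta>') \<le> G"
      using bd(2)[of \<eta> \<eta>'] w by (simp add: field_simps)
    then show "ennreal (norm (iter_diff xs f \<eta> - iter_diff xs f \<eta>')) / ennreal (\<omega> (dist \<eta> \<eta>')) \<le> ennreal G"
      using w by (simp add: divide_ennreal ennreal_leI)
  qed
  ultimately show ?thesis unfolding Cb_modulus_def xs(1)
    by (auto intro: le_less_trans[OF _ ennreal_less_top])
qed

section \<open>The Yukawa map\<close>

lemma measurable_sym_part:
  fixes w :: "(real^'d) \<Rightarrow> (real^'d) \<Rightarrow> complex"
  assumes "\<And>\<eta>. (\<lambda>k. w k \<eta>) \<in> borel_measurable lebesgue"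
  shows "(\<lambda>k. sym_part w k \<eta>) \<in> borel_measurable lebesgue"
proof -
  note [measurable] = assms lebesgue_measurable_diff[OF assms, where t = 0, simplified]
  have [measurable]: "cnj \<in> borel_measurable borel"
    by (intro borel_measurable_continuous_onI continuous_intros)
  show ?thesis unfolding sym_part_def by measurable
qed

lemma measurable_yukawa_integrand:
  fixes w v :: "(real^'d) \<Rightarrow> (real^'d) \<Rightarrow> complex"
  assumes chi: "chi \<in> borel_measurable lebesgue"
    and w: "\<And>\<eta>. (\<lambda>k. w k \<eta>) \<in> borel_measurable lebesgue"
    and v: "\<And>\<eta>. (\<lambda>k. v k \<eta>) \<in> borel_measurable lebesgue"
  shows "yukawa_integrand chi w v k \<eta> \<in> borel_measurable lebesgue"
proof -
  note [measurable] = chi measurable_sym_part[OF w, where \<eta> = 0]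
    lebesgue_measurable_diff[OF measurable_sym_part[OF v, where \<eta> = \<eta>], where t = k]
  have "(\<lambda>k'. complex_of_real (sin (k' \<bullet> \<eta> / 2))) \<in> borel_measurable borel" by measurable
  then have [measurable]: "(\<lambda>k'. complex_of_real (sin (k' \<bullet> \<eta> / 2))) \<in> borel_measurable lebesgue"
    by (simp add: measurable_completion)
  show ?thesis unfolding yukawa_integrand_def[abs_def] by measurable
qed

text \<open>For a fixed \<open>\<eta>\<close>, replacing the factors of the integrand by Borel functions changes the integral for no \<open>k\<close>,
and the integral of a jointly Borel measurable function is measurable in the parameter. Borel
functions are essential here: the composition of a Lebesgue measurable function with \<open>k - k'\<close> need
not be measurable for the product of the Lebesgue sigma-algebras.\<close>

lemma measurable_yukawa:
  fixes w v :: "(real^'d) \<Rightarrow> (real^'d) \<Rightarrow> complex"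
  assumes chi: "chi \<in> borel_measurable lebesgue"
    and w: "\<And>\<eta>. (\<lambda>k. w k \<eta>) \<in> borel_measurable lebesgue"
    and v: "\<And>\<eta>. (\<lambda>k. v k \<eta>) \<in> borel_measurable lebesgue"
  shows "(\<lambda>k. yukawa chi w v k \<eta>) \<in> borel_measurable lebesgue"
proof -
  have "(\<lambda>k. chi k * sym_part w k 0) \<in> borel_measurable lebesgue"
    using chi measurable_sym_part[OF w, where \<eta> = 0] by measurable
  then obtain A where [measurable]: "A \<in> borel_measurable borel" and A: "AE k in lebesgue. chi k * sym_part w k 0 = A k"
    by (rule complex_Borel_version)
  obtain B where [measurable]: "B \<in> borel_measurable borel" and B: "AE k in lebesgue. sym_part v k \<eta> = B k"
    using measurable_sym_part[OF v, where \<eta> = \<eta>] by (rule complex_Borel_version)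
  have eq: "(LINT k'|lebesgue. yukawa_integrand chi w v k \<eta> k') =
     (LINT k'|lborel. complex_of_real (sin (k' \<bullet> \<eta> / 2)) * A k' * B (k - k'))" for k
  proof -
    have m: "(\<lambda>k'. complex_of_real (sin (k' \<bullet> \<eta> / 2)) * A k' * B (k - k')) \<in> borel_measurable lborel" by measurable
    have "(LINT k'|lebesgue. yukawa_integrand chi w v k \<eta> k') =
       (LINT k'|lebesgue. complex_of_real (sin (k' \<bullet> \<eta> / 2)) * A k' * B (k - k'))"
    proof (rule integral_cong_AE)
      show "AE k' in lebesgue. yukawa_integrand chi w v k \<eta> k' = complex_of_real (sin (k' \<bullet> \<eta> / 2)) * A k' * B (k - k')"
        using A AE_lebesgue_diff[OF B, of k]
        by eventually_elim (simp add: yukawa_integrand_def mult.assoc)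
    qed (use measurable_yukawa_integrand[OF assms] m in \<open>auto intro: measurable_completion\<close>)
    also have "\<dots> = (LINT k'|lborel. complex_of_real (sin (k' \<bullet> \<eta> / 2)) * A k' * B (k - k'))"
      by (rule integral_completion[OF m])
    finally show ?thesis .
  qed
  have "(\<lambda>k. complex_of_real (2 / (2 * pi) ^ CARD('d)) *
      (LINT k'|lborel. complex_of_real (sin (k' \<bullet> \<eta> / 2)) * A k' * B (k - k'))) \<in> borel_measurable borel"
    by measurable
  then have "(\<lambda>k. complex_of_real (2 / (2 * pi) ^ CARD('d)) *
      (LINT k'|lborel. complex_of_real (sin (k' \<bullet> \<eta> / 2)) * A k' * B (k - k'))) \<in> borel_measurable lebesgue"
    by (simp add: measurable_completion)
  then show ?thesis unfolding yukawa_def eq .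
qed

lemma majorized_symmetrize:
  assumes "majorized \<theta> N f" "0 \<le> \<theta>" "\<theta> \<le> 1"
  shows "majorized \<theta> (4 * N) (\<lambda>k. f k + f (- k))"
proof -
  have "majorized \<theta> (real (card (UNIV :: bool set)) * (\<Sum>b\<in>(UNIV :: bool set). N)) (\<lambda>k. \<Sum>b\<in>UNIV. if b then f k else f (- k))"
  proof (rule majorized_sum)
    fix b :: bool
    show "majorized \<theta> N (\<lambda>k. if b then f k else f (- k))"
      using assms(1) majorized_reflect[OF assms(1)] by (cases b) simp_all
  qed (use assms in auto)
  then show ?thesis by (simp add: UNIV_bool add.commute)
qed

locale modulus_setting =
  fixes \<omega> :: "real \<Rightarrow> real" and \<iota>' c z\<^sub>0 s \<iota> :: real
  assumes \<omega>: "concave_modulus \<omega>"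
    and \<iota>': "0 < \<iota>'" "\<iota>' \<le> 1"
    and lower: "0 < c" "0 < z\<^sub>0" "\<forall>z\<in>{0..z\<^sub>0}. c * z powr \<iota>' \<le> \<omega> z"
    and s: "0 \<le> s" "0 \<le> \<iota>" "\<iota> \<le> \<iota>'"
begin

lemma \<omega>_pos: "0 < z \<Longrightarrow> 0 < \<omega> z"
  by (rule concave_modulus_pos[OF \<omega> lower])

lemma \<omega>_nonneg: "0 \<le> z \<Longrightarrow> 0 \<le> \<omega> z"
  using \<omega> by (simp add: concave_modulus_def)

lemma \<omega>_zero: "\<omega> 0 = 0"
  using \<omega> by (simp add: concave_modulus_def)

definition leibniz_const :: "nat \<Rightarrow> real" where
  "leibniz_const l = 2 ^ l * ((1 + wave_const c z\<^sub>0 \<iota>') * 2 powr (real l + s + \<iota>))"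

lemma leibniz_const_nonneg: "0 \<le> leibniz_const l"
  using lower by (simp add: leibniz_const_def wave_const_def)

text \<open>For a \<open>k\<close> at which the convolution of the majorants \<open>h\<close> and \<open>g\<close> is finite, the integrand is controlled by
\<open>h k' * g (k - k')\<close>, up to a constant, and this passes to the integral.\<close>

lemma yukawa_controlled:
  fixes w v :: "(real^'d) \<Rightarrow> (real^'d) \<Rightarrow> complex"
  assumes chi: "chi \<in> borel_measurable lebesgue"
    and w: "\<And>\<eta>. (\<lambda>k. w k \<eta>) \<in> borel_measurable lebesgue"
    and v: "\<And>\<eta>. (\<lambda>k. v k \<eta>) \<in> borel_measurable lebesgue"
    and h [measurable]: "h \<in> borel_measurable borel" and g [measurable]: "g \<in> borel_measurable borel"
    and hb: "AE k in lebesgue. norm (chi k * sym_part w k 0) * japanese k powr (real l + s + \<iota>') \<le> h k"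
    and gb: "AE k in lebesgue. controlled \<omega> l s \<iota> (japanese k) (sym_part v k) (g k)"
    and hg: "\<And>k. 0 \<le> h k" "\<And>k. 0 \<le> g k"
    and fin: "(\<integral>\<^sup>+k'. ennreal (h k' * g (k - k')) \<partial>lborel) < top"
  shows "\<forall>\<eta>. integrable lebesgue (yukawa_integrand chi w v k \<eta>)"
    and "controlled \<omega> l s \<iota> (japanese k) (yukawa chi w v k)
      (2 / (2 * pi) ^ CARD('d) * (leibniz_const l * enn2real (\<integral>\<^sup>+k'. ennreal (h k' * g (k - k')) \<partial>lborel)))"
proof -
  define H where "H k' = leibniz_const l * (h k' * g (k - k'))" for k'
  have m: "(\<lambda>k'. h k' * g (k - k')) \<in> borel_measurable lebesgue"
    by (rule measurable_completion) measurable
  have nn: "(\<integral>\<^sup>+k'. ennreal (h k' * g (k - k')) \<partial>lebesgue) = (\<integral>\<^sup>+k'. ennreal (h k' * g (k - k')) \<partial>lborel)"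
    by (rule nn_integral_completion)
  have int: "integrable lebesgue (\<lambda>k'. h k' * g (k - k'))"
    using fin hg by (intro integrableI_nonneg[OF m]) (auto simp: nn)
  then have H: "integrable lebesgue H" unfolding H_def by simp
  have "(LINT k'|lebesgue. h k' * g (k - k')) = enn2real (\<integral>\<^sup>+k'. ennreal (h k' * g (k - k')) \<partial>lborel)"
    using hg by (subst integral_eq_nn_integral[OF m]) (auto simp: nn)
  then have HI: "(LINT k'|lebesgue. H k') = leibniz_const l * enn2real (\<integral>\<^sup>+k'. ennreal (h k' * g (k - k')) \<partial>lborel)"
    unfolding H_def by simp
  let ?F = "\<lambda>k' \<eta>. yukawa_integrand chi w v k \<eta> k'"
  have meas: "(\<lambda>k'. ?F k' \<eta>) \<in> borel_measurable lebesgue" for \<eta>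
    by (rule measurable_yukawa_integrand[OF chi w v])
  have ctl: "AE k' in lebesgue. controlled \<omega> l s \<iota> (japanese k) (?F k') (H k')"
    using hb AE_lebesgue_diff[OF gb, of k]
  proof eventually_elim
    case (elim k')
    let ?E = "japanese k' powr (real l + s + \<iota>')"
    have "?F k' = (\<lambda>\<eta>. (chi k' * sym_part w k' 0) * (wave k' 0 \<eta> * sym_part v (k - k') \<eta>))"
      by (simp add: yukawa_integrand_def wave_def fun_eq_iff)
    moreover have "controlled \<omega> l s \<iota> (japanese k) (\<lambda>\<eta>. wave k' 0 \<eta> * sym_part v (k - k') \<eta>)
        (leibniz_const l * (?E * g (k - k')))"
      unfolding leibniz_const_def
      by (rule controlled_wave_mult[OF \<omega> \<iota>' lower s elim(2)]) (auto simp: japanese_ge_1 intro: japanese_submult)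
    ultimately have "controlled \<omega> l s \<iota> (japanese k) (?F k')
        (norm (chi k' * sym_part w k' 0) * (leibniz_const l * (?E * g (k - k'))))"
      by (simp only: controlled_cmult)
    moreover have "norm (chi k' * sym_part w k' 0) * (leibniz_const l * (?E * g (k - k'))) =
        leibniz_const l * ((norm (chi k' * sym_part w k' 0) * ?E) * g (k - k'))" by (simp only: mult_ac)
    moreover have "\<dots> \<le> H k'"
      unfolding H_def by (intro mult_left_mono mult_right_mono elim(1) hg leibniz_const_nonneg)
    ultimately show ?case using controlled_mono \<omega>_nonneg by metis
  qed
  note I = controlled_integral[OF meas ctl H japanese_ge_1 s(1,2)]
  show "\<forall>\<eta>. integrable lebesgue (yukawa_integrand chi w v k \<eta>)" using I(1) by simp
  have "norm (complex_of_real (2 / (2 * pi) ^ CARD('d))) = 2 / (2 * pi) ^ CARD('d)"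
    by (subst norm_of_real) simp
  moreover have "yukawa chi w v k = (\<lambda>\<eta>. complex_of_real (2 / (2 * pi) ^ CARD('d)) * (LINT k'|lebesgue. ?F k' \<eta>))"
    by (simp add: yukawa_def fun_eq_iff)
  ultimately show "controlled \<omega> l s \<iota> (japanese k) (yukawa chi w v k)
      (2 / (2 * pi) ^ CARD('d) * (leibniz_const l * enn2real (\<integral>\<^sup>+k'. ennreal (h k' * g (k - k')) \<partial>lborel)))"
    using controlled_cmult[OF I(2), of "complex_of_real (2 / (2 * pi) ^ CARD('d))"] unfolding HI by (simp only:)
qed

lemma W_majorized:
  fixes v :: "(real^'d) \<Rightarrow> (real^'d) \<Rightarrow> complex"
  assumes v: "v \<in> W \<omega> l q s \<iota>" and q: "1 \<le> q"
  shows "majorized (recip q) (real (card {\<alpha> :: 'd \<Rightarrow> nat. multi_order \<alpha> \<le> l}) * enn2real (W_norm \<omega> l q s \<iota> v))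
    (\<lambda>k. \<Sum>\<alpha> | multi_order \<alpha> \<le> l. W_density \<omega> l s \<iota> v \<alpha> k)"
proof -
  let ?A = "{\<alpha> :: 'd \<Rightarrow> nat. multi_order \<alpha> \<le> l}"
  have meas: "(\<lambda>k. v k \<eta>) \<in> borel_measurable lebesgue" for \<eta> using v by (simp add: W_def)
  have C: "AE k in lebesgue. C_n l (v k)" using v by (auto simp: W_def elim!: eventually_mono)
  have fin: "(\<Sum>\<alpha>\<in>?A. Lp_norm q (W_density \<omega> l s \<iota> v \<alpha>)) < top"
    using v by (simp add: W_def W_norm_density)
  have fin\<alpha>: "Lp_norm q (W_density \<omega> l s \<iota> v \<alpha>) < top" if "\<alpha> \<in> ?A" for \<alpha>
    using that finite_multi_order_le by (intro le_less_trans[OF member_le_sum fin]) auto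
  have "enn2real (W_norm \<omega> l q s \<iota> v) = (\<Sum>\<alpha>\<in>?A. enn2real (Lp_norm q (W_density \<omega> l s \<iota> v \<alpha>)))"
    unfolding W_norm_density by (subst enn2real_sum) (use fin\<alpha> in \<open>auto simp: o_def\<close>)
  moreover have "(\<lambda>_. 0) \<in> ?A" by simp
  then have "?A \<noteq> {}" by blast
  ultimately show ?thesis
    using majorized_sum[OF finite_multi_order_le[of l], of "recip q" "\<lambda>\<alpha>. enn2real (Lp_norm q (W_density \<omega> l s \<iota> v \<alpha>))" "W_density \<omega> l s \<iota> v"]
      majorized_of_Lp_norm[OF measurable_W_density[OF meas C \<omega> \<omega>_pos] q] fin\<alpha> recip_bounds[OF q]
    by simp
qed

text \<open>The symmetric part involves \<open>v\<close> at both \<open>k\<close> and \<open>- k\<close>; these have the same weight.\<close>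

lemma controlled_sym_part:
  fixes v :: "(real^'d) \<Rightarrow> (real^'d) \<Rightarrow> complex"
  assumes C: "AE k in lebesgue. C_n l (v k)" and g: "\<And>k. 0 \<le> g k"
    and le: "AE k in lebesgue. (\<Sum>\<alpha> | multi_order \<alpha> \<le> l. W_density \<omega> l s \<iota> v \<alpha> k) +
       (\<Sum>\<alpha> | multi_order \<alpha> \<le> l. W_density \<omega> l s \<iota> v \<alpha> (- k)) \<le> ennreal (g k)"
  shows "AE k in lebesgue. controlled \<omega> l s \<iota> (japanese k) (sym_part v k) (g k)"
  using C AE_lebesgue_uminus[OF C] le
proof eventually_elim
  case (elim k)
  let ?S = "\<lambda>k. \<Sum>\<alpha> | multi_order \<alpha> \<le> l. W_density \<omega> l s \<iota> v \<alpha> k"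
  have mem: "W_density \<omega> l s \<iota> v \<alpha> k \<le> ?S k" if "multi_order \<alpha> \<le> l" for \<alpha> k
    using that finite_multi_order_le by (intro member_le_sum) auto
  have S: "?S k \<le> ennreal (g k)" "?S (- k) \<le> ennreal (g k)"
    by (rule order_trans[OF add_increasing2 elim(3)], simp, simp) (rule order_trans[OF add_increasing elim(3)], simp, simp)
  have 1: "controlled \<omega> l s \<iota> (japanese k) (v k) (g k)"
    by (rule controlled_of_W_density[where w = v and k = k, OF elim(1) order_trans[OF mem S(1)] g[of k] \<omega>_pos \<omega>_zero])
  have "controlled \<omega> l s \<iota> (japanese (- k)) (v (- k)) (g k)"
    by (rule controlled_of_W_density[where w = v and k = "- k", OF elim(2) order_trans[OF mem S(2)] g[of k] \<omega>_pos \<omega>_zero])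
  then show ?case
    using controlled_symmetrize[OF 1] by (simp add: sym_part_def[abs_def])
qed

text \<open>The weight \<open>\<sigma>\<close> is shared between \<open>chi\<close>, which carries \<open>s'\<close>, and \<open>w\<close>, which carries the rest.\<close>

lemma amplitude_majorized:
  fixes chi :: "real^'d \<Rightarrow> complex" and w :: "(real^'d) \<Rightarrow> (real^'d) \<Rightarrow> complex"
  assumes chi: "chi \<in> Lps p' s'" and w: "w \<in> Lps_Cb p (\<sigma> - s')"
    and p: "1 \<le> p'" "1 \<le> p" "recip p' + recip p \<le> 1"
  shows "majorized (recip p' + recip p)
    (4 * enn2real (Lps_norm scalar_norm p' s' chi) * enn2real (Lps_norm sup_norm p (\<sigma> - s') w))
    (\<lambda>k. ennreal (norm (chi k * sym_part w k 0) * japanese k powr \<sigma>))"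
proof -
  have [measurable]: "japanese \<in> borel_measurable (lebesgue :: (real^'d) measure)"
    by (rule measurable_completion) measurable
  have [measurable]: "chi \<in> borel_measurable lebesgue" using chi by (simp add: Lps_def)
  have wm: "(\<lambda>k. w k \<eta>) \<in> borel_measurable lebesgue" for \<eta> using w by (simp add: Lps_Cb_def)
  have wc: "AE k in lebesgue. continuous_on UNIV (w k)"
    using w by (auto simp: Lps_Cb_def bcontfun_def elim!: eventually_mono)
  note [measurable] = measurable_sup_norm[OF wm wc]
  define S where "S k = ennreal (japanese k powr (\<sigma> - s')) * sup_norm (w k)" for k
  have "(\<lambda>k. ennreal (japanese k powr s') * scalar_norm (chi k)) \<in> borel_measurable lebesgue"
    unfolding scalar_norm_def by measurable
  then have mc: "majorized (recip p') (enn2real (Lps_norm scalar_norm p' s' chi)) (\<lambda>k. ennreal (japanese k powr s') * scalar_norm (chi k))"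
    using chi p(1) unfolding Lps_norm_def by (intro majorized_of_Lp_norm) (auto simp: Lps_def Lps_norm_def)
  have "S \<in> borel_measurable lebesgue" unfolding S_def[abs_def] by measurable
  then have "majorized (recip p) (enn2real (Lps_norm sup_norm p (\<sigma> - s') w)) S"
    using w p(2) unfolding Lps_norm_def S_def[abs_def] by (intro majorized_of_Lp_norm) (auto simp: Lps_Cb_def Lps_norm_def)
  then have "majorized (recip p) (4 * enn2real (Lps_norm sup_norm p (\<sigma> - s') w)) (\<lambda>k. S k + S (- k))"
    using recip_bounds[OF p(2)] by (intro majorized_symmetrize) auto
  from majorized_mult[OF mc this _ _ p(3)] recip_bounds[OF p(1)] recip_bounds[OF p(2)]
  have "majorized (recip p' + recip p)
    (4 * enn2real (Lps_norm scalar_norm p' s' chi) * enn2real (Lps_norm sup_norm p (\<sigma> - s') w))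
    (\<lambda>k. (ennreal (japanese k powr s') * scalar_norm (chi k)) * (S k + S (- k)))"
    by (simp add: mult_ac)
  then show ?thesis
  proof (rule majorized_mono_AE, intro always_eventually allI)
    fix k :: "real^'d"
    let ?J = "japanese k"
    have sup: "ennreal (norm (w k \<eta>)) \<le> sup_norm (w k)" for k :: "real^'d" and \<eta> unfolding sup_norm_def by (rule SUP_upper) simp
    have "norm (w k 0 + cnj (w (- k) (- 0))) \<le> norm (w k 0) + norm (w (- k) 0)"
      using norm_triangle_ineq[of "w k 0" "cnj (w (- k) (- 0))"] by simp
    moreover have "norm (sym_part w k 0) = norm (w k 0 + cnj (w (- k) (- 0))) / 2"
      by (simp add: sym_part_def norm_divide)
    ultimately have "norm (sym_part w k 0) \<le> norm (w k 0) + norm (w (- k) 0)"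
      using norm_ge_zero[of "w k 0 + cnj (w (- k) (- 0))"] by linarith
    then have "norm (chi k * sym_part w k 0) * ?J powr \<sigma> \<le>
       norm (chi k) * (norm (w k 0) + norm (w (- k) 0)) * ?J powr \<sigma>"
      unfolding norm_mult by (intro mult_right_mono mult_left_mono) auto
    also have "\<dots> = norm (chi k) * (norm (w k 0) + norm (w (- k) 0)) * (?J powr s' * ?J powr (\<sigma> - s'))"
      by (simp flip: powr_add)
    also have "\<dots> =
      (?J powr s' * norm (chi k)) * (?J powr (\<sigma> - s') * norm (w k 0) + ?J powr (\<sigma> - s') * norm (w (- k) 0))"
      by (simp add: algebra_simps)
    finally have "ennreal (norm (chi k * sym_part w k 0) * ?J powr \<sigma>) \<le>
      ennreal ((?J powr s' * norm (chi k)) * (?J powr (\<sigma> - s') * norm (w k 0) + ?J powr (\<sigma> - s') * norm (w (- k) 0)))"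
      by (rule ennreal_leI)
    also have "\<dots> = (ennreal (?J powr s') * scalar_norm (chi k)) *
       (ennreal (?J powr (\<sigma> - s')) * ennreal (norm (w k 0)) + ennreal (?J powr (\<sigma> - s')) * ennreal (norm (w (- k) 0)))"
      by (simp add: ennreal_mult scalar_norm_def)
    also have "\<dots> \<le> (ennreal (?J powr s') * scalar_norm (chi k)) * (S k + S (- k))"
      unfolding S_def japanese_minus by (intro mult_left_mono add_mono sup) auto
    finally show "ennreal (norm (chi k * sym_part w k 0) * ?J powr \<sigma>) \<le>
       (ennreal (?J powr s') * scalar_norm (chi k)) * (S k + S (- k))" .
  qed
qed

text \<open>The majorant \<open>T\<close> is a multiple of the convolution of the majorant of the amplitude, which the Hoelder
inequality provides, with that of the symmetrized density of \<open>v\<close>. The factor 32 is the product of 4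
from each of the two symmetrizations and 2 from the definition of the Yukawa map.\<close>

lemma yukawa_majorant:
  fixes chi :: "real^'d \<Rightarrow> complex" and w v :: "(real^'d) \<Rightarrow> (real^'d) \<Rightarrow> complex"
  assumes chi: "chi \<in> Lps p' s'" and w: "w \<in> Lps_Cb p (real l + s + \<iota>' - s')" and v: "v \<in> W \<omega> l q s \<iota>"
    and p: "1 \<le> p'" "1 \<le> p" "1 \<le> q" "1 \<le> r"
    and exps: "recip p' + recip p \<le> 1" "recip p' + recip p + recip q = 1 + recip r"
  obtains T :: "real^'d \<Rightarrow> ennreal" where
    "majorized (recip r) (32 * leibniz_const l * real (card {\<alpha> :: 'd \<Rightarrow> nat. multi_order \<alpha> \<le> l}) / (2 * pi) ^ CARD('d) *
       enn2real (Lps_norm scalar_norm p' s' chi) *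
       enn2real (Lps_norm sup_norm p (real l + s + \<iota>' - s') w) * enn2real (W_norm \<omega> l q s \<iota> v)) T"
    "AE k in lebesgue. T k < top \<and> (\<forall>\<eta>. integrable lebesgue (yukawa_integrand chi w v k \<eta>)) \<and>
       controlled \<omega> l s \<iota> (japanese k) (yukawa chi w v k) (enn2real (T k))"
proof -
  let ?n = "real (card {\<alpha> :: 'd \<Rightarrow> nat. multi_order \<alpha> \<le> l})"
  define x y where "x = recip p' + recip p" and "y = recip q"
  define N where "N = 4 * enn2real (Lps_norm scalar_norm p' s' chi) * enn2real (Lps_norm sup_norm p (real l + s + \<iota>' - s') w)"
  define M where "M = 4 * (?n * enn2real (W_norm \<omega> l q s \<iota> v))"
  have N0: "0 \<le> N" and M0: "0 \<le> M" by (simp_all add: N_def M_def)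
  have "majorized x N (\<lambda>k. ennreal (norm (chi k * sym_part w k 0) * japanese k powr (real l + s + \<iota>')))"
    unfolding x_def N_def by (rule amplitude_majorized[OF chi w p(1,2) exps(1)])
  then obtain F where F: "subunit F"
    and hb: "AE k in lebesgue. ennreal (norm (chi k * sym_part w k 0) * japanese k powr (real l + s + \<iota>')) \<le> ennreal (N * rpow (F k) x)"
    unfolding majorized_def by blast
  have "majorized y M (\<lambda>k. (\<Sum>\<alpha> | multi_order \<alpha> \<le> l. W_density \<omega> l s \<iota> v \<alpha> k) +
       (\<Sum>\<alpha> | multi_order \<alpha> \<le> l. W_density \<omega> l s \<iota> v \<alpha> (- k)))"
    unfolding y_def M_def using recip_bounds[OF p(3)] by (intro majorized_symmetrize W_majorized[OF v p(3)]) auto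
  then obtain G where G: "subunit G"
    and gb: "AE k in lebesgue. (\<Sum>\<alpha> | multi_order \<alpha> \<le> l. W_density \<omega> l s \<iota> v \<alpha> k) +
       (\<Sum>\<alpha> | multi_order \<alpha> \<le> l. W_density \<omega> l s \<iota> v \<alpha> (- k)) \<le> ennreal (M * rpow (G k) y)"
    unfolding majorized_def by blast
  have [measurable]: "F \<in> borel_measurable borel" "G \<in> borel_measurable borel" using F G by (auto simp: subunit_def)
  define h g where "h k = N * rpow (F k) x" and "g k = M * rpow (G k) y" for k
  have hg: "0 \<le> h k" "0 \<le> g k" for k using N0 M0 by (auto simp: h_def g_def)
  have [measurable]: "h \<in> borel_measurable borel" "g \<in> borel_measurable borel" unfolding h_def g_def by measurable
  have hb': "AE k in lebesgue. norm (chi k * sym_part w k 0) * japanese k powr (real l + s + \<iota>') \<le> h k"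
    using hb by eventually_elim (use hg in \<open>simp add: h_def\<close>)
  have C: "AE k in lebesgue. C_n l (v k)" using v by (auto simp: W_def elim!: eventually_mono)
  have gb': "AE k in lebesgue. controlled \<omega> l s \<iota> (japanese k) (sym_part v k) (g k)"
    using gb hg unfolding g_def by (intro controlled_sym_part[OF C]) auto
  define cv where "cv k = (\<integral>\<^sup>+k'. ennreal (h k' * g (k - k')) \<partial>lborel)" for k
  have cv: "cv k = ennreal (N * M) * (\<integral>\<^sup>+k'. ennreal (rpow (F k') x * rpow (G (k - k')) y) \<partial>lborel)" for k
    unfolding cv_def using N0 M0
    by (subst nn_integral_cmult[symmetric]) (auto simp: h_def g_def ennreal_mult[symmetric] mult_ac)
  have "majorized (recip r) 1 (\<lambda>k. \<integral>\<^sup>+k'. ennreal (rpow (F k') x * rpow (G (k - k')) y) \<partial>lborel)"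
    using exps recip_bounds[OF p(3)] recip_bounds[OF p(4)]
    by (intro majorized_convolution[OF F G]) (auto simp: x_def y_def)
  then have mcv: "majorized (recip r) (N * M * 1) cv"
    unfolding cv[abs_def] using N0 M0 by (intro majorized_cmult) auto
  define a where "a = 2 / (2 * pi) ^ CARD('d) * leibniz_const l"
  have a0: "0 \<le> a" by (simp add: a_def leibniz_const_nonneg)
  show thesis
  proof (rule that[of "\<lambda>k. ennreal a * cv k"])
    have "majorized (recip r) (a * (N * M * 1)) (\<lambda>k. ennreal a * cv k)" by (rule majorized_cmult[OF mcv a0])
    moreover have "a * (N * M * 1) = 32 * leibniz_const l * ?n / (2 * pi) ^ CARD('d) *
       enn2real (Lps_norm scalar_norm p' s' chi) *
       enn2real (Lps_norm sup_norm p (real l + s + \<iota>' - s') w) * enn2real (W_norm \<omega> l q s \<iota> v)"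
      by (simp add: a_def N_def M_def)
    ultimately show "majorized (recip r) (32 * leibniz_const l * ?n / (2 * pi) ^ CARD('d) *
       enn2real (Lps_norm scalar_norm p' s' chi) *
       enn2real (Lps_norm sup_norm p (real l + s + \<iota>' - s') w) * enn2real (W_norm \<omega> l q s \<iota> v)) (\<lambda>k. ennreal a * cv k)"
      by (simp only:)
    show "AE k in lebesgue. ennreal a * cv k < top \<and> (\<forall>\<eta>. integrable lebesgue (yukawa_integrand chi w v k \<eta>)) \<and>
       controlled \<omega> l s \<iota> (japanese k) (yukawa chi w v k) (enn2real (ennreal a * cv k))"
      using majorized_finite[OF mcv]
    proof eventually_elim
      case (elim k)
      note Y = yukawa_controlled[of chi w v h g l k, OF _ _ _ _ _ hb' gb' hg elim[unfolded cv_def]]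
      have meas: "chi \<in> borel_measurable lebesgue" "\<And>\<eta>. (\<lambda>k. w k \<eta>) \<in> borel_measurable lebesgue" "\<And>\<eta>. (\<lambda>k. v k \<eta>) \<in> borel_measurable lebesgue"
        using chi w v by (simp_all add: Lps_def Lps_Cb_def W_def)
      have "enn2real (ennreal a * cv k) = 2 / (2 * pi) ^ CARD('d) * (leibniz_const l * enn2real (cv k))"
        using a0 by (simp add: enn2real_mult a_def)
      then show ?case using Y meas elim by (simp add: ennreal_mult_less_top cv_def[symmetric])
    qed
  qed
qed

text \<open>One of the factors \<open>n\<close> counts the multi-indices over which the norm of the value sums; the other one, as well as
the 32, comes from the majorant. The remaining 2 is due to the two terms of the density.\<close>

lemma yukawa_W:
  fixes chi :: "real^'d \<Rightarrow> complex" and w v :: "(real^'d) \<Rightarrow> (real^'d) \<Rightarrow> complex"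
  assumes chi: "chi \<in> Lps p' s'" and w: "w \<in> Lps_Cb p (real l + s + \<iota>' - s')" and v: "v \<in> W \<omega> l q s \<iota>"
    and p: "1 \<le> p'" "1 \<le> p" "1 \<le> q" "1 \<le> r"
    and exps: "recip p' + recip p \<le> 1" "recip p' + recip p + recip q = 1 + recip r"
  defines "n \<equiv> real (card {\<alpha> :: 'd \<Rightarrow> nat. multi_order \<alpha> \<le> l})"
  shows "AE k in lebesgue. \<forall>\<eta>. integrable lebesgue (yukawa_integrand chi w v k \<eta>)"
    and "yukawa chi w v \<in> W \<omega> l r s \<iota>"
    and "W_norm \<omega> l r s \<iota> (yukawa chi w v) \<le> ennreal (64 * leibniz_const l * n\<^sup>2 / (2 * pi) ^ CARD('d)) *
      Lps_norm scalar_norm p' s' chi * Lps_norm sup_norm p (real l + s + \<iota>' - s') w * W_norm \<omega> l q s \<iota> v"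
proof -
  let ?A = "{\<alpha> :: 'd \<Rightarrow> nat. multi_order \<alpha> \<le> l}"
  define Q where "Q = enn2real (Lps_norm scalar_norm p' s' chi) *
       enn2real (Lps_norm sup_norm p (real l + s + \<iota>' - s') w) * enn2real (W_norm \<omega> l q s \<iota> v)"
  define K where "K = 32 * leibniz_const l * n / (2 * pi) ^ CARD('d)"
  have Q0: "0 \<le> Q" by (simp add: Q_def)
  have K0: "0 \<le> K" by (simp add: K_def n_def leibniz_const_nonneg)
  obtain T where T: "majorized (recip r) (K * Q) T"
    and Y: "AE k in lebesgue. T k < top \<and> (\<forall>\<eta>. integrable lebesgue (yukawa_integrand chi w v k \<eta>)) \<and>
       controlled \<omega> l s \<iota> (japanese k) (yukawa chi w v k) (enn2real (T k))"
    using yukawa_majorant[OF chi w v p exps] unfolding K_def Q_def n_def mult.assoc by blast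
  show "AE k in lebesgue. \<forall>\<eta>. integrable lebesgue (yukawa_integrand chi w v k \<eta>)"
    using Y by eventually_elim blast
  have fin: "Lps_norm scalar_norm p' s' chi < top" "Lps_norm sup_norm p (real l + s + \<iota>' - s') w < top" "W_norm \<omega> l q s \<iota> v < top"
    using chi w v by (simp_all add: Lps_def Lps_Cb_def W_def)
  have meas: "(\<lambda>k. yukawa chi w v k \<eta>) \<in> borel_measurable lebesgue" for \<eta>
    using chi w v by (intro measurable_yukawa) (simp_all add: Lps_def Lps_Cb_def W_def)
  have C: "AE k in lebesgue. C_n l (yukawa chi w v k)"
    using Y by eventually_elim (blast dest: controlledD(1))
  have Cb: "AE k in lebesgue. \<forall>\<alpha>. multi_order \<alpha> \<le> l \<longrightarrow> multi_diff \<alpha> (yukawa chi w v k) \<in> Cb_modulus \<omega>"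
    using Y
  proof eventually_elim
    case (elim k)
    then show ?case using Cb_modulus_of_controlled[where \<omega> = \<omega>, OF _ japanese_ge_1 s(1,2) _ \<omega>_pos] by blast
  qed
  have D: "Lp_norm r (W_density \<omega> l s \<iota> (yukawa chi w v) \<alpha>) \<le> ennreal (2 * (K * Q))" if \<alpha>: "multi_order \<alpha> \<le> l" for \<alpha>
  proof (rule Lp_norm_le_of_majorized[OF measurable_W_density[OF meas C \<omega> \<omega>_pos \<alpha>] p(4)])
    show "majorized (recip r) (2 * (K * Q)) (W_density \<omega> l s \<iota> (yukawa chi w v) \<alpha>)"
    proof (rule majorized_mono_AE[OF majorized_cmult[OF T]])
      show "AE k in lebesgue. W_density \<omega> l s \<iota> (yukawa chi w v) \<alpha> k \<le> ennreal 2 * T k"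
        using Y
      proof eventually_elim
        case (elim k)
        then have "W_density \<omega> l s \<iota> (yukawa chi w v) \<alpha> k \<le> ennreal (2 * enn2real (T k))"
          by (intro W_density_le_of_controlled[where \<omega> = \<omega>, OF _ \<alpha> \<omega>_pos]) auto
        also have "\<dots> = ennreal 2 * T k" using elim by (simp add: ennreal_mult)
        finally show ?case .
      qed
    qed simp
  qed
  have "W_norm \<omega> l r s \<iota> (yukawa chi w v) \<le> (\<Sum>\<alpha>\<in>?A. ennreal (2 * (K * Q)))"
    unfolding W_norm_density using D by (intro sum_mono) auto
  also have "\<dots> = ennreal (n * (2 * (K * Q)))"
    using K0 Q0 by (simp add: n_def ennreal_of_nat_eq_real_of_nat ennreal_mult)
  also have "n * (2 * (K * Q)) = (64 * leibniz_const l * n\<^sup>2 / (2 * pi) ^ CARD('d)) * Q"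
    by (simp add: K_def power2_eq_square)
  also have "ennreal \<dots> = ennreal (64 * leibniz_const l * n\<^sup>2 / (2 * pi) ^ CARD('d)) *
      Lps_norm scalar_norm p' s' chi * Lps_norm sup_norm p (real l + s + \<iota>' - s') w * W_norm \<omega> l q s \<iota> v"
  proof -
    have "ennreal Q = Lps_norm scalar_norm p' s' chi * Lps_norm sup_norm p (real l + s + \<iota>' - s') w * W_norm \<omega> l q s \<iota> v"
      unfolding Q_def using fin by (simp add: ennreal_mult)
    then show ?thesis
      using leibniz_const_nonneg[of l] Q0 by (subst ennreal_mult) (auto simp: mult.assoc)
  qed
  finally show N: "W_norm \<omega> l r s \<iota> (yukawa chi w v) \<le> ennreal (64 * leibniz_const l * n\<^sup>2 / (2 * pi) ^ CARD('d)) *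
      Lps_norm scalar_norm p' s' chi * Lps_norm sup_norm p (real l + s + \<iota>' - s') w * W_norm \<omega> l q s \<iota> v" .
  have "\<dots> < top" using fin by (auto simp: ennreal_mult_less_top)
  with N have "W_norm \<omega> l r s \<iota> (yukawa chi w v) < top" by (rule le_less_trans)
  then show "yukawa chi w v \<in> W \<omega> l r s \<iota>"
    using meas C Cb by (auto simp: W_def)
qed

end

lemma yukawa_linear_left:
  fixes w\<^sub>1 w\<^sub>2 v :: "(real^'d) \<Rightarrow> (real^'d) \<Rightarrow> complex" and a b :: real
  assumes "integrable lebesgue (yukawa_integrand chi w\<^sub>1 v k \<eta>)" "integrable lebesgue (yukawa_integrand chi w\<^sub>2 v k \<eta>)"
  shows "yukawa chi (\<lambda>k \<eta>. a *\<^sub>R w\<^sub>1 k \<eta> + b *\<^sub>R w\<^sub>2 k \<eta>) v k \<eta> = a *\<^sub>R yukawa chi w\<^sub>1 v k \<eta> + b *\<^sub>R yukawa chi w\<^sub>2 v k \<eta>"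
proof -
  have "yukawa_integrand chi (\<lambda>k \<eta>. a *\<^sub>R w\<^sub>1 k \<eta> + b *\<^sub>R w\<^sub>2 k \<eta>) v k \<eta> =
     (\<lambda>k'. a *\<^sub>R yukawa_integrand chi w\<^sub>1 v k \<eta> k' + b *\<^sub>R yukawa_integrand chi w\<^sub>2 v k \<eta> k')"
    by (simp add: yukawa_integrand_def sym_part_def scaleR_conv_of_real fun_eq_iff algebra_simps add_divide_distrib)
  then show ?thesis using assms by (simp add: yukawa_def scaleR_conv_of_real algebra_simps)
qed

lemma yukawa_linear_right:
  fixes w v\<^sub>1 v\<^sub>2 :: "(real^'d) \<Rightarrow> (real^'d) \<Rightarrow> complex" and a b :: real
  assumes "integrable lebesgue (yukawa_integrand chi w v\<^sub>1 k \<eta>)" "integrable lebesgue (yukawa_integrand chi w v\<^sub>2 k \<eta>)"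
  shows "yukawa chi w (\<lambda>k \<eta>. a *\<^sub>R v\<^sub>1 k \<eta> + b *\<^sub>R v\<^sub>2 k \<eta>) k \<eta> = a *\<^sub>R yukawa chi w v\<^sub>1 k \<eta> + b *\<^sub>R yukawa chi w v\<^sub>2 k \<eta>"
proof -
  have "yukawa_integrand chi w (\<lambda>k \<eta>. a *\<^sub>R v\<^sub>1 k \<eta> + b *\<^sub>R v\<^sub>2 k \<eta>) k \<eta> =
     (\<lambda>k'. a *\<^sub>R yukawa_integrand chi w v\<^sub>1 k \<eta> k' + b *\<^sub>R yukawa_integrand chi w v\<^sub>2 k \<eta> k')"
    by (simp add: yukawa_integrand_def sym_part_def scaleR_conv_of_real fun_eq_iff algebra_simps add_divide_distrib)
  then show ?thesis using assms by (simp add: yukawa_def scaleR_conv_of_real algebra_simps)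
qed

theorem lemma9:
  fixes p' p q r :: ennreal and s' s \<iota>' \<iota> c z\<^sub>0 :: real and l :: nat and \<omega> :: "real \<Rightarrow> real"
  assumes "1 \<le> p'"
    and "concave_modulus \<omega>"
    and "0 < \<iota>'" "\<iota>' \<le> 1"
    and "0 < c" "0 < z\<^sub>0" "\<forall>z\<in>{0..z\<^sub>0}. c * z powr \<iota>' \<le> \<omega> z"
    and "0 \<le> s" "0 \<le> \<iota>" "\<iota> \<le> \<iota>'"
    and "1 \<le> p" "1 \<le> q" "1 \<le> r"
    and "1 / p' + 1 / p + 1 / q = 1 + 1 / r"
    and "1 / p' + 1 / p \<le> 1"
  shows
    "(\<forall>chi \<in> (Lps p' s' :: (real^'d \<Rightarrow> complex) set).
        (\<forall>w \<in> Lps_Cb p (real l + s - s' + \<iota>'). \<forall>v \<in> W \<omega> l q s \<iota>.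
           (AE k in lebesgue. \<forall>\<eta>. integrable lebesgue (yukawa_integrand chi w v k \<eta>)) \<and>
           yukawa chi w v \<in> W \<omega> l r s \<iota>) \<and>
        (\<forall>w\<^sub>1 \<in> Lps_Cb p (real l + s - s' + \<iota>'). \<forall>w\<^sub>2 \<in> Lps_Cb p (real l + s - s' + \<iota>').
         \<forall>v \<in> W \<omega> l q s \<iota>. \<forall>a b :: real.
           AE k in lebesgue. \<forall>\<eta>. yukawa chi (\<lambda>k \<eta>. a *\<^sub>R w\<^sub>1 k \<eta> + b *\<^sub>R w\<^sub>2 k \<eta>) v k \<eta> =
             a *\<^sub>R yukawa chi w\<^sub>1 v k \<eta> + b *\<^sub>R yukawa chi w\<^sub>2 v k \<eta>) \<and>
        (\<forall>w \<in> Lps_Cb p (real l + s - s' + \<iota>'). \<forall>v\<^sub>1 \<in> W \<omega> l q s \<iota>. \<forall>v\<^sub>2 \<in> W \<omega> l q s \<iota>. \<forall>a b :: real.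
           AE k in lebesgue. \<forall>\<eta>. yukawa chi w (\<lambda>k \<eta>. a *\<^sub>R v\<^sub>1 k \<eta> + b *\<^sub>R v\<^sub>2 k \<eta>) k \<eta> =
             a *\<^sub>R yukawa chi w v\<^sub>1 k \<eta> + b *\<^sub>R yukawa chi w v\<^sub>2 k \<eta>)) \<and>
     (\<exists>C\<ge>0. \<forall>chi \<in> (Lps p' s' :: (real^'d \<Rightarrow> complex) set).
        \<forall>w \<in> Lps_Cb p (real l + s - s' + \<iota>'). \<forall>v \<in> W \<omega> l q s \<iota>.
          W_norm \<omega> l r s \<iota> (yukawa chi w v) \<le>
            ennreal C * Lps_norm scalar_norm p' s' chi *
            Lps_norm sup_norm p (real l + s - s' + \<iota>') w * W_norm \<omega> l q s \<iota> v)"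
proof -
  interpret modulus_setting \<omega> \<iota>' c z\<^sub>0 s \<iota> by unfold_locales fact+
  have rn: "0 \<le> recip p'" "0 \<le> recip p" "0 \<le> recip q" "0 \<le> recip r"
    using recip_bounds assms(1,11,12,13) by blast+
  have "ennreal (recip p' + recip p + recip q) = ennreal (1 + recip r)"
    using assms(14) rn by (simp add: ennreal_recip assms(1,11,12,13))
  then have e2: "recip p' + recip p + recip q = 1 + recip r"
    using rn by (subst (asm) ennreal_inj) auto
  have "ennreal (recip p' + recip p) \<le> ennreal 1"
    using assms(15) rn by (simp add: ennreal_recip assms(1,11))
  then have e1: "recip p' + recip p \<le> 1"
    by (subst (asm) ennreal_le_iff) auto
  have weight: "real l + s - s' + \<iota>' = real l + s + \<iota>' - s'" by simp
  note Y = yukawa_W[OF _ _ _ assms(1,11,12,13) e1 e2, where 'd = 'd and l = l and s' = s', folded weight]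
  let ?C = "64 * leibniz_const l * (real (card {\<alpha> :: 'd \<Rightarrow> nat. multi_order \<alpha> \<le> l}))\<^sup>2 / (2 * pi) ^ CARD('d)"
  have C0: "0 \<le> ?C" using leibniz_const_nonneg[of l] by simp
  have left: "AE k in lebesgue. \<forall>\<eta>. yukawa chi (\<lambda>k \<eta>. a *\<^sub>R w\<^sub>1 k \<eta> + b *\<^sub>R w\<^sub>2 k \<eta>) v k \<eta> =
             a *\<^sub>R yukawa chi w\<^sub>1 v k \<eta> + b *\<^sub>R yukawa chi w\<^sub>2 v k \<eta>"
    if "chi \<in> Lps p' s'" "w\<^sub>1 \<in> Lps_Cb p (real l + s - s' + \<iota>')" "w\<^sub>2 \<in> Lps_Cb p (real l + s - s' + \<iota>')" "v \<in> W \<omega> l q s \<iota>"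
    for chi :: "real^'d \<Rightarrow> complex" and w\<^sub>1 w\<^sub>2 v and a b :: real
    using Y(1)[OF that(1,2,4)] Y(1)[OF that(1,3,4)] by eventually_elim (blast intro: yukawa_linear_left)
  have right: "AE k in lebesgue. \<forall>\<eta>. yukawa chi w (\<lambda>k \<eta>. a *\<^sub>R v\<^sub>1 k \<eta> + b *\<^sub>R v\<^sub>2 k \<eta>) k \<eta> =
             a *\<^sub>R yukawa chi w v\<^sub>1 k \<eta> + b *\<^sub>R yukawa chi w v\<^sub>2 k \<eta>"
    if "chi \<in> Lps p' s'" "w \<in> Lps_Cb p (real l + s - s' + \<iota>')" "v\<^sub>1 \<in> W \<omega> l q s \<iota>" "v\<^sub>2 \<in> W \<omega> l q s \<iota>"
    for chi :: "real^'d \<Rightarrow> complex" and w v\<^sub>1 v\<^sub>2 and a b :: real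
    using Y(1)[OF that(1,2,3)] Y(1)[OF that(1,2,4)] by eventually_elim (blast intro: yukawa_linear_right)
  show ?thesis
    by (intro conjI ballI allI exI[of _ ?C] C0 Y left right)
qed

end
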